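(* Let $\mu$ be a centered probability measure on $\mathbb{R}$, $\mu\neq\delta_0$, with bounded support. Let $F:\{(w,s)\in\mathbb{R}\times\mathbb{R}_+: w\le s\}\to\mathbb{R}_+$ be continuous, such that the partial derivative $F_s$ exists and is continuous, and suppose that $F$ satisfies F-MON$\downarrow$: for each $s$, $w\mapsto F_s(w,s)/(s-w)$ is nonincreasing in $w$ ($w<s$). Then $$\inf_{\tau\in\mathcal{S}_{\mathrm{UI}}(W,\mu)}\mathbb{E}[F(W_\tau,S_\tau)]=\mathbb{E}\big[F(W_{\tau^{\mathrm{AY}}_\mu},S_{\tau^{\mathrm{AY}}_\mu})\big],$$ $$\sup_{\tau\in\mathcal{S}_{\mathrm{UI}}(W,\mu)}\mathbb{E}[F(W_\tau,S_\tau)]=\mathbb{E}\big[F(W_{\tau^{\mathrm{P}}_\mu},S_{\tau^{\mathrm{P}}_\mu})\big].$$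
   Context: $\mathbb{R}_+=[0,\infty)$, $\mathbb{R}_-=(-\infty,0]$. $(\Omega,\mathcal{F},(\mathcal{F}_t),\mathbb{P})$ is a filtered probability space satisfying the usual conditions, supporting an $(\mathcal{F}_t)$-Brownian motion $W$ with $W_0=0$, and such that there is an $\mathcal{F}_0$-measurable uniform $[0,1]$ random variable independent of $W$. $S_t=\sup_{u\le t}W_u$, $I_t=\inf_{u\le t}W_u$. A probability measure $\mu$ is centered if $\int|x|\mu(dx)<\infty$ and $\int x\mu(dx)=0$. $\mathcal{S}(W,\mu)$ is the set of stopping times $\tau$ with $W_\tau\sim\mu$; $\mathcal{S}_{\mathrm{UI}}(W,\mu)$ is the subset of those for which $(W_{t\wedge\tau})_{t\ge0}$ is uniformly integrable. For $X_\mu\sim\mu$: $C(x)=\mathbb{E}[(X_\mu-x)^+]$, $P(x)=\mathbb{E}[(x-X_\mu)^+]$, $\hat x=\sup\{x:C(x)>0\}$, $\check x=\inf\{x:P(x)>0\}$. Azéma–Yor embedding: for $0\le x<\hat x$, $\beta(x)=\arg\min_{y<x}\frac{C(y)}{x-y}$ (the largest minimizer; $\beta(0)=\check x$), and $\beta(x)=x$ for $x\ge\hat x$. $\tau^{\mathrm{AY}}_\mu=\inf\{u: W_u\le\beta(S_u)\}$. Perkins embedding: for $0<x<\hat x$, $\alpha^+(x)=\arg\max_{y<0}\frac{C(x)-P(y)}{x-y}$, and for $\check x<x<0$, $\alpha^-(x)=\arg\max_{y>0}\frac{P(x)-C(y)}{y-x}$, in each case the maximizer largest in modulus; $\alpha^+(x)=-\infty$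 for $x\ge\hat x$, $\alpha^-(x)=+\infty$ for $x\le\check x$. $\tau_{\alpha}=\inf\{u>0:W_u\le\alpha^+(S_u)\}\wedge\inf\{u>0:W_u\ge\alpha^-(I_u)\}$. If $\mu(\{0\})=0$ then $\tau^{\mathrm{P}}_\mu=\tau_\alpha$; in general, with $Z$ an $\mathcal{F}_0$-measurable uniform $[0,1]$ random variable independent of $W$, $\tau^{\mathrm{P}}_\mu=0$ if $Z\le\mu(\{0\})$ and $\tau^{\mathrm{P}}_\mu=\tau_\alpha$ if $Z>\mu(\{0\})$. Both $\tau^{\mathrm{AY}}_\mu$ and $\tau^{\mathrm{P}}_\mu$ are known to belong to $\mathcal{S}_{\mathrm{UI}}(W,\mu)$. *)

theory Defs
  imports "HOL-Probability.Probability"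
begin

section \<open>Filtered probability space, Brownian motion, Skorokhod embeddings\<close>

text \<open>
  Filtrations are indexed by \<^typ>\<open>ennreal\<close>, so that stopping times in \<open>[0, \<infinity>]\<close> are stopping times in
  the sense of the library.  The terminal \<open>\<sigma>\<close>-algebra \<open>\<F> \<top>\<close> is an arbitrary one lying between all the
  \<open>\<F> t\<close> with \<open>t < \<top>\<close> and \<open>M\<close>; nothing depends on its choice, since \<open>\<tau> \<le> \<top>\<close> always holds.
  Processes are indexed by \<^typ>\<open>real\<close>, and only their values at times \<open>t \<ge> 0\<close> matter.
\<close>

locale usual_filtered_prob_space =
  prob_space M + complete_measure M + filtration "space M" \<F>
  for M :: "'a measure" and \<F> :: "ennreal \<Rightarrow> 'a measure" +
  assumes subalgebra_F: "subalgebra M (\<F> t)"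
    and null_sets_F: "null_sets M \<subseteq> sets (\<F> 0)"
    and right_continuous_F: "t < \<top> \<Longrightarrow> sets (\<F> t) = (\<Inter>s\<in>{t<..}. sets (\<F> s))"

definition brownian_motion ::
  "'a measure \<Rightarrow> (ennreal \<Rightarrow> 'a measure) \<Rightarrow> (real \<Rightarrow> 'a \<Rightarrow> real) \<Rightarrow> bool" where
  "brownian_motion M \<F> W \<longleftrightarrow>
     (\<forall>t\<ge>0. W t \<in> borel_measurable (\<F> (ennreal t))) \<and>
     (AE \<omega> in M. W 0 \<omega> = 0) \<and>
     (AE \<omega> in M. continuous_on {0..} (\<lambda>t. W t \<omega>)) \<and>
     (\<forall>s t. 0 \<le> s \<longrightarrow> s < t \<longrightarrow>
        distributed M lborel (\<lambda>\<omega>. W t \<omega> - W s \<omega>)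
          (\<lambda>x. ennreal (normal_density 0 (sqrt (t - s)) x)) \<and>
        prob_space.indep_set M
          (sets (\<F> (ennreal s)))
          (sets (vimage_algebra (space M) (\<lambda>\<omega>. W t \<omega> - W s \<omega>) borel)))"

definition uniform_rv :: "'a measure \<Rightarrow> ('a \<Rightarrow> real) \<Rightarrow> bool" where
  "uniform_rv M Z \<longleftrightarrow>
     Z \<in> borel_measurable M \<and> distr M borel Z = uniform_measure lborel {0..1}"

text \<open>Independence of a random variable and a whole process \<open>(W\<^sub>t)\<close>, \<open>t \<ge> 0\<close>.\<close>

definition indep_of_process ::
  "'a measure \<Rightarrow> ('a \<Rightarrow> real) \<Rightarrow> (real \<Rightarrow> 'a \<Rightarrow> real) \<Rightarrow> bool" where
  "indep_of_process M Z W \<longleftrightarrow>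
     prob_space.indep_set M
       (sets (vimage_algebra (space M) Z borel))
       (sets (vimage_algebra (space M) (\<lambda>\<omega>. \<lambda>t\<in>{0..}. W t \<omega>) (PiM {0..} (\<lambda>_. borel))))"

definition running_sup :: "(real \<Rightarrow> 'a \<Rightarrow> real) \<Rightarrow> real \<Rightarrow> 'a \<Rightarrow> real" where
  "running_sup W t \<omega> = (SUP u\<in>{0..t}. W u \<omega>)"

definition running_inf :: "(real \<Rightarrow> 'a \<Rightarrow> real) \<Rightarrow> real \<Rightarrow> 'a \<Rightarrow> real" where
  "running_inf W t \<omega> = (INF u\<in>{0..t}. W u \<omega>)"

text \<open>
  The value of a process at a random time.  On \<open>\<tau> = \<top>\<close> this is the value at time \<open>0\<close>, because
  \<open>enn2real \<top> = 0\<close>; finiteness of \<open>\<tau>\<close> is therefore required wherever it is used.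
\<close>

definition at_time :: "(real \<Rightarrow> 'a \<Rightarrow> real) \<Rightarrow> ('a \<Rightarrow> ennreal) \<Rightarrow> 'a \<Rightarrow> real" where
  "at_time X \<tau> \<omega> = X (enn2real (\<tau> \<omega>)) \<omega>"

definition stopped_process ::
  "(real \<Rightarrow> 'a \<Rightarrow> real) \<Rightarrow> ('a \<Rightarrow> ennreal) \<Rightarrow> real \<Rightarrow> 'a \<Rightarrow> real" where
  "stopped_process X \<tau> t \<omega> = at_time X (\<lambda>\<omega>. min (ennreal t) (\<tau> \<omega>)) \<omega>"

definition uniformly_integrable ::
  "'a measure \<Rightarrow> 'i set \<Rightarrow> ('i \<Rightarrow> 'a \<Rightarrow> real) \<Rightarrow> bool" where
  "uniformly_integrable M I X \<longleftrightarrow>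
     (\<forall>i\<in>I. X i \<in> borel_measurable M) \<and>
     ((\<lambda>K::real. SUP i\<in>I. \<integral>\<^sup>+\<omega>. ennreal \<bar>X i \<omega>\<bar> * indicator {\<omega>. K < \<bar>X i \<omega>\<bar>} \<omega> \<partial>M)
        \<longlongrightarrow> 0) at_top"

definition embeddings ::
  "'a measure \<Rightarrow> (ennreal \<Rightarrow> 'a measure) \<Rightarrow> (real \<Rightarrow> 'a \<Rightarrow> real) \<Rightarrow> real measure \<Rightarrow> ('a \<Rightarrow> ennreal) set" where
  "embeddings M \<F> W \<mu> =
     {\<tau>. stopping_time \<F> \<tau> \<and> (AE \<omega> in M. \<tau> \<omega> < \<top>) \<and>
         at_time W \<tau> \<in> borel_measurable M \<and> distr M borel (at_time W \<tau>) = \<mu>}"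

definition ui_embeddings ::
  "'a measure \<Rightarrow> (ennreal \<Rightarrow> 'a measure) \<Rightarrow> (real \<Rightarrow> 'a \<Rightarrow> real) \<Rightarrow> real measure \<Rightarrow> ('a \<Rightarrow> ennreal) set" where
  "ui_embeddings M \<F> W \<mu> =
     {\<tau> \<in> embeddings M \<F> W \<mu>. uniformly_integrable M {0..} (stopped_process W \<tau>)}"


section \<open>The target law\<close>

definition centered :: "real measure \<Rightarrow> bool" where
  "centered \<mu> \<longleftrightarrow> integrable \<mu> (\<lambda>x. x) \<and> (\<integral>x. x \<partial>\<mu>) = 0"

definition measure_support :: "'b::topological_space measure \<Rightarrow> 'b set" where
  "measure_support \<mu> = {x. \<forall>U. open U \<longrightarrow> x \<in> U \<longrightarrow> 0 < emeasure \<mu> U}"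

definition call :: "real measure \<Rightarrow> real \<Rightarrow> real" where
  "call \<mu> x = (\<integral>y. max (y - x) 0 \<partial>\<mu>)"

definition put :: "real measure \<Rightarrow> real \<Rightarrow> real" where
  "put \<mu> x = (\<integral>y. max (x - y) 0 \<partial>\<mu>)"

definition upper_end :: "real measure \<Rightarrow> ereal" where
  "upper_end \<mu> = Sup (ereal ` {x. 0 < call \<mu> x})"

definition lower_end :: "real measure \<Rightarrow> ereal" where
  "lower_end \<mu> = Inf (ereal ` {x. 0 < put \<mu> x})"


section \<open>The Azema--Yor embedding\<close>

text \<open>Only arguments \<open>x \<ge> 0\<close> matter, as \<open>S \<ge> 0\<close>.\<close>

definition AY_beta :: "real measure \<Rightarrow> real \<Rightarrow> ereal" where
  "AY_beta \<mu> x =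
     (if upper_end \<mu> \<le> ereal x then ereal x
      else if x = 0 then lower_end \<mu>
      else ereal (GREATEST y. is_arg_min (\<lambda>y. call \<mu> y / (x - y)) (\<lambda>y. y < x) y))"

definition tau_AY :: "real measure \<Rightarrow> (real \<Rightarrow> 'a \<Rightarrow> real) \<Rightarrow> 'a \<Rightarrow> ennreal" where
  "tau_AY \<mu> W \<omega> =
     Inf (ennreal ` {u. 0 \<le> u \<and> ereal (W u \<omega>) \<le> AY_beta \<mu> (running_sup W u \<omega>)})"


section \<open>The Perkins embedding\<close>

text \<open>
  The maximizer largest in modulus is the least one among negative numbers and the greatest one
  among positive numbers.  The values of \<open>\<alpha>\<^sup>+\<close> at \<open>x \<le> 0\<close> and of \<open>\<alpha>\<^sup>-\<close> at \<open>x \<ge> 0\<close> are a convention without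
  effect, as almost surely \<open>I\<^sub>u < 0 < S\<^sub>u\<close> for all \<open>u > 0\<close>.
\<close>

definition perkins_alpha_plus :: "real measure \<Rightarrow> real \<Rightarrow> ereal" where
  "perkins_alpha_plus \<mu> x =
     (if 0 < x \<and> ereal x < upper_end \<mu>
      then ereal (LEAST y. is_arg_max (\<lambda>y. (call \<mu> x - put \<mu> y) / (x - y)) (\<lambda>y. y < 0) y)
      else -\<infinity>)"

definition perkins_alpha_minus :: "real measure \<Rightarrow> real \<Rightarrow> ereal" where
  "perkins_alpha_minus \<mu> x =
     (if lower_end \<mu> < ereal x \<and> x < 0
      then ereal (GREATEST y. is_arg_max (\<lambda>y. (put \<mu> x - call \<mu> y) / (y - x)) (\<lambda>y. 0 < y) y)
      else \<infinity>)"

definition tau_alpha :: "real measure \<Rightarrow> (real \<Rightarrow> 'a \<Rightarrow> real) \<Rightarrow> 'a \<Rightarrow> ennreal" where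
  "tau_alpha \<mu> W \<omega> =
     min (Inf (ennreal ` {u. 0 < u \<and> ereal (W u \<omega>) \<le> perkins_alpha_plus \<mu> (running_sup W u \<omega>)}))
         (Inf (ennreal ` {u. 0 < u \<and> perkins_alpha_minus \<mu> (running_inf W u \<omega>) \<le> ereal (W u \<omega>)}))"

definition tau_perkins ::
  "real measure \<Rightarrow> (real \<Rightarrow> 'a \<Rightarrow> real) \<Rightarrow> ('a \<Rightarrow> real) \<Rightarrow> 'a \<Rightarrow> ennreal" where
  "tau_perkins \<mu> W Z \<omega> =
     (if measure \<mu> {0} = 0 then tau_alpha \<mu> W \<omega>
      else if Z \<omega> \<le> measure \<mu> {0} then 0
      else tau_alpha \<mu> W \<omega>)"


section \<open>Payoffs\<close>

definition payoff_domain :: "(real \<times> real) set" where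
  "payoff_domain = {(w, s). 0 \<le> s \<and> w \<le> s}"

text \<open>
  \<open>Fs\<close> is the partial derivative of \<open>F\<close> in its second argument, on all of the domain; where
  \<open>s = max w 0\<close> it is the right derivative, the only one that makes sense there.
\<close>

definition has_partial_s :: "(real \<times> real \<Rightarrow> real) \<Rightarrow> (real \<times> real \<Rightarrow> real) \<Rightarrow> bool" where
  "has_partial_s F Fs \<longleftrightarrow>
     (\<forall>(w, s) \<in> payoff_domain.
        ((\<lambda>r. F (w, r)) has_real_derivative Fs (w, s)) (at s within {r. (w, r) \<in> payoff_domain}))"

definition F_MON_down :: "(real \<times> real \<Rightarrow> real) \<Rightarrow> bool" where
  "F_MON_down Fs \<longleftrightarrow> (\<forall>s\<ge>0. antimono_on {..<s} (\<lambda>w. Fs (w, s) / (s - w)))"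

definition expected_payoff ::
  "'a measure \<Rightarrow> (real \<Rightarrow> 'a \<Rightarrow> real) \<Rightarrow> (real \<times> real \<Rightarrow> real) \<Rightarrow> ('a \<Rightarrow> ennreal) \<Rightarrow> ennreal" where
  "expected_payoff M W F \<tau> =
     (\<integral>\<^sup>+\<omega>. ennreal (F (at_time W \<tau> \<omega>, at_time (running_sup W) \<tau> \<omega>)) \<partial>M)"

end

theory Submission
  imports Defs "HOL-Real_Asymp.Real_Asymp"
begin

text \<open>
  The first term in \<open>F (W, S) = F (W, max W 0) + (integral of F\<^sub>s (W, s) over max W 0 < s < S)\<close> has the same
  expectation for every embedding, so each level \<open>s\<close> can be optimised separately
  (\<open>payoff_layers\<close>).  At level \<open>s\<close> the quantity of interest is the integral of \<open>F\<^sub>s (w, s) / (s - w)\<close>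
  against the measure \<open>(s - w) P (W \<in> dw, S \<ge> s)\<close> on \<open>w < s\<close>.  By Doob's identity
  \<open>E ((W - s) 1 (S \<ge> s)) = 0\<close> its total mass is \<open>E ((W - s)\<^sup>+)\<close>, which depends on the target law only, and
  it is dominated by \<open>(s - w) \<mu> (dw)\<close>.  Since \<open>F\<^sub>s (w, s) / (s - w)\<close> decreases in \<open>w\<close>, the integral is least
  if the mass sits as far to the right as possible and greatest if it sits as far to the left as
  possible (\<open>payoff_comparison\<close>).  The Azema--Yor time does the former at every level, as then
  \<open>S \<ge> s\<close> means \<open>W \<ge> \<beta> (s)\<close> up to the boundary point; the Perkins time does the latter, as then
  \<open>S \<ge> s > W\<close> means \<open>W \<le> \<alpha>\<^sup>+ (s)\<close>.  Both descriptions are pathwise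
  (\<open>tau_AY_threshold\<close>, \<open>tau_alpha_threshold\<close>).

  The larger part of the work is to prove that both times embed \<open>\<mu>\<close>.  Doob's identity and the threshold
  descriptions translate into statements on the potentials \<open>C\<close> and \<open>P\<close> of the stopped law: for Azema--Yor
  the tangent to \<open>C\<close> from the point \<open>(s, 0)\<close> touches at \<open>\<beta> (s)\<close>, and for Perkins the tangent to \<open>P\<close>
  from the point \<open>(s, C (s))\<close> touches at \<open>\<alpha>\<^sup>+ (s)\<close>, and symmetrically with the roles of \<open>C\<close> and \<open>P\<close>
  exchanged.  By definition of the barriers the potentials of \<open>\<mu>\<close> have the same tangents.  A maximum
  principle shows that the tangents determine the potentials: at a maximum of the difference of two
  potentials the slopes agree, so following the common tangent to its anchor carries the maximum to the
  anchor.  For Azema--Yor the anchor lies on the axis, where the difference vanishes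
  (\<open>AY_comparison\<close>); for Perkins it lies strictly higher on the other side of \<open>0\<close>, which
  leaves no room for a highest maximum except \<open>0\<close> (\<open>perkins_comparison\<close>).

  In the Perkins case the tangents determine the potentials only up to a factor, namely the
  mass outside \<open>0\<close>; hence the stopped law must be shown to have no more mass at \<open>0\<close> than \<open>\<mu>\<close>, that is,
  \<open>\<tau>\<^sub>\<alpha>\<close> must be positive.  This follows from the gambler's ruin estimate and the Borel--Cantelli
  lemma, because the relevant probabilities are dominated by the increments of the tangent slopes
  (\<open>tau_lower_positive\<close>).

  The stochastic input is optional stopping of Brownian motion at bounded times, proved by
  discretisation and an \<open>L\<^sup>2\<close> bound (\<open>optional_stopping\<close>).
\<close>

section \<open>Tangents of convex functions\<close>

text \<open>
  The graph of \<open>g\<close> is supported on \<open>D\<close>, with contact at \<open>b\<close>, by the line of slope \<open>- m\<close> through the anchor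
  \<open>(- s, v)\<close>.  The anchor has abscissa \<open>- s\<close> because one half-line is reflected: then the two halves of a
  Perkins problem are functions on \<open>[0, \<infinity>)\<close> and can be exchanged.
\<close>

definition touches :: "real set \<Rightarrow> (real \<Rightarrow> real) \<Rightarrow> real \<Rightarrow> real \<Rightarrow> real \<Rightarrow> real \<Rightarrow> bool" where
  "touches D g v s b m \<longleftrightarrow> b \<in> D \<and> g b = v - (s + b) * m \<and> (\<forall>y\<in>D. v - (s + y) * m \<le> g y)"

text \<open>
  The transfer of a maximum of \<open>g1 - g2\<close> from \<open>y\<close> to the anchor.  Points of contact with a common anchor
  form an interval, so contact of \<open>g1\<close> on both sides of \<open>y\<close> gives contact at \<open>y\<close>.  At the maximum, the
  supporting slope of \<open>g1\<close> is at least the steepest slope \<open>l\<close> of \<open>g2\<close>, so the tangent of \<open>g1\<close>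
  gains at least as much height on the way to the anchor as that of \<open>g2\<close>.
\<close>

lemma touches_max_transfer:
  assumes t0: "touches D g1 v1 s b0 m0" and t1: "touches D g1 v1 s b1 m1"
    and y: "b0 \<le> y" "y \<le> b1" "y \<in> D" "- s \<le> b0" "- s < y"
    and cvx: "convex_on D g1"
    and g2: "g2 y = v2 - (s + y) * l"
    and l: "\<And>l'. (\<And>z. z \<in> D \<Longrightarrow> y < z \<Longrightarrow> g2 y - g2 z \<le> (z - y) * l') \<Longrightarrow> l \<le> l'"
    and mx: "\<And>z. z \<in> D \<Longrightarrow> y < z \<Longrightarrow> g1 z - g2 z \<le> g1 y - g2 y"
  shows "g1 y - g2 y \<le> v1 - v2"
proof -
  have D: "b0 \<in> D" "b1 \<in> D" using t0 t1 by (auto simp: touches_def)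
  have "v1 - (s + b1) * m0 \<le> v1 - (s + b1) * m1"
    using t0 t1 by (auto simp: touches_def)
  then have m: "m1 \<le> m0" using y by (simp add: mult_le_cancel_left)
  have e0: "g1 b0 \<le> v1 - (s + b0) * m1"
  proof -
    have "(s + b0) * m1 \<le> (s + b0) * m0" using m y by (intro mult_left_mono) auto
    then show ?thesis using t0 by (auto simp: touches_def)
  qed
  have e1: "g1 b1 = v1 - (s + b1) * m1" using t1 by (auto simp: touches_def)
  have up: "g1 y \<le> v1 - (s + y) * m1"
  proof (cases "b0 = b1")
    case True then show ?thesis using y e1 by auto
  next
    case False
    define t where "t = (y - b0) / (b1 - b0)"
    have t: "0 \<le> t" "t \<le> 1" using y False by (auto simp: t_def)
    have "(b1 - b0) * t = y - b0" using False by (simp add: t_def)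
    then have yt: "(1 - t) * b0 + t * b1 = y" by (simp add: algebra_simps)
    have "g1 y \<le> (1 - t) * g1 b0 + t * g1 b1"
      using convex_onD[OF cvx t D] yt by simp
    also have "\<dots> \<le> (1 - t) * (v1 - (s + b0) * m1) + t * (v1 - (s + b1) * m1)"
      using e0 e1 t by (intro add_mono mult_left_mono) auto
    also have "\<dots> = v1 - (s + ((1 - t) * b0 + t * b1)) * m1" by (simp add: algebra_simps)
    finally show ?thesis unfolding yt .
  qed
  have low: "v1 - (s + z) * m1 \<le> g1 z" if "z \<in> D" for z
    using t1 that by (auto simp: touches_def)
  have eq: "g1 y = v1 - (s + y) * m1" using up low[OF y(3)] by simp
  have "l \<le> m1"
  proof (rule l)
    fix z assume z: "z \<in> D" "y < z"
    have "g2 y - g2 z \<le> g1 y - g1 z" using mx[OF z] by simp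
    also have "\<dots> \<le> (z - y) * m1" using low[OF z(1)] eq by (simp add: algebra_simps)
    finally show "g2 y - g2 z \<le> (z - y) * m1" .
  qed
  then have "(s + y) * l \<le> (s + y) * m1" using y by (intro mult_left_mono) auto
  then show ?thesis using eq g2 by simp
qed

text \<open>
  Contact is a closed condition.  Hence it also holds at the one-sided limits of a barrier, which is what
  makes the barriers usable at their jumps.
\<close>

lemma touches_limit:
  assumes t: "\<And>n::nat. touches D g (v n) (s n) (b n) (m n)"
    and b: "\<And>n. b n \<in> {lo..hi}" and m: "\<And>n. m n \<in> {A..B}" and D: "{lo..hi} \<subseteq> D"
    and v: "v \<longlonglongrightarrow> v0" and s: "s \<longlonglongrightarrow> s0" and g: "continuous_on D g"
    and sb: "\<And>n. - s n \<le> b n"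
  shows "\<exists>b0\<in>{lo..hi}. - s0 \<le> b0 \<and> (\<exists>m0\<in>{A..B}. touches D g v0 s0 b0 m0)"
proof -
  have "compact ({lo..hi} \<times> {A..B})" by (intro compact_Times) auto
  then have "seq_compact ({lo..hi} \<times> {A..B})" by (simp add: compact_imp_seq_compact)
  moreover have "\<forall>n. (b n, m n) \<in> {lo..hi} \<times> {A..B}" using b m by auto
  ultimately obtain p r where p: "p \<in> {lo..hi} \<times> {A..B}" and r: "strict_mono (r::nat\<Rightarrow>nat)"
    and lim: "((\<lambda>n. (b n, m n)) \<circ> r) \<longlonglongrightarrow> p"
    by (rule seq_compactE) auto
  obtain b0 m0 where pe: "p = (b0, m0)" by (cases p)
  have bl: "(\<lambda>n. b (r n)) \<longlonglongrightarrow> b0" and ml: "(\<lambda>n. m (r n)) \<longlonglongrightarrow> m0"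
    using tendsto_fst[OF lim] tendsto_snd[OF lim] by (auto simp: pe o_def)
  have vl: "(\<lambda>n. v (r n)) \<longlonglongrightarrow> v0" and sl: "(\<lambda>n. s (r n)) \<longlonglongrightarrow> s0"
    using LIMSEQ_subseq_LIMSEQ[OF v r] LIMSEQ_subseq_LIMSEQ[OF s r] by (auto simp: o_def)
  have b0: "b0 \<in> D" using p pe D by auto
  have bD: "b n \<in> D" for n using b D by blast
  have "(\<lambda>n. g (b (r n))) \<longlonglongrightarrow> g b0"
    by (rule continuous_on_tendsto_compose[OF g bl b0]) (auto simp: bD)
  moreover have "(\<lambda>n. v (r n) - (s (r n) + b (r n)) * m (r n)) \<longlonglongrightarrow> v0 - (s0 + b0) * m0"
    by (intro tendsto_intros vl sl bl ml)
  moreover have "g (b (r n)) = v (r n) - (s (r n) + b (r n)) * m (r n)" for n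
    using t by (auto simp: touches_def)
  ultimately have 1: "g b0 = v0 - (s0 + b0) * m0"
    using LIMSEQ_unique by force
  have 2: "v0 - (s0 + y) * m0 \<le> g y" if "y \<in> D" for y
  proof (rule LIMSEQ_le_const2)
    show "(\<lambda>n. v (r n) - (s (r n) + y) * m (r n)) \<longlonglongrightarrow> v0 - (s0 + y) * m0"
      by (intro tendsto_intros vl sl bl ml)
    show "\<exists>N. \<forall>n\<ge>N. v (r n) - (s (r n) + y) * m (r n) \<le> g y"
      using t that by (auto simp: touches_def)
  qed
  have "touches D g v0 s0 b0 m0" using 1 2 b0 by (simp add: touches_def)
  moreover have "- s0 \<le> b0"
    by (rule LIMSEQ_le[OF tendsto_minus[OF sl] bl]) (use sb in auto)
  ultimately show ?thesis using p pe by (intro bexI[of _ b0] bexI[of _ m0] conjI) auto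
qed

lemma convex_slopes:
  fixes f :: "real \<Rightarrow> real"
  assumes c: "convex_on D f" and x: "x \<in> D" "z \<in> D" and o: "x < y" "y < z"
  shows "(f y - f x) * (z - y) \<le> (f z - f y) * (y - x)"
proof -
  define t where "t = (y - x) / (z - x)"
  have t: "0 \<le> t" "t \<le> 1" using o by (auto simp: t_def)
  have e: "(z - x) * t = y - x" using o by (simp add: t_def)
  have y: "y = (1 - t) *\<^sub>R x + t *\<^sub>R z" using e by (simp add: algebra_simps)
  have "f y \<le> (1 - t) * f x + t * f z"
    unfolding y using convex_onD[OF c t x] by simp
  then have "(z - x) * f y \<le> (z - x) * ((1 - t) * f x + t * f z)"
    using o by (intro mult_left_mono) auto
  also have "\<dots> = (z - x) * f x - ((z - x) * t) * f x + ((z - x) * t) * f z"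
    by (simp add: algebra_simps)
  also have "\<dots> = (z - y) * f x + (y - x) * f z"
    unfolding e by (simp add: algebra_simps)
  finally show ?thesis by (simp add: algebra_simps)
qed

section \<open>The maximum principle for Perkins tangents\<close>

text \<open>
  The properties of one half of the potential of a law: of \<open>E ((X - x)\<^sup>+)\<close> for \<open>x \<ge> 0\<close>, or of the mirror image of
  \<open>E ((x - X)\<^sup>+)\<close> for \<open>x \<le> 0\<close>, for a law concentrated below \<open>h\<close>.
\<close>

definition potential :: "real \<Rightarrow> (real \<Rightarrow> real) \<Rightarrow> bool" where
  "potential h f \<longleftrightarrow> convex_on {0..} f \<and> continuous_on {0..} f \<and> (\<forall>x\<ge>0. 0 \<le> f x)
     \<and> (\<forall>x\<ge>h. f x = 0) \<and> (\<forall>x y. 0 \<le> x \<longrightarrow> x \<le> y \<longrightarrow> f y \<le> f x)"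

lemma potentialD:
  assumes "potential h f"
  shows potential_convex: "convex_on {0..} f" and potential_continuous: "continuous_on {0..} f"
    and potential_nonneg: "\<And>x. 0 \<le> x \<Longrightarrow> 0 \<le> f x" and potential_zero: "\<And>x. h \<le> x \<Longrightarrow> f x = 0"
    and potential_antimono: "\<And>x y. 0 \<le> x \<Longrightarrow> x \<le> y \<Longrightarrow> f y \<le> f x"
  using assms unfolding potential_def by blast+

text \<open>
  For \<open>f = C\<close> and \<open>g (y) = P (- y)\<close> this is the defining property of \<open>a (s) = - \<alpha>\<^sup>+ (s)\<close>: the tangent from
  \<open>(s, C (s))\<close> touches \<open>P\<close> at \<open>- a (s)\<close>.  The bound on the slopes provides convergent subsequences.
\<close>

definition tangency ::
  "real \<Rightarrow> (real \<Rightarrow> real) \<Rightarrow> (real \<Rightarrow> real) \<Rightarrow> real \<Rightarrow> real \<Rightarrow> (real \<Rightarrow> real) \<Rightarrow> bool" where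
  "tangency B f g h k a \<longleftrightarrow>
     (\<forall>s\<in>{0<..<h}. a s \<in> {0..k} \<and> (\<exists>m\<in>{0..B}. touches {0..} g (f s) s (a s) m))"

lemma potential_strict:
  assumes "potential h f" "\<forall>x\<in>{0..<h}. 0 < f x" "0 \<le> x" "x < y" "x < h" shows "f y < f x"
proof -
  have c: "convex_on {0..} f" and le: "f y \<le> f x" and fz: "\<And>x. h \<le> x \<Longrightarrow> f x = 0"
    using assms potentialD[of h f] by auto
  have px: "0 < f x" using assms by auto
  show ?thesis
  proof (cases "h \<le> y")
    case True then show ?thesis using px fz by auto
  next
    case False
    have "(f y - f x) * (h - y) \<le> (f h - f y) * (y - x)"
      by (rule convex_slopes[OF c]) (use assms False in auto)
    moreover have "f h = 0" using fz by simp
    moreover have "0 < f y" using assms False by auto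
    ultimately have "(f y - f x) * (h - y) \<le> - (f y) * (y - x)" by simp
    also have "\<dots> < 0" using \<open>0 < f y\<close> assms by (simp add: mult_neg_pos)
    finally show ?thesis using False by (simp add: mult_less_0_iff)
  qed
qed

text \<open>
  Each tangent lies below the graph at the contact point of the other; were \<open>a > y\<close>, this would make the
  tangent with anchor \<open>s\<close> the steeper one, and as it also climbs over a longer distance, its anchor would be the
  higher one.
\<close>

lemma touches_mono:
  assumes t: "touches D g (f s) s y l" "touches D g (f s') s' a m"
    and l: "0 \<le> l" and s: "s' < s" "f s < f s'" "0 \<le> s'" "0 \<le> y"
  shows "a \<le> y"
proof (rule ccontr)
  assume "\<not> a \<le> y"
  then have ay: "y < a" by simp
  have 1: "f s' - (s' + y) * m \<le> f s - (s + y) * l"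
    and 2: "f s - (s + a) * l \<le> f s' - (s' + a) * m"
    using t by (auto simp: touches_def)
  from 1 2 have "(a - y) * m \<le> (a - y) * l" by (simp add: algebra_simps)
  then have ml: "m \<le> l" using ay by simp
  have "(s' + y) * m \<le> (s' + y) * l" using ml s by (intro mult_left_mono) auto
  also have "\<dots> \<le> (s + y) * l" using s l by (intro mult_right_mono) auto
  finally show False using 1 s by simp
qed

lemma left_approach:
  fixes s :: real assumes "l < s"
  obtains u :: "nat \<Rightarrow> real" where "\<And>n. l < u n" "\<And>n. u n < s" "u \<longlonglongrightarrow> s"
proof
  show "l < s - (s - l) / (2 + real n)" for n
  proof -
    have "(s - l) / (2 + real n) < (s - l) / 1" using assms by (intro divide_strict_left_mono) auto
    then show ?thesis by simp
  qed
  show "s - (s - l) / (2 + real n) < s" for n using assms by simp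
  have "(\<lambda>n. (s - l) / real n) \<longlonglongrightarrow> 0" by (rule lim_const_over_n)
  then have "(\<lambda>n. (s - l) / real (n + 2)) \<longlonglongrightarrow> 0" by (rule LIMSEQ_ignore_initial_segment)
  then have "(\<lambda>n. s - (s - l) / real (n + 2)) \<longlonglongrightarrow> s - 0" by (intro tendsto_diff tendsto_const)
  then show "(\<lambda>n. s - (s - l) / (2 + real n)) \<longlonglongrightarrow> s" by simp
qed

lemma right_approach:
  fixes s :: real assumes "s < l"
  obtains u :: "nat \<Rightarrow> real" where "\<And>n. u n < l" "\<And>n. s < u n" "u \<longlonglongrightarrow> s"
proof -
  obtain v :: "nat \<Rightarrow> real" where v: "\<And>n. - l < v n" "\<And>n. v n < - s" "v \<longlonglongrightarrow> - s"
    using left_approach[of "-l" "-s"] assms by auto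
  show thesis
  proof
    show "- v n < l" "s < - v n" for n using v(1,2)[of n] by auto
    show "(\<lambda>n. - v n) \<longlonglongrightarrow> s" using tendsto_minus[OF v(3)] by simp
  qed
qed

text \<open>
  The one-sided derivative is taken as a supremum of chord slopes, so that no differentiability enters;
  its minimality among the upper bounds is the form in which \<open>touches_max_transfer\<close> uses it.
\<close>

lemma steepest_chord:
  fixes g :: "real \<Rightarrow> real"
  assumes cvx: "convex_on D g" and D: "y \<in> D" "z0 \<in> D" "y0 \<in> D" and y: "y0 < y" "y < z0"
    and dom: "D = {0..} \<or> D = UNIV"
  obtains l where "\<And>z. z \<in> D \<Longrightarrow> y < z \<Longrightarrow> g y - g z \<le> (z - y) * l"
    "\<And>l'. (\<And>z. z \<in> D \<Longrightarrow> y < z \<Longrightarrow> g y - g z \<le> (z - y) * l') \<Longrightarrow> l \<le> l'"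
    "\<And>z. z \<in> D \<Longrightarrow> g y - (z - y) * l \<le> g z"
proof -
  define Q where "Q = {(g y - g z) / (z - y) | z. z \<in> D \<and> y < z}"
  define l where "l = Sup Q"
  have ne: "Q \<noteq> {}" using D y by (auto simp: Q_def)
  have bd: "q \<le> (g x - g y) / (y - x)" if q: "q \<in> Q" and x: "x \<in> D" "x < y" for q x
  proof -
    obtain z where z: "q = (g y - g z) / (z - y)" "z \<in> D" "y < z" using q by (auto simp: Q_def)
    have "(g y - g x) * (z - y) \<le> (g z - g y) * (y - x)"
      by (rule convex_slopes[OF cvx]) (use x z in auto)
    then have "(g y - g z) * (y - x) \<le> (g x - g y) * (z - y)" by (simp add: algebra_simps)
    then show ?thesis unfolding z(1) using x z
      by (simp only: pos_divide_le_eq pos_le_divide_eq times_divide_eq_left diff_gt_0_iff_gt)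
  qed
  have bdd: "bdd_above Q" by (rule bdd_aboveI[of _ "(g y0 - g y) / (y - y0)"]) (use bd D y in auto)
  show thesis
  proof
    show a: "g y - g z \<le> (z - y) * l" if "z \<in> D" "y < z" for z
    proof -
      have "(g y - g z) / (z - y) \<le> l" unfolding l_def
        by (rule cSup_upper[OF _ bdd]) (use that in \<open>auto simp: Q_def\<close>)
      then show ?thesis using that by (simp add: field_simps)
    qed
    show "l \<le> l'" if "\<And>z. z \<in> D \<Longrightarrow> y < z \<Longrightarrow> g y - g z \<le> (z - y) * l'" for l'
      unfolding l_def
    proof (rule cSup_least[OF ne])
      fix q assume "q \<in> Q"
      then obtain z where z: "q = (g y - g z) / (z - y)" "z \<in> D" "y < z" by (auto simp: Q_def)
      then show "q \<le> l'" using that[OF z(2,3)] by (simp add: pos_divide_le_eq mult.commute)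
    qed
    show "g y - (z - y) * l \<le> g z" if z: "z \<in> D" for z
    proof (cases z y rule: linorder_cases)
      case less
      have "l \<le> (g z - g y) / (y - z)" unfolding l_def
        by (rule cSup_least[OF ne]) (use bd z less in auto)
      then have "l * (y - z) \<le> g z - g y" using less by (simp add: pos_le_divide_eq)
      then show ?thesis by (simp add: algebra_simps)
    next
      case greater
      then show ?thesis using a[OF z] by simp
    qed simp
  qed
qed

text \<open>
  The steepest tangent of \<open>g2\<close> at the maximum \<open>y\<close> is followed up to the graph of \<open>f2\<close>, which it meets at a
  point \<open>s\<close> with a larger value.  Anchors slightly below and above \<open>s\<close> have contact points on the two sides of
  \<open>y\<close>; these are shared by both pairs, and in the limit they give contact of \<open>g1\<close> with anchor \<open>s\<close> on both
  sides of \<open>y\<close>.  In the degenerate case \<open>s = 0\<close> the anchor itself is the nearer contact point.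
\<close>

lemma maximum_principle_step:
  assumes p1: "potential h f1" "potential k g1" and p2: "potential h f2" "potential k g2"
    and t1: "tangency B f1 g1 h k a" and t2: "tangency B f2 g2 h k a"
    and pos: "\<forall>x\<in>{0..<h}. 0 < f2 x" "\<forall>x\<in>{0..<k}. 0 < g2 x"
    and hk: "0 < h" "0 < k"
    and z0: "f1 0 = g1 0" "f2 0 = g2 0"
    and y: "0 < y" "y < k" and mx: "\<And>z. 0 \<le> z \<Longrightarrow> g1 z - g2 z \<le> g1 y - g2 y"
  shows "\<exists>s\<in>{0..<h}. g1 y - g2 y \<le> f1 s - f2 s \<and> g2 y < f2 s"
proof -
  note p = potential_convex[OF p1(1)] potential_convex[OF p1(2)] potential_convex[OF p2(2)]
    potential_zero[OF p2(1), of h] potential_zero[OF p2(2), of k]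
    potential_continuous[OF p1(1)] potential_continuous[OF p1(2)] potential_continuous[OF p2(1)]
  obtain l where l: "\<And>z. z \<in> {0..} \<Longrightarrow> y < z \<Longrightarrow> g2 y - g2 z \<le> (z - y) * l"
    "\<And>l'. (\<And>z. z \<in> {0..} \<Longrightarrow> y < z \<Longrightarrow> g2 y - g2 z \<le> (z - y) * l') \<Longrightarrow> l \<le> l'"
    "\<And>z. z \<in> {0..} \<Longrightarrow> g2 y - (z - y) * l \<le> g2 z"
    by (rule steepest_chord[of "{0..}" g2 y k 0]) (use p y in auto)
  have gk: "g2 k = 0" "0 < g2 y" using p y pos by auto
  have "0 < (k - y) * l" using l(1)[of k] y gk by auto
  then have lpos: "0 < l" using y by (simp add: zero_less_mult_iff)
  \<comment> \<open>where the steepest tangent at \<open>y\<close> meets the graph of \<open>f2\<close>\<close>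
  have "\<exists>s\<ge>0. s \<le> h \<and> (\<lambda>s. (s + y) * l - f2 s) s = - g2 y"
  proof (rule IVT')
    show "(0 + y) * l - f2 0 \<le> - g2 y" using l(3)[of 0] z0 by simp
    have "f2 h = 0" using p by auto
    moreover have "0 < (h + y) * l" using lpos hk y by simp
    ultimately show "- g2 y \<le> (h + y) * l - f2 h" using gk by simp
    show "0 \<le> h" using hk by simp
    show "continuous_on {0..h} (\<lambda>s. (s + y) * l - f2 s)"
      using continuous_on_subset[OF potential_continuous[OF p2(1)], of "{0..h}"]
      by (auto intro!: continuous_intros)
  qed
  then obtain s where s: "0 \<le> s" "s \<le> h" and e: "f2 s = g2 y + (s + y) * l" by auto
  have lt: "g2 y < f2 s" using e s y lpos by simp
  have "f2 h = 0" using p by auto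
  then have sh: "s < h" using s lt gk by (cases "s = h") auto
  have t: "touches {0..} g2 (f2 s) s y l"
    unfolding touches_def using l(3) y e by (auto simp: algebra_simps)
  have str: "f2 v < f2 u" if "0 \<le> u" "u < v" "u < h" for u v
    using potential_strict[OF p2(1) pos(1)] that by auto
  have T: "\<exists>m\<in>{0..B}. touches {0..} g1 (f1 u) u (a u) m" "\<exists>m\<in>{0..B}. touches {0..} g2 (f2 u) u (a u) m"
     "a u \<in> {0..k}" if "0 < u" "u < h" for u
    using t1 t2 that unfolding tangency_def by auto
  have mono1: "a u \<le> y" if "0 < u" "u < s" for u
  proof -
    have u: "0 < u" "u < h" using that s by auto
    obtain m where "touches {0..} g2 (f2 u) u (a u) m" using T(2)[OF u] by blast
    then show ?thesis using touches_mono[where f=f2, OF t] that lpos str[of u s] sh y by auto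
  qed
  have mono2: "y \<le> a u" if "s < u" "u < h" for u
  proof -
    have u: "0 < u" "u < h" using that s by auto
    obtain m where m: "touches {0..} g2 (f2 u) u (a u) m" "0 \<le> m"
      using T(2)[OF u] by (meson atLeastAtMost_iff)
    have "0 \<le> a u" using T(3)[of u] that s by auto
    then show ?thesis using touches_mono[where f=f2, OF m(1) t m(2)] that str[of s u] s y by auto
  qed
  have cont: "continuous_on {0..} f1" "continuous_on {0..} g1" using p by auto
  have lim: "\<exists>b\<in>{lo..hi}. \<exists>m. touches {0..} g1 (f1 s) s b m"
    if u: "\<And>n::nat. 0 < u n" "\<And>n. u n < h" "u \<longlonglongrightarrow> s" "\<And>n. a (u n) \<in> {lo..hi}" "0 \<le> lo" for u lo hi
  proof -
    have "\<forall>n. \<exists>m\<in>{0..B}. touches {0..} g1 (f1 (u n)) (u n) (a (u n)) m" using T(1) u by auto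
    then obtain m where m: "\<And>n. m n \<in> {0..B}" "\<And>n. touches {0..} g1 (f1 (u n)) (u n) (a (u n)) (m n)"
      by metis
    have fl: "(\<lambda>n. f1 (u n)) \<longlonglongrightarrow> f1 s"
      by (rule continuous_on_tendsto_compose[OF cont(1) u(3)])
        (use s u(1) in \<open>auto intro!: always_eventually less_imp_le\<close>)
    have sb: "- u n \<le> a (u n)" for n
    proof -
      have "0 \<le> a (u n)" using u(4)[of n] u(5) by simp
      then show ?thesis using u(1)[of n] by simp
    qed
    have lo: "{lo..hi} \<subseteq> {0..}" using u(5) by auto
    from touches_limit[OF m(2) u(4) m(1) lo fl u(3) cont(2) sb] show ?thesis by blast
  qed
  obtain u where u: "\<And>n. u n < h" "\<And>n. s < u n" "u \<longlonglongrightarrow> s" using right_approach[OF sh] by metis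
  have u0: "0 < u n" for n using u(2)[of n] s by linarith
  have "\<exists>b\<in>{y..k}. \<exists>m. touches {0..} g1 (f1 s) s b m"
    using mono2 T(3) u u0 y by (intro lim[of u]) auto
  then obtain b1 m1 where b1: "y \<le> b1" "touches {0..} g1 (f1 s) s b1 m1" by auto
  obtain b0 m0 where b0: "0 \<le> b0" "b0 \<le> y" "touches {0..} g1 (f1 s) s b0 m0"
  proof (cases "s = 0")
    case True
    have "touches {0..} g1 (f1 s) s 0 m1" using b1(2) True z0 by (auto simp: touches_def)
    then show ?thesis using y that[of 0 m1] by auto
  next
    case False
    then obtain w where w: "\<And>n. 0 < w n" "\<And>n. w n < s" "w \<longlonglongrightarrow> s" using left_approach[of 0 s] s by auto
    have wh: "w n < h" for n using w(2)[of n] s by linarith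
    have "\<exists>b\<in>{0..y}. \<exists>m. touches {0..} g1 (f1 s) s b m"
      using mono1 T(3) w wh by (intro lim[of w]) auto
    then show ?thesis using that by (meson atLeastAtMost_iff)
  qed
  have "g1 y - g2 y \<le> f1 s - f2 s"
    by (rule touches_max_transfer[OF b0(3) b1(2) b0(2) b1(1) _ _ _ _ _ l(2)])
       (use y s b0 p mx e in auto)
  then show ?thesis using lt s sh by auto
qed

text \<open>
  A positive maximum of the difference would be attained on both sides of \<open>0\<close>, since each maximum leads to one on
  the other side where the potential of the second pair is strictly larger.  The maxima closest to
  \<open>0\<close> on either side have the largest potentials, and so each would have to exceed the other.
\<close>

lemma perkins_comparison:
  assumes p1: "potential h f1" "potential k g1" and p2: "potential h f2" "potential k g2"
    and ta: "tangency B f1 g1 h k a" "tangency B f2 g2 h k a"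
    and tb: "tangency B g1 f1 k h b" "tangency B g2 f2 k h b"
    and pos: "\<forall>x\<in>{0..<h}. 0 < f2 x" "\<forall>x\<in>{0..<k}. 0 < g2 x"
    and hk: "0 < h" "0 < k"
    and z0: "f1 0 = g1 0" "f2 0 = g2 0" "f1 0 = f2 0"
    and x: "0 \<le> x"
  shows "f1 x \<le> f2 x \<and> g1 x \<le> g2 x"
proof -
  note pz = potential_zero[OF p1(1)] potential_zero[OF p1(2)] potential_zero[OF p2(1)] potential_zero[OF p2(2)]
  note pc = potential_continuous[OF p1(1)] potential_continuous[OF p1(2)] potential_continuous[OF p2(1)]
     potential_continuous[OF p2(2)]
  have cf: "continuous_on {0..} (\<lambda>x. f1 x - f2 x)" and cg: "continuous_on {0..} (\<lambda>x. g1 x - g2 x)"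
    using pc by (auto intro!: continuous_on_diff)
  obtain xf where xf: "xf \<in> {0..h}" "\<And>z. z \<in> {0..h} \<Longrightarrow> f1 z - f2 z \<le> f1 xf - f2 xf"
    using continuous_attains_sup[of "{0..h}" "\<lambda>x. f1 x - f2 x"] continuous_on_subset[OF cf, of "{0..h}"] hk
    by auto
  obtain xg where xg: "xg \<in> {0..k}" "\<And>z. z \<in> {0..k} \<Longrightarrow> g1 z - g2 z \<le> g1 xg - g2 xg"
    using continuous_attains_sup[of "{0..k}" "\<lambda>x. g1 x - g2 x"] continuous_on_subset[OF cg, of "{0..k}"] hk
    by auto
  \<comment> \<open>the maximum of the difference over both sides\<close>
  define N where "N = max (f1 xf - f2 xf) (g1 xg - g2 xg)"
  have N0: "0 \<le> N" using xf(2)[of 0] z0 hk by (auto simp: N_def)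
  have Nf: "f1 z - f2 z \<le> N" if "0 \<le> z" for z
    using xf(2)[of z] N0 pz that by (cases "z \<le> h") (auto simp: N_def)
  have Ng: "g1 z - g2 z \<le> N" if "0 \<le> z" for z
    using xg(2)[of z] N0 pz that by (cases "z \<le> k") (auto simp: N_def)
  have "N \<le> 0"
  proof (rule ccontr)
    assume "\<not> N \<le> 0"
    then have N: "0 < N" by simp
    define Kf where "Kf = {z \<in> {0..h}. f1 z - f2 z = N}"
    define Kg where "Kg = {z \<in> {0..k}. g1 z - g2 z = N}"
    have least: "\<exists>m\<in>K. \<forall>z\<in>K. m \<le> z" if "K \<noteq> {}" "compact K" for K :: "real set"
      using compact_attains_inf[of K] that by auto
    have cK: "compact {z \<in> {0..e}. d z = N}" if "continuous_on {0..} d" for d :: "real \<Rightarrow> real" and e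
    proof -
      have "closed {z \<in> {0..e}. d z = N}"
        by (rule continuous_closed_preimage_constant) (use continuous_on_subset[OF that, of "{0..e}"] in auto)
      moreover have "{z \<in> {0..e}. d z = N} = {0..e} \<inter> {z \<in> {0..e}. d z = N}" by auto
      ultimately show ?thesis by (metis compact_Icc compact_Int_closed)
    qed
    have stepg: "\<exists>s\<in>Kf. g2 y < f2 s" if y: "y \<in> Kg" for y
    proof -
      have "y \<noteq> 0" "y \<noteq> k" using y N z0 pz by (auto simp: Kg_def)
      then have "\<exists>s\<in>{0..<h}. g1 y - g2 y \<le> f1 s - f2 s \<and> g2 y < f2 s"
        using y Ng by (intro maximum_principle_step[OF p1 p2 ta pos hk z0(1,2)]) (auto simp: Kg_def)
      then show ?thesis using y Nf by (force simp: Kg_def Kf_def)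
    qed
    have stepf: "\<exists>s\<in>Kg. f2 y < g2 s" if y: "y \<in> Kf" for y
    proof -
      have "y \<noteq> 0" "y \<noteq> h" using y N z0 pz by (auto simp: Kf_def)
      then have "\<exists>s\<in>{0..<k}. f1 y - f2 y \<le> g1 s - g2 s \<and> f2 y < g2 s"
        using y Nf by (intro maximum_principle_step[OF p1(2,1) p2(2,1) tb pos(2,1) hk(2,1) z0(1,2)[symmetric]])
           (auto simp: Kf_def)
      then show ?thesis using y Ng by (force simp: Kg_def Kf_def)
    qed
    have "Kf \<noteq> {} \<or> Kg \<noteq> {}"
      using xf(1) xg(1) unfolding N_def Kf_def Kg_def max_def by (auto split: if_splits)
    then have ne: "Kf \<noteq> {}" "Kg \<noteq> {}" using stepf stepg by auto
    obtain s0 where s0: "s0 \<in> Kf" "\<And>z. z \<in> Kf \<Longrightarrow> s0 \<le> z"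
      using least[OF ne(1)] cK[OF cf] unfolding Kf_def by auto
    obtain y0 where y0: "y0 \<in> Kg" "\<And>z. z \<in> Kg \<Longrightarrow> y0 \<le> z"
      using least[OF ne(2)] cK[OF cg] unfolding Kg_def by auto
    obtain s where s: "s \<in> Kf" "g2 y0 < f2 s" using stepg[OF y0(1)] by auto
    obtain y where y: "y \<in> Kg" "f2 s0 < g2 y" using stepf[OF s0(1)] by auto
    have mf: "f2 v \<le> f2 u" and mg: "g2 v \<le> g2 u" if "0 \<le> u" "u \<le> v" for u v
      using potential_antimono[OF p2(1)] potential_antimono[OF p2(2)] that by auto
    have "f2 s \<le> f2 s0" using s0(2)[OF s(1)] s0(1) by (intro mf) (auto simp: Kf_def)
    moreover have "g2 y \<le> g2 y0" using y0(2)[OF y(1)] y0(1) by (intro mg) (auto simp: Kg_def)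
    ultimately show False using s(2) y(2) by simp
  qed
  then show ?thesis using Nf[OF x] Ng[OF x] by simp
qed


text \<open>
  The right end of the support of a law, seen from its potential.
\<close>

lemma first_zero:
  fixes f :: "real \<Rightarrow> real"
  assumes c: "continuous_on {0..} f" and nn: "\<And>x. 0 \<le> x \<Longrightarrow> 0 \<le> f x" and h: "f h = 0" "0 \<le> h" and p: "0 < f 0"
  obtains z where "0 < z" "z \<le> h" "f z = 0" "\<And>x. 0 \<le> x \<Longrightarrow> x < z \<Longrightarrow> 0 < f x"
proof -
  have "closed {x \<in> {0..h}. f x = 0}"
    by (rule continuous_closed_preimage_constant) (use continuous_on_subset[OF c, of "{0..h}"] in auto)
  moreover have "{x \<in> {0..h}. f x = 0} = {0..h} \<inter> {x \<in> {0..h}. f x = 0}" by auto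
  ultimately have "compact {x \<in> {0..h}. f x = 0}" by (metis compact_Icc compact_Int_closed)
  moreover have "h \<in> {x \<in> {0..h}. f x = 0}" using h by auto
  ultimately obtain z where z: "z \<in> {0..h}" "f z = 0" "\<And>x. x \<in> {0..h} \<Longrightarrow> f x = 0 \<Longrightarrow> z \<le> x"
    using compact_attains_inf[of "{x \<in> {0..h}. f x = 0}"] by blast
  have "0 < z" using z p by (cases "z = 0") auto
  moreover have "0 < f x" if "0 \<le> x" "x < z" for x
    using z(1) z(3)[of x] nn[of x] that by (cases "f x = 0") auto
  ultimately show thesis using that z by auto
qed

text \<open>
  As long as \<open>f1\<close> is positive at \<open>s\<close>, the contact point \<open>a (s)\<close> cannot lie beyond the zero \<open>x\<close> of \<open>g1\<close>.  For the
  second pair the tangent through \<open>a (s)\<close> then yields a gap between \<open>g2 x\<close> and \<open>f2 s\<close> that does not close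
  as \<open>s\<close> tends to \<open>y\<close>.
\<close>

lemma positivity_half:
  assumes p2: "potential h f2" "potential k g2"
    and ta: "tangency B f1 g1 h k a" "tangency B f2 g2 h k a"
    and hk: "0 < h" "0 < k"
    and f1: "0 < y" "y \<le> h" "\<And>x. 0 \<le> x \<Longrightarrow> x < y \<Longrightarrow> 0 < f1 x"
    and g1: "0 \<le> x" "\<And>z. x \<le> z \<Longrightarrow> g1 z = 0"
  shows "g2 x + y * f2 y / (y + k) \<le> f2 y"
proof -
  have ev: "g2 x + s * f2 s / (s + k) \<le> f2 s" if s: "0 < s" "s < y" for s
  proof -
    have sh: "s \<in> {0<..<h}" using s f1 by auto
    obtain m where m: "touches {0..} g1 (f1 s) s (a s) m" using ta(1) sh unfolding tangency_def by blast
    have as: "a s \<in> {0..k}" using ta(1) sh unfolding tangency_def by blast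
    obtain l where l: "l \<in> {0..B}" "touches {0..} g2 (f2 s) s (a s) l" using ta(2) sh unfolding tangency_def by blast
    have "f1 s - (s + x) * m \<le> g1 x" using m g1(1) by (simp add: touches_def)
    then have 1: "f1 s \<le> (s + x) * m" using g1 by simp
    have mp: "0 < m" using 1 f1(3)[of s] s g1(1) by (smt (verit) mult_nonneg_nonpos)
    have "a s \<le> x"
    proof (rule ccontr)
      assume n: "\<not> a s \<le> x"
      then have "f1 s = (s + a s) * m" using m g1(2)[of "a s"] by (simp add: touches_def)
      moreover have "(s + x) * m < (s + a s) * m" using n mp by simp
      ultimately show False using 1 by simp
    qed
    then have g: "g2 x \<le> g2 (a s)" using potential_antimono[OF p2(2)] as by auto
    have "f2 s - (s + k) * l \<le> g2 k" using l hk by (simp add: touches_def)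
    then have "f2 s \<le> (s + k) * l" using potential_zero[OF p2(2), of k] by simp
    then have "f2 s / (s + k) \<le> l" using s hk by (simp add: pos_divide_le_eq mult.commute)
    then have "s * (f2 s / (s + k)) \<le> s * l" using s by (intro mult_left_mono) auto
    also have "\<dots> \<le> (s + a s) * l" using l as by (intro mult_right_mono) auto
    also have "\<dots> = f2 s - g2 (a s)" using l by (simp add: touches_def)
    finally show ?thesis using g by simp
  qed
  obtain u where u: "\<And>n. 0 < u n" "\<And>n. u n < y" "u \<longlonglongrightarrow> y" using left_approach[OF f1(1)] by metis
  have fu: "(\<lambda>n. f2 (u n)) \<longlonglongrightarrow> f2 y"
    by (rule continuous_on_tendsto_compose[OF potential_continuous[OF p2(1)] u(3)])
       (use u(1) f1(1) in \<open>auto intro!: always_eventually less_imp_le\<close>)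
  show ?thesis
  proof (rule LIMSEQ_le)
    show "(\<lambda>n. g2 x + u n * f2 (u n) / (u n + k)) \<longlonglongrightarrow> g2 x + y * f2 y / (y + k)"
      by (intro tendsto_intros u fu) (use f1 hk in auto)
    show "(\<lambda>n. f2 (u n)) \<longlonglongrightarrow> f2 y" by (rule fu)
    show "\<exists>N. \<forall>n\<ge>N. g2 x + u n * f2 (u n) / (u n + k) \<le> f2 (u n)" using ev u by auto
  qed
qed

text \<open>
  A law with the same tangents cannot have a smaller support: if its ends are \<open>y\<close> and \<open>- x\<close>, then
  \<open>positivity_half\<close> applied to both sides gives \<open>g2 x \<le> f2 y\<close> and \<open>f2 y \<le> g2 x\<close> with gaps that must vanish,
  and so \<open>f2 y = 0 = g2 x\<close>.
\<close>

lemma perkins_positivity: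
  assumes p1: "potential h f1" "potential k g1" and p2: "potential h f2" "potential k g2"
    and ta: "tangency B f1 g1 h k a" "tangency B f2 g2 h k a"
    and tb: "tangency B g1 f1 k h b" "tangency B g2 f2 k h b"
    and pos: "\<forall>x\<in>{0..<h}. 0 < f2 x" "\<forall>x\<in>{0..<k}. 0 < g2 x"
    and hk: "0 < h" "0 < k"
    and z0: "0 < f1 0" "f1 0 = g1 0"
  shows "\<forall>x\<in>{0..<h}. 0 < f1 x" "\<forall>x\<in>{0..<k}. 0 < g1 x"
proof -
  obtain y where y: "0 < y" "y \<le> h" "f1 y = 0" "\<And>x. 0 \<le> x \<Longrightarrow> x < y \<Longrightarrow> 0 < f1 x"
    by (rule first_zero[of f1 h]) (use potentialD[OF p1(1)] hk z0 in auto)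
  obtain x where x: "0 < x" "x \<le> k" "g1 x = 0" "\<And>z. 0 \<le> z \<Longrightarrow> z < x \<Longrightarrow> 0 < g1 z"
    by (rule first_zero[of g1 k]) (use potentialD[OF p1(2)] hk z0 in auto)
  have gz: "g1 z = 0" if "x \<le> z" for z
    using potential_antimono[OF p1(2), of x z] potential_nonneg[OF p1(2), of z] that x by auto
  have fz: "f1 z = 0" if "y \<le> z" for z
    using potential_antimono[OF p1(1), of y z] potential_nonneg[OF p1(1), of z] that y by auto
  have 1: "g2 x + y * f2 y / (y + k) \<le> f2 y"
    by (rule positivity_half[OF p2 ta hk y(1,2,4)]) (use x gz in auto)
  have 2: "f2 y + x * g2 x / (x + h) \<le> g2 x"
    by (rule positivity_half[OF p2(2,1) tb hk(2,1) x(1,2,4)]) (use y fz in auto)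
  have n: "0 \<le> f2 y" "0 \<le> g2 x" using potential_nonneg[OF p2(1)] potential_nonneg[OF p2(2)] x y by auto
  have n2: "0 \<le> y * f2 y / (y + k)" "0 \<le> x * g2 x / (x + h)" using n x y hk by auto
  have "y * f2 y / (y + k) = 0" "x * g2 x / (x + h) = 0" using 1 2 n2 by linarith+
  then have "f2 y = 0" "g2 x = 0" using x y hk by auto
  then have "h \<le> y" "k \<le> x"
    using bspec[OF pos(1), of y] bspec[OF pos(2), of x] x y by (cases "y < h", simp_all, cases "x < k", simp_all)
  then show "\<forall>x\<in>{0..<h}. 0 < f1 x" "\<forall>x\<in>{0..<k}. 0 < g1 x" using y x by auto
qed

section \<open>The maximum principle for Azema--Yor tangents\<close>

text \<open>
  The properties of the function \<open>E ((X - x)\<^sup>+)\<close> for a centred law on \<open>[c, h]\<close>.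
\<close>

definition AY_potential :: "real \<Rightarrow> real \<Rightarrow> (real \<Rightarrow> real) \<Rightarrow> bool" where
  "AY_potential c h f \<longleftrightarrow> convex_on UNIV f \<and> continuous_on UNIV f \<and> (\<forall>x. 0 \<le> f x \<and> - x \<le> f x)
     \<and> (\<forall>x\<ge>h. f x = 0) \<and> (\<forall>x\<le>c. f x = - x) \<and> (\<forall>x y. x \<le> y \<longrightarrow> f y \<le> f x \<and> f x - f y \<le> y - x)"

lemma AY_potentialD:
  assumes "AY_potential c h f"
  shows "convex_on UNIV f" "continuous_on UNIV f" "\<And>x. 0 \<le> f x" "\<And>x. - x \<le> f x"
    "\<And>x. h \<le> x \<Longrightarrow> f x = 0" "\<And>x. x \<le> c \<Longrightarrow> f x = - x" "\<And>x y. x \<le> y \<Longrightarrow> f y \<le> f x"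
    "\<And>x y. x \<le> y \<Longrightarrow> f x - f y \<le> y - x"
  using assms unfolding AY_potential_def by blast+

text \<open>
  Tangents of slope \<open>- p\<close> from the points \<open>(s, 0)\<close>.  For the law of a stopped Brownian motion, \<open>p\<close> will be the
  probability that the running supremum reaches \<open>s\<close>.
\<close>

definition AY_tangency :: "(real \<Rightarrow> real) \<Rightarrow> real \<Rightarrow> real \<Rightarrow> (real \<Rightarrow> real) \<Rightarrow> bool" where
  "AY_tangency f c h a \<longleftrightarrow>
     (\<forall>s\<in>{0<..<h}. c \<le> a s \<and> a s < s \<and>
        (\<exists>p\<in>{0..1}. f (a s) = (s - a s) * p \<and> (\<forall>y. (s - y) * p \<le> f y)))"

text \<open>
  If \<open>f1\<close> vanished from some \<open>y < h\<close> on, the contact points for \<open>s\<close> just above \<open>y\<close> would be squeezed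
  between \<open>y\<close> and \<open>s\<close>, which forces \<open>f2 y = 0\<close>.
\<close>

lemma AY_positivity:
  assumes p1: "AY_potential c h f1" and p2: "AY_potential c h f2"
    and t: "AY_tangency f1 c h a" "AY_tangency f2 c h a"
    and pos: "\<And>x. x < h \<Longrightarrow> 0 < f2 x" and h: "0 < h" and z: "0 < f1 0"
  shows "\<And>x. x < h \<Longrightarrow> 0 < f1 x"
proof -
  note D1 = AY_potentialD[OF p1] and D2 = AY_potentialD[OF p2]
  obtain y where y: "0 < y" "y \<le> h" "f1 y = 0" "\<And>x. 0 \<le> x \<Longrightarrow> x < y \<Longrightarrow> 0 < f1 x"
    by (rule first_zero[of f1 h]) (use D1 h z continuous_on_subset[OF D1(2), of "{0..}"] in auto)
  have yp: "0 < f1 x" if "x < y" for x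
    using y(4)[of x] D1(4)[of x] that by (cases "0 \<le> x") auto
  have "h \<le> y"
  proof (rule ccontr)
    assume n: "\<not> h \<le> y"
    then obtain u where u: "\<And>n. u n < h" "\<And>n. y < u n" "u \<longlonglongrightarrow> y" using right_approach[of y h] by auto
    have le: "f2 (u n) \<le> u n - y" for n
    proof -
      have un: "u n \<in> {0<..<h}" using u(1,2)[of n] y by auto
      obtain p where p: "p \<in> {0..1}" "f1 (a (u n)) = (u n - a (u n)) * p" "\<And>y. (u n - y) * p \<le> f1 y"
        using t(1) un unfolding AY_tangency_def by blast
      obtain q where q: "q \<in> {0..1}" "f2 (a (u n)) = (u n - a (u n)) * q"
        using t(2) un unfolding AY_tangency_def by blast
      have au: "a (u n) < u n" using t(1) un unfolding AY_tangency_def by blast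
      have "p = 0" using p(1) p(3)[of y] y(3) u(2)[of n] by (auto simp: mult_le_0_iff)
      then have "y \<le> a (u n)" using p(2) yp[of "a (u n)"] by (cases "a (u n) < y") auto
      have "f2 (u n) \<le> f2 (a (u n))" using D2(7) au by auto
      also have "\<dots> \<le> (u n - a (u n)) * 1" unfolding q(2) using q(1) au by (intro mult_left_mono) auto
      finally show ?thesis using \<open>y \<le> a (u n)\<close> by simp
    qed
    have "f2 y \<le> y - y"
    proof (rule LIMSEQ_le)
      show "(\<lambda>n. f2 (u n)) \<longlonglongrightarrow> f2 y"
        by (rule continuous_on_tendsto_compose[OF D2(2) u(3)]) auto
      show "(\<lambda>n. u n - y) \<longlonglongrightarrow> y - y" by (intro tendsto_intros u)
    qed (use le in auto)
    then show False using pos[of y] n by simp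
  qed
  then show "\<And>x. x < h \<Longrightarrow> 0 < f1 x" using yp by auto
qed

lemma AY_touches_mono:
  assumes t: "touches UNIV g 0 s y l" "touches UNIV g 0 s' a m"
    and l: "l < 0" and s: "s' < s" "0 \<le> s' + a"
  shows "y \<le> a"
proof (rule ccontr)
  assume n: "\<not> y \<le> a"
  have 1: "- ((s' + y) * m) \<le> - ((s + y) * l)" and 2: "- ((s + a) * l) \<le> - ((s' + a) * m)"
    using t by (auto simp: touches_def dest: spec[of _ y] spec[of _ a])
  from 1 2 have "(y - a) * l \<le> (y - a) * m" by (simp add: algebra_simps)
  then have "l \<le> m" using n by simp
  then have "(s' + a) * l \<le> (s' + a) * m" using s by (intro mult_left_mono) auto
  then have "(s' + a) * l \<le> (s + a) * l" using 2 by simp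
  then have "s + a \<le> s' + a" using l by simp
  then show False using s by simp
qed

text \<open>
  The same principle as for the Perkins tangents, but the anchors lie on the axis, where both
  tangents have height \<open>0\<close>; a single transfer of the maximum therefore shows that it is not positive.
  The half-line is reflected in order to use \<open>touches\<close>.
\<close>

lemma AY_comparison:
  assumes p1: "AY_potential c h f1" and p2: "AY_potential c h f2"
    and t: "AY_tangency f1 c h a" "AY_tangency f2 c h a"
    and pos: "\<And>x. x < h \<Longrightarrow> 0 < f2 x" "\<And>x. c < x \<Longrightarrow> - x < f2 x" and ch: "c < 0" "0 < h"
  shows "f1 x \<le> f2 x"
proof -
  note D1 = AY_potentialD[OF p1] and D2 = AY_potentialD[OF p2]
  have "continuous_on {c..h} (\<lambda>x. f1 x - f2 x)"
    using continuous_on_subset[OF D1(2)] continuous_on_subset[OF D2(2)] by (intro continuous_on_diff) auto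
  then obtain x0 where x0: "x0 \<in> {c..h}" "\<And>z. z \<in> {c..h} \<Longrightarrow> f1 z - f2 z \<le> f1 x0 - f2 x0"
    using continuous_attains_sup[of "{c..h}" "\<lambda>x. f1 x - f2 x"] ch by auto
  have "f1 x0 - f2 x0 \<le> 0"
  proof (rule ccontr)
    assume M: "\<not> f1 x0 - f2 x0 \<le> 0"
    have ends: "f1 z - f2 z = 0" if "z \<le> c \<or> h \<le> z" for z using that D1(5,6) D2(5,6) by auto
    then have x0': "c < x0" "x0 < h" using M x0(1) by (force simp: not_less le_less)+
    have mx: "f1 z - f2 z \<le> f1 x0 - f2 x0" for z
      using x0(2)[of z] ends[of z] M by (cases "z \<in> {c..h}") auto
    define g1 g2 where "g1 = (\<lambda>y. f1 (- y))" and "g2 = (\<lambda>y. f2 (- y))"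
    define y where "y = - x0"
    have cvx: "convex_on UNIV g" if g: "g = (\<lambda>y. f (- y))" and f: "convex_on UNIV f" for f g :: "real \<Rightarrow> real"
    proof (rule convex_onI)
      fix t x z :: real assume "0 < t" "t < 1"
      then show "g ((1 - t) *\<^sub>R x + t *\<^sub>R z) \<le> (1 - t) * g x + t * g z"
        using convex_onD[OF f, of t "-x" "-z"] by (simp add: g algebra_simps)
    qed auto
    have c1: "convex_on UNIV g1" and c2: "convex_on UNIV g2"
      using cvx[OF g1_def D1(1)] cvx[OF g2_def D2(1)] .
    have cont: "continuous_on UNIV g1" unfolding g1_def
      by (rule continuous_on_compose2[OF D1(2)]) (auto intro!: continuous_intros)
    obtain l where l: "\<And>z. z \<in> UNIV \<Longrightarrow> y < z \<Longrightarrow> g2 y - g2 z \<le> (z - y) * l"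
      "\<And>l'. (\<And>z. z \<in> UNIV \<Longrightarrow> y < z \<Longrightarrow> g2 y - g2 z \<le> (z - y) * l') \<Longrightarrow> l \<le> l'"
      "\<And>z. z \<in> UNIV \<Longrightarrow> g2 y - (z - y) * l \<le> g2 z"
      by (rule steepest_chord[OF c2, of y "y + 1" "y - 1"]) auto
    have gy: "0 < g2 y" "y < g2 y" using pos x0' by (auto simp: g2_def y_def)
    have hl: "g2 y + (h + y) * l \<le> 0" using l(3)[of "-h"] D2(5)[of h] by (simp add: g2_def algebra_simps)
    have hy: "0 < h + y" using x0' by (simp add: y_def)
    have ln: "l < 0" using hl hy gy by (smt (verit) mult_nonneg_nonneg)
    have l1: "- 1 \<le> l" using l(1)[of "y + 1"] D2(8)[of "- (y + 1)" "- y"] by (simp add: g2_def)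
    define s where "s = - y - g2 y / l"
    have sl: "(s + y) * l = - g2 y" using ln by (simp add: s_def)
    have sy: "0 < s + y" using gy ln by (simp add: s_def divide_pos_neg)
    have "(h + y) * l \<le> (s + y) * l" using hl sl by simp
    then have sh: "s \<le> h" using ln by simp
    have "(s + y) * (- l) \<le> (s + y) * 1" using l1 sy by (intro mult_left_mono) auto
    then have s0: "0 < s" using sl gy by simp
    have t2: "touches UNIV g2 0 s y l"
    proof -
      have "0 - (s + z) * l \<le> g2 z" for z using l(3)[of z] sl by (simp add: algebra_simps)
      then show ?thesis using sl by (simp add: touches_def)
    qed
    have T: "\<exists>m\<in>{-1..0}. touches UNIV (\<lambda>y. f (- y)) 0 u (- a u) m \<and> f (a u) = (u - a u) * - m"
      if tt: "AY_tangency f c h a" "0 < u" "u < h" for u f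
    proof -
      obtain p where "p \<in> {0..1}" "f (a u) = (u - a u) * p" "\<And>y. (u - y) * p \<le> f y"
        using tt unfolding AY_tangency_def by (metis greaterThanLessThan_iff)
      note p = this
      have "0 - (u + z) * - p \<le> f (- z)" for z using p(3)[of "- z"] by simp
      then show ?thesis using p by (intro bexI[of _ "- p"]) (auto simp: touches_def algebra_simps)
    qed
    have au: "c \<le> a u" "a u < u" if "0 < u" "u < h" for u
      using t(1) that unfolding AY_tangency_def by auto
    have mono1: "y \<le> - a u" if u: "0 < u" "u < s" for u
    proof -
      have "u < h" using u sh by simp
      then obtain m where "touches UNIV g2 0 u (- a u) m" using T[OF t(2) u(1)] unfolding g2_def by blast
      then show ?thesis using AY_touches_mono[OF t2 _ ln u(2)] au[of u] u \<open>u < h\<close> by auto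
    qed
    have mono2: "- a u \<le> y" if u: "s < u" "u < h" for u
    proof -
      have u0: "0 < u" using u s0 by simp
      then obtain m where m: "touches UNIV g2 0 u (- a u) m" "f2 (a u) = (u - a u) * - m" "m \<le> 0"
        using T[OF t(2) u0 u(2)] unfolding g2_def by auto
      have "0 < f2 (a u)" using pos(1)[of "a u"] au[of u] u0 u by auto
      then have "m \<noteq> 0" using m by auto
      then show ?thesis using AY_touches_mono[OF m(1) t2 _ u(1)] m sy by auto
    qed
    have lim: "\<exists>b\<in>{lo..hi}. - s \<le> b \<and> (\<exists>m. touches UNIV g1 0 s b m)"
      if u: "\<And>n::nat. 0 < u n" "\<And>n. u n < h" "u \<longlonglongrightarrow> s" "\<And>n. - a (u n) \<in> {lo..hi}" for u lo hi
    proof -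
      have "\<forall>n. \<exists>m\<in>{-1..0}. touches UNIV g1 0 (u n) (- a (u n)) m"
        using T[OF t(1)] u unfolding g1_def by blast
      then obtain m where m: "\<And>n. m n \<in> {-1..0}" "\<And>n. touches UNIV g1 0 (u n) (- a (u n)) (m n)"
        by metis
      have sb: "- u n \<le> - a (u n)" for n using au(2)[OF u(1,2)] by (simp add: less_imp_le)
      from touches_limit[OF m(2) u(4) m(1) subset_UNIV tendsto_const u(3) cont sb] show ?thesis by blast
    qed
    obtain w where w: "\<And>n. 0 < w n" "\<And>n. w n < s" "w \<longlonglongrightarrow> s" using left_approach[OF s0] by metis
    have wh: "w n < h" for n using w(2)[of n] sh by linarith
    have "\<exists>b\<in>{y..- c}. - s \<le> b \<and> (\<exists>m. touches UNIV g1 0 s b m)"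
      using mono1 au w wh by (intro lim[of w]) auto
    then obtain b1 m1 where b1: "y \<le> b1" "touches UNIV g1 0 s b1 m1" by auto
    obtain b0 m0 where b0: "- s \<le> b0" "b0 \<le> y" "touches UNIV g1 0 s b0 m0"
    proof (cases "s = h")
      case True
      have "touches UNIV g1 0 s (- h) m1" using b1(2) True D1(5)[of h] by (auto simp: touches_def g1_def)
      then show ?thesis using hy True that[of "-h" m1] by auto
    next
      case False
      then obtain u where u: "\<And>n. u n < h" "\<And>n. s < u n" "u \<longlonglongrightarrow> s" using right_approach[of s h] sh by auto
      have u0: "0 < u n" for n using u(2)[of n] s0 by linarith
      have "\<exists>b\<in>{- h..y}. - s \<le> b \<and> (\<exists>m. touches UNIV g1 0 s b m)"
      proof (intro lim[of u])
        show "- a (u n) \<in> {- h..y}" for n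
          using mono2[OF u(2,1)] au(2)[OF u0 u(1)] u(1) by (metis atLeastAtMost_iff less_imp_le less_trans neg_le_iff_le)
      qed (use u u0 in auto)
      then show ?thesis using that by (meson atLeastAtMost_iff)
    qed
    have "g1 y - g2 y \<le> 0 - 0"
      by (rule touches_max_transfer[OF b0(3) b1(2) b0(2) b1(1) _ b0(1) _ c1 _ l(2)])
         (use sl sy mx in \<open>auto simp: g1_def g2_def y_def\<close>)
    then show False using M by (simp add: g1_def g2_def y_def)
  qed
  then show ?thesis using x0(2)[of x] D1(5,6) D2(5,6) by (cases "x \<in> {c..h}") (auto simp: not_le)
qed

section \<open>Brownian increments and limits of bounded sequences in L2\<close>

locale brownian = usual_filtered_prob_space M \<F> for M :: "'a measure" and \<F> :: "ennreal \<Rightarrow> 'a measure" +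
  fixes W :: "real \<Rightarrow> 'a \<Rightarrow> real"
  assumes bm: "brownian_motion M \<F> W"
begin

lemma sets_F_subset: "sets (\<F> t) \<subseteq> sets M"
  using subalgebra_F by (auto simp: subalgebra_def)

lemma measurable_F: "X \<in> borel_measurable (\<F> t) \<Longrightarrow> X \<in> borel_measurable M"
  using measurable_from_subalg[OF subalgebra_F] .

lemma measurable_F_mono: "X \<in> borel_measurable (\<F> s) \<Longrightarrow> s \<le> t \<Longrightarrow> X \<in> borel_measurable (\<F> t)"
  using sets_F_mono[of s t] unfolding measurable_def by (auto simp: space_F)

lemma W_measurable_F: "0 \<le> t \<Longrightarrow> W t \<in> borel_measurable (\<F> (ennreal t))"
  using bm by (auto simp: brownian_motion_def)

lemma W_measurable: "0 \<le> t \<Longrightarrow> W t \<in> borel_measurable M"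
  using W_measurable_F measurable_F by blast

text \<open>
  By completeness every event of \<open>\<F> t\<close> may be changed on a null set; this disposes of the paths that are not
  continuous.
\<close>

lemma F_AE:
  assumes A: "A \<in> sets (\<F> t)" and B: "B \<subseteq> space M" and ae: "AE \<omega> in M. \<omega> \<in> A \<longleftrightarrow> \<omega> \<in> B"
  shows "B \<in> sets (\<F> t)"
proof -
  have n: "AE \<omega> in M. \<omega> \<notin> A - B \<and> \<omega> \<notin> B - A" using ae by eventually_elim auto
  have "A \<subseteq> space M" using A sets_F_subset sets.sets_into_space by blast
  then have "A - B \<in> null_sets M" "B - A \<in> null_sets M"
    using n B by (auto simp: null_sets_iff_AE)
  then have "A - B \<in> sets (\<F> t)" "B - A \<in> sets (\<F> t)"
    using null_sets_F sets_F_mono[of 0 t] by auto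
  then have "(A - (A - B)) \<union> (B - A) \<in> sets (\<F> t)" using A by auto
  also have "(A - (A - B)) \<union> (B - A) = B" by auto
  finally show ?thesis .
qed

definition continuous_path :: "'a \<Rightarrow> bool" where
  "continuous_path \<omega> \<longleftrightarrow> W 0 \<omega> = 0 \<and> continuous_on {0..} (\<lambda>t. W t \<omega>)"

lemma AE_continuous_path: "AE \<omega> in M. continuous_path \<omega>"
  using bm unfolding brownian_motion_def continuous_path_def by auto

lemma increment_normal:
  assumes "0 \<le> s" "s < t"
  shows "distributed M lborel (\<lambda>\<omega>. W t \<omega> - W s \<omega>) (\<lambda>x. ennreal (normal_density 0 (sqrt (t - s)) x))"
  using bm assms unfolding brownian_motion_def by blast

lemma increment_indep:
  assumes st: "0 \<le> s" "s < t" and Y: "Y \<in> borel_measurable (\<F> (ennreal s))"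
  shows "indep_var borel Y borel (\<lambda>\<omega>. W t \<omega> - W s \<omega>)"
proof -
  have i: "indep_set (sets (\<F> (ennreal s))) (sets (vimage_algebra (space M) (\<lambda>\<omega>. W t \<omega> - W s \<omega>) borel))"
    using bm st unfolding brownian_motion_def by blast
  have Ym: "Y \<in> borel_measurable M" using Y measurable_F by blast
  have Xm: "(\<lambda>\<omega>. W t \<omega> - W s \<omega>) \<in> borel_measurable M"
    using W_measurable[of t] W_measurable[of s] st by auto
  have 1: "sigma_sets (space M) {Y -` A \<inter> space M |A. A \<in> sets borel} \<subseteq> sets (\<F> (ennreal s))"
  proof -
    have "{Y -` A \<inter> space M |A. A \<in> sets borel} \<subseteq> sets (\<F> (ennreal s))"
      using measurable_sets[OF Y] by (auto simp: space_F)
    then show ?thesis using sets.sigma_sets_subset[of _ "\<F> (ennreal s)"] by (auto simp: space_F)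
  qed
  have 2: "sigma_sets (space M) {(\<lambda>\<omega>. W t \<omega> - W s \<omega>) -` A \<inter> space M |A. A \<in> sets borel}
     \<subseteq> sets (vimage_algebra (space M) (\<lambda>\<omega>. W t \<omega> - W s \<omega>) borel)"
    by (auto simp: sets_vimage_algebra)
  show ?thesis
    unfolding indep_var_eq indep_sets2_eq
    using i[unfolded indep_sets2_eq] 1 2 Ym Xm by (meson subset_iff order_trans)
qed

lemma increment_moments:
  assumes st: "0 \<le> s" "s < t"
  shows "integrable M (\<lambda>\<omega>. W t \<omega> - W s \<omega>)" "expectation (\<lambda>\<omega>. W t \<omega> - W s \<omega>) = 0"
    "integrable M (\<lambda>\<omega>. (W t \<omega> - W s \<omega>)\<^sup>2)" "expectation (\<lambda>\<omega>. (W t \<omega> - W s \<omega>)\<^sup>2) = t - s"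
proof -
  let ?\<sigma> = "sqrt (t - s)"
  have sp: "0 < ?\<sigma>" using st by simp
  note d = increment_normal[OF st]
  have m1: "has_bochner_integral lborel (\<lambda>x. normal_density 0 ?\<sigma> x * x) 0"
    using normal_moment_nz_1[OF sp, of 0] .
  have m2: "has_bochner_integral lborel (\<lambda>x. normal_density 0 ?\<sigma> x * x\<^sup>2) (t - s)"
    using normal_moment_even[OF sp, of 0 1] st by (simp add: power2_eq_square diff_divide_distrib)
  show "integrable M (\<lambda>\<omega>. W t \<omega> - W s \<omega>)"
    using distributed_integrable[OF d, of "\<lambda>x. x"] m1 by (auto simp: has_bochner_integral_iff)
  show "expectation (\<lambda>\<omega>. W t \<omega> - W s \<omega>) = 0"
    using distributed_integral[OF d, of "\<lambda>x. x"] m1 by (auto simp: has_bochner_integral_iff)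
  show "integrable M (\<lambda>\<omega>. (W t \<omega> - W s \<omega>)\<^sup>2)"
    using distributed_integrable[OF d, of "\<lambda>x. x\<^sup>2"] m2 by (auto simp: has_bochner_integral_iff)
  show "expectation (\<lambda>\<omega>. (W t \<omega> - W s \<omega>)\<^sup>2) = t - s"
    using distributed_integral[OF d, of "\<lambda>x. x\<^sup>2"] m2 by (auto simp: has_bochner_integral_iff)
qed

lemma increment_orthogonal:
  assumes st: "0 \<le> s" "s < t" and Y: "Y \<in> borel_measurable (\<F> (ennreal s))" "integrable M Y"
  shows "integrable M (\<lambda>\<omega>. Y \<omega> * (W t \<omega> - W s \<omega>))" "expectation (\<lambda>\<omega>. Y \<omega> * (W t \<omega> - W s \<omega>)) = 0"
    "integrable M (\<lambda>\<omega>. Y \<omega> * (W t \<omega> - W s \<omega>)\<^sup>2)"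
    "expectation (\<lambda>\<omega>. Y \<omega> * (W t \<omega> - W s \<omega>)\<^sup>2) = expectation Y * (t - s)"
proof -
  note i = increment_indep[OF st Y(1)] and m = increment_moments[OF st]
  have i2: "indep_var borel Y borel (\<lambda>\<omega>. (W t \<omega> - W s \<omega>)\<^sup>2)"
    using indep_var_compose[OF i, of id borel "\<lambda>x. x\<^sup>2" borel] by (simp add: o_def id_def)
  show "integrable M (\<lambda>\<omega>. Y \<omega> * (W t \<omega> - W s \<omega>))" using indep_var_integrable[OF i Y(2) m(1)] .
  show "expectation (\<lambda>\<omega>. Y \<omega> * (W t \<omega> - W s \<omega>)) = 0" using indep_var_lebesgue_integral[OF i Y(2) m(1)] m by simp
  show "integrable M (\<lambda>\<omega>. Y \<omega> * (W t \<omega> - W s \<omega>)\<^sup>2)" using indep_var_integrable[OF i2 Y(2) m(3)] .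
  show "expectation (\<lambda>\<omega>. Y \<omega> * (W t \<omega> - W s \<omega>)\<^sup>2) = expectation Y * (t - s)"
    using indep_var_lebesgue_integral[OF i2 Y(2) m(3)] m by simp
qed

end

context prob_space begin

lemma integrable_of_square:
  assumes "X \<in> borel_measurable M" "integrable M (\<lambda>\<omega>. (X \<omega>)\<^sup>2 :: real)" shows "integrable M X"
proof -
  have b: "\<bar>x\<bar> \<le> 1 + x\<^sup>2" for x :: real
  proof -
    have "0 \<le> (\<bar>x\<bar> - 1)\<^sup>2" by simp
    then have "2 * \<bar>x\<bar> \<le> 1 + x\<^sup>2" by (simp add: power2_diff)
    then show ?thesis by simp
  qed
  have i: "integrable M (\<lambda>\<omega>. 1 + (X \<omega>)\<^sup>2)" by (intro Bochner_Integration.integrable_add assms(2)) simp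
  have "norm (X x) \<le> norm (1 + (X x)\<^sup>2)" for x
    using order_trans[OF b abs_ge_self] by (simp only: real_norm_def)
  then show ?thesis by (intro Bochner_Integration.integrable_bound[OF i assms(1)] AE_I2)
qed

text \<open>
  A bound in \<open>L\<^sup>2\<close> replaces domination: truncation at level \<open>L\<close> changes each expectation by at most \<open>K / L\<close>, and
  truncated variables converge by dominated convergence.
\<close>

lemma L2_bounded_limit:
  fixes X :: "nat \<Rightarrow> 'a \<Rightarrow> real"
  assumes m: "\<And>n. X n \<in> borel_measurable M" "Y \<in> borel_measurable M"
    and lim: "AE \<omega> in M. (\<lambda>n. X n \<omega>) \<longlonglongrightarrow> Y \<omega>"
    and sq: "\<And>n. integrable M (\<lambda>\<omega>. (X n \<omega>)\<^sup>2)" "\<And>n. expectation (\<lambda>\<omega>. (X n \<omega>)\<^sup>2) \<le> K"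
    and e: "\<And>n. expectation (X n) = 0"
  shows "integrable M Y" "expectation Y = 0"
proof -
  have "0 \<le> expectation (\<lambda>\<omega>. (X 0 \<omega>)\<^sup>2)" by simp
  then have K: "0 \<le> K" using sq(2)[of 0] by linarith
  have "(\<integral>\<^sup>+\<omega>. ennreal ((Y \<omega>)\<^sup>2) \<partial>M) = (\<integral>\<^sup>+\<omega>. liminf (\<lambda>n. ennreal ((X n \<omega>)\<^sup>2)) \<partial>M)"
  proof (rule nn_integral_cong_AE, use lim in eventually_elim)
    fix \<omega> assume "(\<lambda>n. X n \<omega>) \<longlonglongrightarrow> Y \<omega>"
    then have "(\<lambda>n. ennreal ((X n \<omega>)\<^sup>2)) \<longlonglongrightarrow> ennreal ((Y \<omega>)\<^sup>2)" by (intro tendsto_intros)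
    then show "ennreal ((Y \<omega>)\<^sup>2) = liminf (\<lambda>n. ennreal ((X n \<omega>)\<^sup>2))"
      by (rule lim_imp_Liminf[OF sequentially_bot, symmetric])
  qed
  also have "\<dots> \<le> liminf (\<lambda>n. \<integral>\<^sup>+\<omega>. ennreal ((X n \<omega>)\<^sup>2) \<partial>M)"
    by (rule nn_integral_liminf) (use m in auto)
  also have "\<dots> \<le> ennreal K"
  proof (rule Liminf_le)
    show "\<forall>\<^sub>F n in sequentially. (\<integral>\<^sup>+\<omega>. ennreal ((X n \<omega>)\<^sup>2) \<partial>M) \<le> ennreal K"
      using sq by (auto simp: nn_integral_eq_integral intro!: ennreal_leI always_eventually)
  qed simp
  finally have le: "(\<integral>\<^sup>+\<omega>. ennreal ((Y \<omega>)\<^sup>2) \<partial>M) \<le> ennreal K" .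
  have sY: "integrable M (\<lambda>\<omega>. (Y \<omega>)\<^sup>2)"
    by (rule integrableI_nonneg) (use m le in \<open>auto intro: le_less_trans\<close>)
  have eY: "expectation (\<lambda>\<omega>. (Y \<omega>)\<^sup>2) \<le> K"
  proof -
    have "ennreal (expectation (\<lambda>\<omega>. (Y \<omega>)\<^sup>2)) = (\<integral>\<^sup>+\<omega>. ennreal ((Y \<omega>)\<^sup>2) \<partial>M)"
      using sY by (intro nn_integral_eq_integral[symmetric]) auto
    then have "ennreal (expectation (\<lambda>\<omega>. (Y \<omega>)\<^sup>2)) \<le> ennreal K" using le by metis
    then show ?thesis using K by (simp only: ennreal_le_iff)
  qed
  show iY: "integrable M Y" by (rule integrable_of_square[OF m(2) sY])
  have iX: "integrable M (X n)" for n by (rule integrable_of_square[OF m(1) sq(1)])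
  define cl where "cl L x = max (- L) (min L x)" for L x :: real
  have clm: "cl L \<in> borel_measurable borel" for L unfolding cl_def by measurable
  have err: "\<bar>x - cl L x\<bar> \<le> x\<^sup>2 / L" if L: "0 < L" for x L
  proof (cases "\<bar>x\<bar> \<le> L")
    case True then show ?thesis using L by (auto simp: cl_def max_def min_def)
  next
    case False
    have "\<bar>x - cl L x\<bar> \<le> \<bar>x\<bar>" using False L by (auto simp: cl_def max_def min_def)
    also have "\<dots> \<le> \<bar>x\<bar> * (\<bar>x\<bar> / L)" using False L mult_left_mono[of 1 "\<bar>x\<bar> / L" "\<bar>x\<bar>"] by simp
    also have "\<dots> = x\<^sup>2 / L" by (simp add: power2_eq_square)
    finally show ?thesis .
  qed
  have bd: "\<bar>expectation Z - expectation (\<lambda>\<omega>. cl L (Z \<omega>))\<bar> \<le> K / L"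
    if L: "0 < L" and Z: "integrable M Z" "integrable M (\<lambda>\<omega>. (Z \<omega>)\<^sup>2)" "expectation (\<lambda>\<omega>. (Z \<omega>)\<^sup>2) \<le> K" for Z L
  proof -
    have [measurable]: "Z \<in> borel_measurable M" using Z by auto
    have ic: "integrable M (\<lambda>\<omega>. cl L (Z \<omega>))"
      by (rule integrable_const_bound[of _ L]) (use L clm in \<open>auto simp: cl_def\<close>)
    have "\<bar>expectation Z - expectation (\<lambda>\<omega>. cl L (Z \<omega>))\<bar> = \<bar>expectation (\<lambda>\<omega>. Z \<omega> - cl L (Z \<omega>))\<bar>"
      using Z ic by simp
    also have "\<dots> \<le> expectation (\<lambda>\<omega>. \<bar>Z \<omega> - cl L (Z \<omega>)\<bar>)" by (rule integral_abs_bound)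
    also have "\<dots> \<le> expectation (\<lambda>\<omega>. (Z \<omega>)\<^sup>2 / L)"
      by (rule integral_mono) (use Z ic err[OF L] in auto)
    also have "\<dots> \<le> K / L" using Z L by (simp add: divide_right_mono)
    finally show ?thesis .
  qed
  have cllim: "(\<lambda>n. expectation (\<lambda>\<omega>. cl L (X n \<omega>))) \<longlonglongrightarrow> expectation (\<lambda>\<omega>. cl L (Y \<omega>))" if L: "0 < L" for L
  proof (rule integral_dominated_convergence[where w="\<lambda>_. L"])
    show "AE \<omega> in M. (\<lambda>n. cl L (X n \<omega>)) \<longlonglongrightarrow> cl L (Y \<omega>)"
      using lim unfolding cl_def by eventually_elim (intro tendsto_intros)
  qed (use m L in \<open>auto simp: cl_def\<close>)
  have "\<bar>expectation Y\<bar> \<le> 2 * K / L" if L: "0 < L" for L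
  proof -
    have 1: "\<bar>expectation (\<lambda>\<omega>. cl L (X n \<omega>))\<bar> \<le> K / L" for n
      using bd[OF L iX sq(1) sq(2), of n] e[of n] by simp
    have "\<bar>expectation (\<lambda>\<omega>. cl L (Y \<omega>))\<bar> \<le> K / L"
      by (rule LIMSEQ_le_const2[OF tendsto_rabs[OF cllim[OF L]]]) (use 1 in auto)
    then show ?thesis using bd[OF L iY sY eY] by simp
  qed
  note B = this
  have "\<bar>expectation Y\<bar> \<le> 0 + e" if e: "0 < e" for e
  proof -
    define L where "L = (2 * K + 1) / e"
    have L: "0 < L" using K e by (simp add: L_def)
    have "2 * K / L \<le> (2 * K + 1) / L" using L by (intro divide_right_mono) auto
    also have "\<dots> = e" using e K by (simp add: L_def)
    finally show ?thesis using B[OF L] by simp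
  qed
  then show "expectation Y = 0" using field_le_epsilon[of "\<bar>expectation Y\<bar>" 0] by auto
qed

end

section \<open>Optional stopping at bounded times\<close>

context brownian begin

lemma stopping_time_gt: "stopping_time \<F> \<tau> \<Longrightarrow> {\<omega>\<in>space M. t < \<tau> \<omega>} \<in> sets (\<F> t)"
  using stopping_timeD2[of \<F> \<tau> t] by (simp add: pred_def space_F)

lemma stopping_time_le: "stopping_time \<F> \<tau> \<Longrightarrow> {\<omega>\<in>space M. \<tau> \<omega> \<le> t} \<in> sets (\<F> t)"
  using stopping_timeD[of \<F> \<tau> t] by (simp add: pred_def space_F)

lemma stopping_time_measurable: "stopping_time \<F> \<tau> \<Longrightarrow> \<tau> \<in> borel_measurable M"
  by (rule measurable_stopping_time[where F=\<F>]) (use sets_F_subset in \<open>auto simp: space_F\<close>)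

lemma path_LIMSEQ:
  assumes g: "continuous_path \<omega>" and t: "0 \<le> t" and u: "u \<longlonglongrightarrow> t" "\<And>n. 0 \<le> u n"
  shows "(\<lambda>n. W (u n) \<omega>) \<longlonglongrightarrow> W t \<omega>"
proof (rule continuous_on_tendsto_compose[OF _ u(1)])
  show "continuous_on {0..} (\<lambda>t. W t \<omega>)" using g by (simp add: continuous_path_def)
qed (use t u(2) in auto)

lemma AE_limit_measurable:
  fixes X :: "nat \<Rightarrow> 'a \<Rightarrow> real"
  assumes X: "\<And>n. X n \<in> borel_measurable M" and lim: "AE \<omega> in M. (\<lambda>n. X n \<omega>) \<longlonglongrightarrow> Y \<omega>"
  shows "Y \<in> borel_measurable M"
proof -
  have L: "(\<lambda>\<omega>. lim (\<lambda>n. X n \<omega>)) \<in> borel_measurable M" using X by measurable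
  have ae: "AE \<omega> in M. lim (\<lambda>n. X n \<omega>) = Y \<omega>" using lim by eventually_elim (rule limI)
  show ?thesis
  proof (rule measurableI)
    fix A :: "real set" assume A: "A \<in> sets borel"
    show "Y -` A \<inter> space M \<in> sets M"
      by (rule in_sets_AE[OF _ measurable_sets[OF L A]]) (use ae in \<open>auto elim!: eventually_mono\<close>)
  qed simp
qed

text \<open>
  On a grid, \<open>W\<close> at the first grid point after \<open>\<tau>\<close> is a sum of increments switched on by events of the
  past.  It has mean \<open>0\<close> and, by orthogonality, second moment at most \<open>T\<close>; refining the grid
  and \<open>L2_bounded_limit\<close> give the claim.
\<close>

lemma optional_stopping:
  assumes \<tau>: "stopping_time \<F> \<tau>" and T: "0 \<le> T"
  shows "integrable M (stopped_process W \<tau> T)" "expectation (stopped_process W \<tau> T) = 0"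
proof -
  define \<sigma> where "\<sigma> \<omega> = enn2real (min (ennreal T) (\<tau> \<omega>))" for \<omega>
  have \<sigma>0: "0 \<le> \<sigma> \<omega>" and \<sigma>T: "\<sigma> \<omega> \<le> T" for \<omega>
    using T enn2real_mono[of "min (ennreal T) (\<tau> \<omega>)" "ennreal T"] by (auto simp: \<sigma>_def)
  have \<sigma>lt: "ennreal u < \<tau> \<omega> \<longleftrightarrow> u < \<sigma> \<omega>" if "0 \<le> u" "u < T" for u \<omega>
  proof (cases "\<tau> \<omega>")
    case (real r)
    then show ?thesis using that T by (auto simp: \<sigma>_def min_def ennreal_less_iff ennreal_le_iff)
  next
    case top
    then show ?thesis using that T by (simp add: \<sigma>_def min_def)
  qed
  have sp: "stopped_process W \<tau> T = (\<lambda>\<omega>. W (\<sigma> \<omega>) \<omega>)"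
    by (auto simp: stopped_process_def at_time_def \<sigma>_def)
  define t where "t N k = real k * T / real (Suc N)" for N k
  have t0: "0 \<le> t N k" for N k using T by (simp add: t_def)
  define V where "V N j \<omega> = (\<Sum>k<j. indicator {\<omega>\<in>space M. ennreal (t N k) < \<tau> \<omega>} \<omega> * (W (t N (Suc k)) \<omega> - W (t N k) \<omega>))" for N j \<omega>
  show "integrable M (stopped_process W \<tau> T)" "expectation (stopped_process W \<tau> T) = 0"
  proof (atomize (full), cases "T = 0")
    case True
    then have "\<sigma> \<omega> = 0" for \<omega> using \<sigma>0[of \<omega>] \<sigma>T[of \<omega>] by simp
    then have e: "stopped_process W \<tau> T = W 0" by (auto simp: sp)
    have z: "AE \<omega> in M. W 0 \<omega> = 0" using AE_continuous_path by eventually_elim (simp add: continuous_path_def)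
    have "integrable M (W 0)" using integrable_cong_AE[of "W 0" M "\<lambda>_. 0"] z W_measurable[of 0] by simp
    moreover have "expectation (W 0) = 0" using integral_cong_AE[of "W 0" M "\<lambda>_. 0"] z W_measurable[of 0] by simp
    ultimately show "integrable M (stopped_process W \<tau> T) \<and> expectation (stopped_process W \<tau> T) = 0" by (simp add: e)
  next
    case False
    then have Tp: "0 < T" using T by simp
    have tS: "t N k < t N (Suc k)" for N k using Tp by (simp add: t_def divide_strict_right_mono)
    have V: "V N j \<in> borel_measurable (\<F> (ennreal (t N j))) \<and> integrable M (V N j) \<and> expectation (V N j) = 0
        \<and> integrable M (\<lambda>\<omega>. (V N j \<omega>)\<^sup>2) \<and> expectation (\<lambda>\<omega>. (V N j \<omega>)\<^sup>2) \<le> t N j" for N j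
    proof (induction j)
      case 0 then show ?case by (simp add: V_def t_def)
    next
      case (Suc j)
      let ?s = "t N j" and ?u = "t N (Suc j)"
      let ?I = "indicator {\<omega>\<in>space M. ennreal ?s < \<tau> \<omega>} :: 'a \<Rightarrow> real"
      let ?D = "\<lambda>\<omega>. W ?u \<omega> - W ?s \<omega>"
      have Im: "?I \<in> borel_measurable (\<F> (ennreal ?s))" using stopping_time_gt[OF \<tau>] by simp
      have Vm: "V N j \<in> borel_measurable (\<F> (ennreal ?s))" using Suc by simp
      have VS: "V N (Suc j) = (\<lambda>\<omega>. V N j \<omega> + ?I \<omega> * ?D \<omega>)" by (auto simp: V_def)
      have su: "ennreal ?s \<le> ennreal ?u" using tS by (intro ennreal_leI less_imp_le)
      have Ii: "integrable M ?I" using measurable_F[OF Im] by (intro integrable_const_bound[of _ 1]) auto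
      have VIm: "(\<lambda>\<omega>. V N j \<omega> * ?I \<omega>) \<in> borel_measurable (\<F> (ennreal ?s))" using Im Vm by simp
      have VIi: "integrable M (\<lambda>\<omega>. V N j \<omega> * ?I \<omega>)"
      proof (rule Bochner_Integration.integrable_bound[of M "V N j"])
        show "AE \<omega> in M. norm (V N j \<omega> * ?I \<omega>) \<le> norm (V N j \<omega>)"
          by (rule AE_I2) (simp add: indicator_def)
        show "integrable M (V N j)" using Suc by blast
      qed (rule measurable_F[OF VIm])
      note o1 = increment_orthogonal[OF t0 tS Im Ii]
      note o2 = increment_orthogonal[OF t0 tS VIm VIi]
      have m: "V N (Suc j) \<in> borel_measurable (\<F> (ennreal ?u))"
        unfolding VS using measurable_F_mono[OF Vm su] measurable_F_mono[OF Im su]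
          W_measurable_F[OF t0, of N "Suc j"] measurable_F_mono[OF W_measurable_F[OF t0] su] by measurable
      have sq: "(V N (Suc j) \<omega>)\<^sup>2 = (V N j \<omega>)\<^sup>2 + 2 * (V N j \<omega> * ?I \<omega> * ?D \<omega>) + ?I \<omega> * (?D \<omega>)\<^sup>2" for \<omega>
      proof -
        have alg: "(v + i * d)\<^sup>2 = v\<^sup>2 + 2 * (v * i * d) + (i * i) * d\<^sup>2" for v i d :: real
          by (simp add: power2_eq_square algebra_simps)
        have "?I \<omega> * ?I \<omega> = ?I \<omega>" by (simp add: indicator_def)
        then show ?thesis unfolding VS alg by simp
      qed
      have i2: "integrable M (\<lambda>\<omega>. (V N (Suc j) \<omega>)\<^sup>2)"
        unfolding sq by (intro Bochner_Integration.integrable_add integrable_mult_right o1(3) o2(1)) (use Suc in blast)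
      have "expectation (\<lambda>\<omega>. (V N (Suc j) \<omega>)\<^sup>2) = expectation (\<lambda>\<omega>. (V N j \<omega>)\<^sup>2) + expectation ?I * (?u - ?s)"
      proof -
        have i: "integrable M (\<lambda>\<omega>. (V N j \<omega>)\<^sup>2)" using Suc by blast
        show ?thesis unfolding sq using i o1(3,4) o2(1,2) by simp
      qed
      also have "\<dots> \<le> ?s + 1 * (?u - ?s)"
      proof (intro add_mono mult_right_mono)
        show "expectation ?I \<le> 1"
          using integral_mono[OF Ii, of "\<lambda>_. 1"] by (auto simp: prob_space indicator_def)
      qed (use Suc tS[of N j] in auto)
      finally have e2: "expectation (\<lambda>\<omega>. (V N (Suc j) \<omega>)\<^sup>2) \<le> ?u" by simp
      have "integrable M (V N j)" "expectation (V N j) = 0" using Suc by blast+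
      then have "integrable M (V N (Suc j))" "expectation (V N (Suc j)) = 0"
        unfolding VS using o1(1,2) by simp_all
      then show ?case using m i2 e2 by blast
    qed
    \<comment> \<open>the index of the first grid point that is not below \<open>\<sigma> \<omega>\<close>\<close>
    define u where "u N \<omega> = (nat \<lceil>\<sigma> \<omega> * real (Suc N) / T\<rceil>)" for N \<omega>
    have u_le: "u N \<omega> \<le> Suc N" for N \<omega>
    proof -
      have "\<sigma> \<omega> * real (Suc N) / T \<le> real (Suc N)"
        using \<sigma>T[of \<omega>] Tp by (simp only: pos_divide_le_eq) (simp add: mult.commute mult_right_mono)
      then show ?thesis unfolding u_def by (simp only: nat_le_iff ceiling_le_iff of_int_of_nat_eq)
    qed
    have u_iff: "t N k < \<sigma> \<omega> \<longleftrightarrow> k < u N \<omega>" for N k \<omega>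
    proof -
      have "t N k < \<sigma> \<omega> \<longleftrightarrow> real k < \<sigma> \<omega> * real (Suc N) / T"
        using Tp unfolding t_def by (simp only: pos_divide_less_eq pos_less_divide_eq of_nat_0_less_iff zero_less_Suc)
      also have "\<dots> \<longleftrightarrow> int k < \<lceil>\<sigma> \<omega> * real (Suc N) / T\<rceil>" by (simp only: less_ceiling_iff) simp
      also have "\<dots> \<longleftrightarrow> k < u N \<omega>" unfolding u_def by (simp only: zless_nat_eq_int_zless)
      finally show ?thesis .
    qed
    have Veq: "V N j \<omega> = W (t N (min j (u N \<omega>))) \<omega> - W 0 \<omega>" if \<omega>: "\<omega> \<in> space M" and j: "j \<le> Suc N" for N j \<omega>
      using j
    proof (induction j)
      case 0 then show ?case by (simp add: V_def t_def)
    next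
      case (Suc j)
      have "t N j < T" using Suc.prems Tp by (simp add: t_def pos_divide_less_eq)
      then have "ennreal (t N j) < \<tau> \<omega> \<longleftrightarrow> j < u N \<omega>" using \<sigma>lt[OF t0] u_iff by simp
      moreover have "V N (Suc j) \<omega> = V N j \<omega> + indicator {\<omega>\<in>space M. ennreal (t N j) < \<tau> \<omega>} \<omega> * (W (t N (Suc j)) \<omega> - W (t N j) \<omega>)"
        by (simp add: V_def)
      ultimately show ?case using Suc \<omega> by (cases "j < u N \<omega>") (auto simp: indicator_def min_def)
    qed
    have ulim: "(\<lambda>N. t N (u N \<omega>)) \<longlonglongrightarrow> \<sigma> \<omega>" for \<omega>
    proof (rule tendsto_sandwich)
      show "\<forall>\<^sub>F N in sequentially. \<sigma> \<omega> \<le> t N (u N \<omega>)"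
      proof (rule always_eventually, rule allI)
        show "\<sigma> \<omega> \<le> t N (u N \<omega>)" for N using u_iff[of N "u N \<omega>" \<omega>] by simp
      qed
      have "t N (u N \<omega>) \<le> \<sigma> \<omega> + T / real (Suc N)" for N
      proof (cases "u N \<omega>")
        case 0 then show ?thesis using \<sigma>0 Tp by (simp add: t_def)
      next
        case (Suc k)
        then have "t N k < \<sigma> \<omega>" using u_iff by simp
        moreover have "t N (Suc k) = t N k + T / real (Suc N)" by (simp add: t_def add_divide_distrib distrib_right)
        ultimately show ?thesis using Suc by simp
      qed
      then show "\<forall>\<^sub>F N in sequentially. t N (u N \<omega>) \<le> \<sigma> \<omega> + T / real (Suc N)" by simp
      show "(\<lambda>N. \<sigma> \<omega> + T / real (Suc N)) \<longlonglongrightarrow> \<sigma> \<omega>"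
        using tendsto_add[OF tendsto_const LIMSEQ_Suc[OF lim_const_over_n[of T]], of "\<sigma> \<omega>"] by simp
    qed simp
    have Vlim: "AE \<omega> in M. (\<lambda>N. V N (Suc N) \<omega>) \<longlonglongrightarrow> W (\<sigma> \<omega>) \<omega>"
      using AE_continuous_path AE_space
    proof eventually_elim
      fix \<omega> assume g: "continuous_path \<omega>" and sp: "\<omega> \<in> space M"
      have "(\<lambda>N. W (t N (u N \<omega>)) \<omega>) \<longlonglongrightarrow> W (\<sigma> \<omega>) \<omega>"
        by (rule path_LIMSEQ[OF g \<sigma>0 ulim t0])
      moreover have "V N (Suc N) \<omega> = W (t N (u N \<omega>)) \<omega>" for N
        using Veq[OF sp, of "Suc N" N] u_le[of N \<omega>] g by (simp add: continuous_path_def min_absorb2)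
      ultimately show "(\<lambda>N. V N (Suc N) \<omega>) \<longlonglongrightarrow> W (\<sigma> \<omega>) \<omega>" by simp
    qed
    have Vm: "V N (Suc N) \<in> borel_measurable M" for N using V measurable_F by blast
    have lm: "(\<lambda>\<omega>. W (\<sigma> \<omega>) \<omega>) \<in> borel_measurable M"
      by (rule AE_limit_measurable[OF Vm Vlim])
    have tN: "t N (Suc N) = T" for N by (simp add: t_def)
    show "integrable M (stopped_process W \<tau> T) \<and> expectation (stopped_process W \<tau> T) = 0"
    proof -
      have "integrable M (\<lambda>\<omega>. (V n (Suc n) \<omega>)\<^sup>2)" "expectation (\<lambda>\<omega>. (V n (Suc n) \<omega>)\<^sup>2) \<le> T"
        "expectation (V n (Suc n)) = 0" for n
        using V[of n "Suc n"] unfolding tN by blast+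
      from L2_bounded_limit[OF Vm lm Vlim this] show ?thesis unfolding sp by blast
    qed
  qed
qed

end

section \<open>Stopped processes, running suprema and hitting times\<close>

lemma Inf_ennreal_closed:
  assumes E: "closed E" "E \<subseteq> {0..}" "E \<noteq> {}"
  obtains e where "e \<in> E" "\<And>u. u \<in> E \<Longrightarrow> e \<le> u" "Inf (ennreal ` E) = ennreal e"
proof
  have bd: "bdd_below E" using E by (auto intro: bdd_belowI[of _ 0])
  show 1: "Inf E \<in> E" using closed_contains_Inf[OF E(3) bd E(1)] .
  show 2: "Inf E \<le> u" if "u \<in> E" for u using cInf_lower[OF that bd] .
  show "Inf (ennreal ` E) = ennreal (Inf E)"
    by (rule antisym) (use 1 2 in \<open>auto intro!: Inf_lower Inf_greatest ennreal_leI\<close>)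
qed

context brownian begin

lemma stopped_process_measurable:
  assumes "stopping_time \<F> \<tau>" "0 \<le> T" shows "stopped_process W \<tau> T \<in> borel_measurable M"
  using optional_stopping(1)[OF assms] by auto

text \<open>
  Optional stopping at the time that equals \<open>min t \<tau>\<close> on \<open>A\<close> and \<open>min r \<tau>\<close> elsewhere.
\<close>

lemma optional_stopping_conditional:
  assumes \<tau>: "stopping_time \<F> \<tau>" and rt: "0 \<le> r" "r \<le> t" and A: "A \<in> sets (\<F> (ennreal r))"
  shows "expectation (\<lambda>\<omega>. indicator A \<omega> * stopped_process W \<tau> t \<omega>)
       = expectation (\<lambda>\<omega>. indicator A \<omega> * stopped_process W \<tau> r \<omega>)"
proof -
  define \<rho> where "\<rho> \<omega> = (if \<omega> \<in> A then min (ennreal t) (\<tau> \<omega>) else min (ennreal r) (\<tau> \<omega>))" for \<omega>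
  have AM: "A \<in> sets M" "A \<subseteq> space M" using A sets_F_subset sets.sets_into_space by blast+
  have rt': "ennreal r \<le> ennreal t" using rt by (simp add: ennreal_leI)
  have st: "stopping_time \<F> \<rho>"
  proof (rule stopping_timeI)
    fix u
    show "Measurable.pred (\<F> u) (\<lambda>\<omega>. \<rho> \<omega> \<le> u)"
    proof (cases "ennreal r \<le> u")
      case True
      then have "A \<in> sets (\<F> u)" using A sets_F_mono by blast
      moreover have "{\<omega>\<in>space M. min (ennreal t) (\<tau> \<omega>) \<le> u} \<in> sets (\<F> u)"
        by (rule stopping_time_le) (intro stopping_time_min stopping_time_const \<tau>)
      ultimately have "(A \<inter> {\<omega>\<in>space M. min (ennreal t) (\<tau> \<omega>) \<le> u}) \<union> (space (\<F> u) - A) \<in> sets (\<F> u)" by blast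
      also have "(A \<inter> {\<omega>\<in>space M. min (ennreal t) (\<tau> \<omega>) \<le> u}) \<union> (space (\<F> u) - A) = {\<omega>\<in>space (\<F> u). \<rho> \<omega> \<le> u}"
        using AM True by (auto simp: \<rho>_def space_F min_le_iff_disj)
      finally show ?thesis by (simp add: pred_def)
    next
      case False
      then have "\<rho> \<omega> \<le> u \<longleftrightarrow> \<tau> \<omega> \<le> u" for \<omega>
        using rt' by (auto simp: \<rho>_def min_le_iff_disj)
      then show ?thesis using stopping_timeD[OF \<tau>] by simp
    qed
  qed
  have t: "0 \<le> t" using rt by simp
  have min: "min (ennreal t) (min (ennreal t) x) = min (ennreal t) x"
    "min (ennreal t) (min (ennreal r) x) = min (ennreal r) x" for x :: ennreal
    using rt' by (auto simp: min_def)
  have eq: "stopped_process W \<rho> t \<omega>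
     = indicator A \<omega> * stopped_process W \<tau> t \<omega> - indicator A \<omega> * stopped_process W \<tau> r \<omega> + stopped_process W \<tau> r \<omega>" for \<omega>
    unfolding stopped_process_def at_time_def \<rho>_def using min by (simp add: indicator_def)
  note i = optional_stopping[OF \<tau> t] optional_stopping[OF \<tau> rt(1)]
  have i1: "integrable M (\<lambda>\<omega>. indicator A \<omega> * stopped_process W \<tau> t \<omega>)"
    "integrable M (\<lambda>\<omega>. indicator A \<omega> * stopped_process W \<tau> r \<omega>)"
    using integrable_mult_indicator[OF AM(1) i(1)] integrable_mult_indicator[OF AM(1) i(3)] by simp_all
  have "expectation (stopped_process W \<rho> t) = 0" using optional_stopping[OF st t] by simp
  then have "expectation (\<lambda>\<omega>. indicator A \<omega> * stopped_process W \<tau> t \<omega> - indicator A \<omega> * stopped_process W \<tau> r \<omega> + stopped_process W \<tau> r \<omega>) = 0"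
    unfolding eq .
  then show ?thesis using i i1 by simp
qed

definition bounded_until :: "('a \<Rightarrow> ennreal) \<Rightarrow> real \<Rightarrow> bool" where
  "bounded_until \<tau> K \<longleftrightarrow> stopping_time \<F> \<tau> \<and> (AE \<omega> in M. \<tau> \<omega> < \<top>)
     \<and> (AE \<omega> in M. \<forall>t\<ge>0. \<bar>stopped_process W \<tau> t \<omega>\<bar> \<le> K)"

lemma stopped_process_eventually:
  assumes "\<tau> \<omega> < \<top>"
  shows "\<forall>\<^sub>F n in sequentially. stopped_process W \<tau> (real n) \<omega> = at_time W \<tau> \<omega>"
proof -
  obtain r where r: "\<tau> \<omega> = ennreal r" "0 \<le> r" using assms by (cases "\<tau> \<omega>") auto
  have "stopped_process W \<tau> (real n) \<omega> = at_time W \<tau> \<omega>" if "nat \<lceil>r\<rceil> \<le> n" for n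
  proof -
    have "r \<le> real n" using that by linarith
    then have "min (ennreal (real n)) (\<tau> \<omega>) = \<tau> \<omega>" using r by (simp add: min_def ennreal_leI)
    then show ?thesis by (simp add: stopped_process_def at_time_def)
  qed
  then show ?thesis unfolding eventually_sequentially by blast
qed

lemma stopped_process_LIMSEQ:
  assumes "AE \<omega> in M. \<tau> \<omega> < \<top>"
  shows "AE \<omega> in M. (\<lambda>n. stopped_process W \<tau> (real n) \<omega>) \<longlonglongrightarrow> at_time W \<tau> \<omega>"
  using assms by eventually_elim (rule tendsto_eventually, rule stopped_process_eventually, assumption)

lemma at_time_measurable:
  assumes "stopping_time \<F> \<tau>" "AE \<omega> in M. \<tau> \<omega> < \<top>" shows "at_time W \<tau> \<in> borel_measurable M"
  by (rule AE_limit_measurable[OF _ stopped_process_LIMSEQ[OF assms(2)]])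
     (use stopped_process_measurable[OF assms(1)] in auto)

lemma bounded_until_at_time:
  assumes "bounded_until \<tau> K"
  shows "at_time W \<tau> \<in> borel_measurable M" "AE \<omega> in M. \<bar>at_time W \<tau> \<omega>\<bar> \<le> K"
    "integrable M (at_time W \<tau>)" "expectation (at_time W \<tau>) = 0"
proof -
  have \<tau>: "stopping_time \<F> \<tau>" "AE \<omega> in M. \<tau> \<omega> < \<top>"
    and b: "AE \<omega> in M. \<forall>t\<ge>0. \<bar>stopped_process W \<tau> t \<omega>\<bar> \<le> K"
    using assms by (auto simp: bounded_until_def)
  show m: "at_time W \<tau> \<in> borel_measurable M" by (rule at_time_measurable[OF \<tau>])
  show bd: "AE \<omega> in M. \<bar>at_time W \<tau> \<omega>\<bar> \<le> K"
    using \<tau>(2) b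
  proof eventually_elim
    fix \<omega> assume *: "\<tau> \<omega> < \<top>" "\<forall>t\<ge>0. \<bar>stopped_process W \<tau> t \<omega>\<bar> \<le> K"
    obtain n where "stopped_process W \<tau> (real n) \<omega> = at_time W \<tau> \<omega>"
      using stopped_process_eventually[where \<tau>=\<tau> and \<omega>=\<omega>, OF *(1)] by (auto simp: eventually_sequentially)
    then show "\<bar>at_time W \<tau> \<omega>\<bar> \<le> K" using *(2) by (metis of_nat_0_le_iff)
  qed
  show "integrable M (at_time W \<tau>)" by (rule integrable_const_bound[of _ K]) (use bd m in auto)
  have "(\<lambda>n. expectation (stopped_process W \<tau> (real n))) \<longlonglongrightarrow> expectation (at_time W \<tau>)"
  proof (rule integral_dominated_convergence[where w="\<lambda>_. K"])
    show "AE \<omega> in M. norm (stopped_process W \<tau> (real n) \<omega>) \<le> K" for n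
      using b by eventually_elim simp
  qed (use stopped_process_LIMSEQ[OF \<tau>(2)] stopped_process_measurable[OF \<tau>(1)] m in auto)
  then show "expectation (at_time W \<tau>) = 0"
    using optional_stopping(2)[OF \<tau>(1)] by (simp add: LIMSEQ_const_iff)
qed

lemma path_continuous_on: "continuous_path \<omega> \<Longrightarrow> A \<subseteq> {0..} \<Longrightarrow> continuous_on A (\<lambda>t. W t \<omega>)"
  using continuous_on_subset unfolding continuous_path_def by blast

lemma sup_attained:
  assumes "continuous_path \<omega>" "0 \<le> t"
  obtains u where "0 \<le> u" "u \<le> t" "W u \<omega> = running_sup W t \<omega>" "\<And>v. 0 \<le> v \<Longrightarrow> v \<le> t \<Longrightarrow> W v \<omega> \<le> W u \<omega>"
proof -
  obtain u where u: "u \<in> {0..t}" "\<And>v. v \<in> {0..t} \<Longrightarrow> W v \<omega> \<le> W u \<omega>"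
    using continuous_attains_sup[of "{0..t}" "\<lambda>t. W t \<omega>"] path_continuous_on[OF assms(1), of "{0..t}"] assms by auto
  have "running_sup W t \<omega> = W u \<omega>" unfolding running_sup_def
    by (rule cSup_eq_maximum) (use u in auto)
  then show thesis using that[of u] u by auto
qed

lemma sup_upper: "continuous_path \<omega> \<Longrightarrow> 0 \<le> u \<Longrightarrow> u \<le> t \<Longrightarrow> W u \<omega> \<le> running_sup W t \<omega>"
  using sup_attained[of \<omega> t] by (metis order_trans)

lemma sup_ge_iff: "continuous_path \<omega> \<Longrightarrow> 0 \<le> t \<Longrightarrow> s \<le> running_sup W t \<omega> \<longleftrightarrow> (\<exists>u\<in>{0..t}. s \<le> W u \<omega>)"
  using sup_attained[of \<omega> t] sup_upper[of \<omega> _ t] by (metis atLeastAtMost_iff order_trans)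

lemma sup_mono: "continuous_path \<omega> \<Longrightarrow> 0 \<le> u \<Longrightarrow> u \<le> t \<Longrightarrow> running_sup W u \<omega> \<le> running_sup W t \<omega>"
  using sup_attained[of \<omega> u] sup_upper[of \<omega> _ t] by (metis order_trans)

lemma sup_nonneg: "continuous_path \<omega> \<Longrightarrow> 0 \<le> t \<Longrightarrow> 0 \<le> running_sup W t \<omega>"
  using sup_upper[of \<omega> 0 t] by (simp add: continuous_path_def)

lemma sup_zero: "continuous_path \<omega> \<Longrightarrow> running_sup W 0 \<omega> = 0"
  by (simp add: running_sup_def continuous_path_def)

lemma path_rational_above:
  assumes g: "continuous_path \<omega>" and u: "0 \<le> u" "u < t" and x: "x < W u \<omega>"
  shows "\<exists>q\<in>\<rat>. u < q \<and> q < t \<and> x < W q \<omega>"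
proof -
  obtain v where v: "\<And>n. v n < t" "\<And>n. u < v n" "v \<longlonglongrightarrow> u"
    using right_approach[OF u(2)] by metis
  have "\<forall>n. \<exists>q\<in>\<rat>. u < q \<and> q < v n" using Rats_dense_in_real[OF v(2)] by blast
  then obtain q where q: "\<And>n. q n \<in> \<rat>" "\<And>n. u < q n" "\<And>n. q n < v n" by metis
  have "q \<longlonglongrightarrow> u"
    by (rule tendsto_sandwich[OF _ _ tendsto_const v(3)]) (use q in \<open>auto intro!: always_eventually less_imp_le\<close>)
  then have "(\<lambda>n. W (q n) \<omega>) \<longlonglongrightarrow> W u \<omega>"
    by (rule path_LIMSEQ[OF g u(1)]) (use q(2) u in \<open>meson less_imp_le order_trans\<close>)
  from order_tendstoD(1)[OF this x] obtain n where "x < W (q n) \<omega>" by (auto simp: eventually_sequentially)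
  then show ?thesis using q[of n] v(1)[of n] by (meson less_trans)
qed

text \<open>
  On a continuous path the supremum may be taken over the rational times and \<open>t\<close> itself.
\<close>

lemma sup_measurable_F:
  assumes t: "0 \<le> t" shows "running_sup W t \<in> borel_measurable (\<F> (ennreal t))"
proof -
  define D where "D = insert t (\<rat> \<inter> {0..t})"
  have cD: "countable D" by (simp add: D_def countable_rat)
  have "{\<omega>\<in>space M. x < running_sup W t \<omega>} \<in> sets (\<F> (ennreal t))" for x
  proof (rule F_AE)
    have "{\<omega>\<in>space M. x < W q \<omega>} \<in> sets (\<F> (ennreal t))" if "q \<in> D" for q
    proof -
      have q: "0 \<le> q" "q \<le> t" using that t by (auto simp: D_def)
      have "W q \<in> borel_measurable (\<F> (ennreal t))"
        using measurable_F_mono[OF W_measurable_F[OF q(1)]] q by (simp add: ennreal_leI)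
      then have "{\<omega>\<in>space (\<F> (ennreal t)). x < W q \<omega>} \<in> sets (\<F> (ennreal t))" by measurable
      then show ?thesis by (simp add: space_F)
    qed
    then show "(\<Union>q\<in>D. {\<omega>\<in>space M. x < W q \<omega>}) \<in> sets (\<F> (ennreal t))"
      using cD by (intro sets.countable_UN') auto
    show "AE \<omega> in M. (\<omega> \<in> (\<Union>q\<in>D. {\<omega>\<in>space M. x < W q \<omega>})) = (\<omega> \<in> {\<omega>\<in>space M. x < running_sup W t \<omega>})"
      using AE_continuous_path AE_space
    proof eventually_elim
      fix \<omega> assume g: "continuous_path \<omega>" and sp: "\<omega> \<in> space M"
      have "(\<exists>q\<in>D. x < W q \<omega>) \<longleftrightarrow> x < running_sup W t \<omega>"
      proof
        assume "\<exists>q\<in>D. x < W q \<omega>"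
        then show "x < running_sup W t \<omega>" using sup_upper[OF g, of _ t] t by (auto simp: D_def intro: less_le_trans)
      next
        assume "x < running_sup W t \<omega>"
        then obtain u where u: "0 \<le> u" "u \<le> t" "x < W u \<omega>" using sup_attained[OF g t] by metis
        show "\<exists>q\<in>D. x < W q \<omega>"
        proof (cases "u = t")
          case True then show ?thesis using u by (auto simp: D_def)
        next
          case False
          then obtain q where "q \<in> \<rat>" "u < q" "q < t" "x < W q \<omega>"
            using path_rational_above[OF g u(1) _ u(3), of t] u by auto
          then show ?thesis using u by (auto simp: D_def intro!: bexI[of _ q])
        qed
      qed
      then show "(\<omega> \<in> (\<Union>q\<in>D. {\<omega>\<in>space M. x < W q \<omega>})) = (\<omega> \<in> {\<omega>\<in>space M. x < running_sup W t \<omega>})"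
        using sp by auto
    qed
  qed auto
  then show ?thesis by (intro borel_measurable_iff_greater[THEN iffD2]) (simp add: space_F)
qed

text \<open>
  With a right-continuous filtration it is enough to decide whether the time is strictly below \<open>t\<close>, which
  does not require the infimum to be attained.
\<close>

lemma hitting_stopping_time:
  assumes E: "\<And>\<omega>. E \<omega> \<subseteq> {0..}"
    and m: "\<And>t. 0 < t \<Longrightarrow> {\<omega>\<in>space M. \<exists>u\<in>E \<omega>. u < t} \<in> sets (\<F> (ennreal t))"
  shows "stopping_time \<F> (\<lambda>\<omega>. Inf (ennreal ` E \<omega>))"
proof (rule stopping_timeI)
  fix t :: ennreal
  define \<tau> where "\<tau> \<omega> = Inf (ennreal ` E \<omega>)" for \<omega>
  have lt: "\<tau> \<omega> < ennreal r \<longleftrightarrow> (\<exists>u\<in>E \<omega>. u < r)" if "0 < r" for r \<omega>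
  proof -
    have "\<tau> \<omega> < ennreal r \<longleftrightarrow> (\<exists>u\<in>E \<omega>. ennreal u < ennreal r)" by (auto simp: \<tau>_def Inf_less_iff)
    also have "\<dots> \<longleftrightarrow> (\<exists>u\<in>E \<omega>. u < r)" using E[of \<omega>] that by (force simp: ennreal_less_iff)
    finally show ?thesis .
  qed
  show "Measurable.pred (\<F> t) (\<lambda>\<omega>. Inf (ennreal ` E \<omega>) \<le> t)"
  proof (cases t)
    case top then show ?thesis by simp
  next
    case (real r)
    have "{\<omega>\<in>space M. \<tau> \<omega> \<le> t} \<in> sets (\<F> s)" if s: "t < s" for s
    proof -
      obtain N :: nat where N: "ennreal (r + 1 / real (Suc N)) \<le> s"
      proof (cases s)
        case top then show ?thesis using that by auto
      next
        case (real s')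
        then have "r < s'" using s \<open>t = ennreal r\<close> \<open>0 \<le> r\<close> by (simp add: ennreal_less_iff)
        then obtain N where "inverse (real (Suc N)) < s' - r" using reals_Archimedean[of "s' - r"] by auto
        then show ?thesis using that[of N] real by (auto simp: inverse_eq_divide intro!: ennreal_leI)
      qed
      have "{\<omega>\<in>space M. \<tau> \<omega> \<le> t} = (\<Inter>n\<in>{N..}. {\<omega>\<in>space M. \<exists>u\<in>E \<omega>. u < r + 1 / real (Suc n)})"
      proof (intro set_eqI iffI)
        fix \<omega> assume w: "\<omega> \<in> {\<omega>\<in>space M. \<tau> \<omega> \<le> t}"
        have "\<exists>u\<in>E \<omega>. u < r + 1 / real (Suc n)" for n
        proof -
          have "\<tau> \<omega> \<le> ennreal r" using w real by simp
          also have "\<dots> < ennreal (r + 1 / real (Suc n))" using real by (simp add: ennreal_less_iff del: ennreal_plus)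
          finally have "\<tau> \<omega> < ennreal (r + 1 / real (Suc n))" .
          moreover have "0 < r + 1 / real (Suc n)" using real by (simp add: add_nonneg_pos)
          ultimately show ?thesis using lt by blast
        qed
        then show "\<omega> \<in> (\<Inter>n\<in>{N..}. {\<omega>\<in>space M. \<exists>u\<in>E \<omega>. u < r + 1 / real (Suc n)})"
          using w by blast
      next
        fix \<omega> assume w: "\<omega> \<in> (\<Inter>n\<in>{N..}. {\<omega>\<in>space M. \<exists>u\<in>E \<omega>. u < r + 1 / real (Suc n)})"
        then have sp: "\<omega> \<in> space M" by auto
        have "\<tau> \<omega> \<le> ennreal r"
        proof (rule LIMSEQ_le_const)
          have "(\<lambda>n. r + 1 / real (Suc n)) \<longlonglongrightarrow> r + 0"
            by (intro tendsto_add tendsto_const LIMSEQ_Suc[OF lim_const_over_n])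
          then show "(\<lambda>n. ennreal (r + 1 / real (Suc n))) \<longlonglongrightarrow> ennreal r" by (auto intro!: tendsto_intros)
          show "\<exists>M. \<forall>n\<ge>M. \<tau> \<omega> \<le> ennreal (r + 1 / real (Suc n))"
          proof (intro exI[of _ N] allI impI less_imp_le)
            fix n assume "N \<le> n"
            then have "\<exists>u\<in>E \<omega>. u < r + 1 / real (Suc n)" using w by auto
            then show "\<tau> \<omega> < ennreal (r + 1 / real (Suc n))" using real by (subst lt) (auto simp: add_nonneg_pos)
          qed
        qed
        then show "\<omega> \<in> {\<omega>\<in>space M. \<tau> \<omega> \<le> t}" using sp real by simp
      qed
      also have "\<dots> \<in> sets (\<F> s)"
      proof (rule sets.countable_INT')
        show "(\<lambda>n. {\<omega>\<in>space M. \<exists>u\<in>E \<omega>. u < r + 1 / real (Suc n)}) ` {N..} \<subseteq> sets (\<F> s)"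
        proof (rule image_subsetI)
          fix n assume "n \<in> {N..}"
          then have "r + 1 / real (Suc n) \<le> r + 1 / real (Suc N)" by (simp add: frac_le)
          then have "ennreal (r + 1 / real (Suc n)) \<le> s" using N by (meson ennreal_leI order_trans)
          moreover have "0 < r + 1 / real (Suc n)" using real by (simp add: add_nonneg_pos)
          ultimately show "{\<omega>\<in>space M. \<exists>u\<in>E \<omega>. u < r + 1 / real (Suc n)} \<in> sets (\<F> s)"
            using m sets_F_mono by blast
        qed
      qed auto
      finally show ?thesis .
    qed
    then have "{\<omega>\<in>space M. \<tau> \<omega> \<le> t} \<in> (\<Inter>s\<in>{t<..}. sets (\<F> s))" by auto
    then have "{\<omega>\<in>space M. \<tau> \<omega> \<le> t} \<in> sets (\<F> t)" using right_continuous_F[of t] real by simp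
    then show ?thesis by (simp add: pred_def space_F \<tau>_def)
  qed
qed

end

section \<open>Doob identity and escape from intervals\<close>

lemma rational_left_approach:
  fixes s :: real assumes "0 < s"
  obtains q :: "nat \<Rightarrow> real" where "\<And>n. q n \<in> \<rat>" "\<And>n. 0 < q n" "\<And>n. q n < s" "q \<longlonglongrightarrow> s"
proof -
  obtain v where v: "\<And>n. 0 < v n" "\<And>n. v n < s" "v \<longlonglongrightarrow> s" using left_approach[OF assms] by metis
  have "\<forall>n. \<exists>q\<in>\<rat>. v n < q \<and> q < s" using Rats_dense_in_real[OF v(2)] by blast
  then obtain q where q: "\<And>n. q n \<in> \<rat>" "\<And>n. v n < q n" "\<And>n. q n < s" by metis
  have "q \<longlonglongrightarrow> s"
    by (rule tendsto_sandwich[OF _ _ v(3) tendsto_const]) (use q in \<open>auto intro!: always_eventually less_imp_le\<close>)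
  moreover have "0 < q n" for n using v(1)[of n] q(2)[of n] by (rule less_trans)
  ultimately show thesis using that q by blast
qed

context brownian begin

text \<open>
  The reflection that turns every statement on the running supremum into one on the running infimum.
\<close>

lemma neg_brownian: "brownian M \<F> (\<lambda>t \<omega>. - W t \<omega>)"
proof
  have V: "sets (vimage_algebra (space M) (\<lambda>\<omega>. - W t \<omega> - - W s \<omega>) borel)
      \<subseteq> sets (vimage_algebra (space M) (\<lambda>\<omega>. W t \<omega> - W s \<omega>) borel)" for s t
  proof
    fix A assume "A \<in> sets (vimage_algebra (space M) (\<lambda>\<omega>. - W t \<omega> - - W s \<omega>) (borel :: real measure))"
    then obtain B :: "real set" where B: "B \<in> sets borel" "A = (\<lambda>\<omega>. - W t \<omega> - - W s \<omega>) -` B \<inter> space M"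
      by (auto simp: sets_vimage_algebra2)
    have "uminus -` B \<in> sets (borel :: real measure)"
      using measurable_sets[of "uminus :: real \<Rightarrow> real" borel borel B] B by simp
    moreover have "A = (\<lambda>\<omega>. W t \<omega> - W s \<omega>) -` (uminus -` B) \<inter> space M"
      using B by (auto simp: vimage_def)
    ultimately show "A \<in> sets (vimage_algebra (space M) (\<lambda>\<omega>. W t \<omega> - W s \<omega>) borel)"
      by (auto simp: sets_vimage_algebra2)
  qed
  show "brownian_motion M \<F> (\<lambda>t \<omega>. - W t \<omega>)"
    unfolding brownian_motion_def
  proof (intro conjI allI impI)
    show "(\<lambda>\<omega>. - W t \<omega>) \<in> borel_measurable (\<F> (ennreal t))" if "0 \<le> t" for t
      using W_measurable_F[OF that] by simp
    show "AE \<omega> in M. - W 0 \<omega> = 0" using AE_continuous_path by eventually_elim (simp add: continuous_path_def)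
    show "AE \<omega> in M. continuous_on {0..} (\<lambda>t. - W t \<omega>)"
      using AE_continuous_path by eventually_elim (auto simp: continuous_path_def intro!: continuous_on_minus)
  next
    fix s t :: real assume st: "0 \<le> s" "s < t"
    note d = increment_normal[OF st]
    have "distributed M lborel (\<lambda>\<omega>. 0 + -1 * (W t \<omega> - W s \<omega>)) (normal_density (0 + -1 * 0) (\<bar>-1\<bar> * sqrt (t - s)))"
      by (rule normal_density_affine[OF d]) (use st in auto)
    then show "distributed M lborel (\<lambda>\<omega>. - W t \<omega> - - W s \<omega>) (\<lambda>x. ennreal (normal_density 0 (sqrt (t - s)) x))"
      by simp
    show "indep_set (sets (\<F> (ennreal s))) (sets (vimage_algebra (space M) (\<lambda>\<omega>. - W t \<omega> - - W s \<omega>) borel))"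
    proof -
      have "indep_set (sets (\<F> (ennreal s))) (sets (vimage_algebra (space M) (\<lambda>\<omega>. W t \<omega> - W s \<omega>) borel))"
        using bm st unfolding brownian_motion_def by blast
      then show ?thesis unfolding indep_sets2_eq using V[of t s] by blast
    qed
  qed
qed

definition hit :: "real \<Rightarrow> 'a \<Rightarrow> ennreal" where
  "hit s \<omega> = Inf (ennreal ` {u. 0 \<le> u \<and> s \<le> W u \<omega>})"

text \<open>
  Reaching level \<open>s\<close> before \<open>t\<close> can be read off the running supremum at rational times.
\<close>

lemma hit_stopping_time: "stopping_time \<F> (hit s)"
proof -
  have "stopping_time \<F> (\<lambda>\<omega>. Inf (ennreal ` {u. 0 \<le> u \<and> s \<le> W u \<omega>}))"
  proof (rule hitting_stopping_time)
    fix t :: real assume t: "0 < t"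
    show "{\<omega> \<in> space M. \<exists>u\<in>{u. 0 \<le> u \<and> s \<le> W u \<omega>}. u < t} \<in> sets (\<F> (ennreal t))"
    proof (rule F_AE)
      have "{\<omega>\<in>space M. s \<le> running_sup W q \<omega>} \<in> sets (\<F> (ennreal t))" if "0 \<le> q" "q < t" for q
      proof -
        have "running_sup W q \<in> borel_measurable (\<F> (ennreal t))"
          using measurable_F_mono[OF sup_measurable_F[OF that(1)]] that by (simp add: ennreal_leI)
        then have "{\<omega>\<in>space (\<F> (ennreal t)). s \<le> running_sup W q \<omega>} \<in> sets (\<F> (ennreal t))" by measurable
        then show ?thesis by (simp add: space_F)
      qed
      then show "(\<Union>q\<in>\<rat> \<inter> {0..<t}. {\<omega>\<in>space M. s \<le> running_sup W q \<omega>}) \<in> sets (\<F> (ennreal t))"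
        using countable_rat by (intro sets.countable_UN') auto
      show "AE \<omega> in M. (\<omega> \<in> (\<Union>q\<in>\<rat> \<inter> {0..<t}. {\<omega>\<in>space M. s \<le> running_sup W q \<omega>}))
         = (\<omega> \<in> {\<omega> \<in> space M. \<exists>u\<in>{u. 0 \<le> u \<and> s \<le> W u \<omega>}. u < t})"
        using AE_continuous_path AE_space
      proof eventually_elim
        fix \<omega> assume g: "continuous_path \<omega>" and sp: "\<omega> \<in> space M"
        have "(\<exists>q\<in>\<rat> \<inter> {0..<t}. s \<le> running_sup W q \<omega>) \<longleftrightarrow> (\<exists>u. 0 \<le> u \<and> s \<le> W u \<omega> \<and> u < t)"
        proof
          assume "\<exists>q\<in>\<rat> \<inter> {0..<t}. s \<le> running_sup W q \<omega>"
          then obtain q where q: "0 \<le> q" "q < t" "s \<le> running_sup W q \<omega>" by auto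
          then obtain u where "u \<in> {0..q}" "s \<le> W u \<omega>" using sup_ge_iff[OF g q(1)] by blast
          then show "\<exists>u. 0 \<le> u \<and> s \<le> W u \<omega> \<and> u < t" using q by (intro exI[of _ u]) auto
        next
          assume "\<exists>u. 0 \<le> u \<and> s \<le> W u \<omega> \<and> u < t"
          then obtain u where u: "0 \<le> u" "s \<le> W u \<omega>" "u < t" by auto
          obtain q where q: "q \<in> \<rat>" "u < q" "q < t" using Rats_dense_in_real[OF u(3)] by blast
          then have "s \<le> running_sup W q \<omega>" using sup_ge_iff[OF g, of q s] u by (auto intro!: bexI[of _ u])
          then show "\<exists>q\<in>\<rat> \<inter> {0..<t}. s \<le> running_sup W q \<omega>" using q u by (intro bexI[of _ q]) auto
        qed
        then show "(\<omega> \<in> (\<Union>q\<in>\<rat> \<inter> {0..<t}. {\<omega>\<in>space M. s \<le> running_sup W q \<omega>}))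
         = (\<omega> \<in> {\<omega> \<in> space M. \<exists>u\<in>{u. 0 \<le> u \<and> s \<le> W u \<omega>}. u < t})" using sp by auto
      qed
    qed auto
  qed auto
  then show ?thesis by (simp add: hit_def[abs_def])
qed

lemma hit_attained:
  assumes g: "continuous_path \<omega>" and h: "hit s \<omega> < \<top>"
  obtains e where "0 \<le> e" "hit s \<omega> = ennreal e" "s \<le> W e \<omega>" "\<And>u. 0 \<le> u \<Longrightarrow> u < e \<Longrightarrow> W u \<omega> < s"
proof -
  let ?E = "{u. 0 \<le> u \<and> s \<le> W u \<omega>}"
  have "closed {u\<in>{0..}. s \<le> W u \<omega>}"
    by (rule continuous_on_closed_Collect_le) (use path_continuous_on[OF g] in auto)
  moreover have "{u\<in>{0..}. s \<le> W u \<omega>} = ?E" by auto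
  ultimately have c: "closed ?E" by simp
  have ne: "?E \<noteq> {}"
  proof
    assume "?E = {}" then have "hit s \<omega> = \<top>" unfolding hit_def by (simp only: image_empty Inf_empty)
    then show False using h by simp
  qed
  obtain e where e: "e \<in> ?E" "\<And>u. u \<in> ?E \<Longrightarrow> e \<le> u" "Inf (ennreal ` ?E) = ennreal e"
    using Inf_ennreal_closed[OF c _ ne] by auto
  have "W u \<omega> < s" if "0 \<le> u" "u < e" for u using e(2)[of u] that by (auto simp: not_less[symmetric])
  then show thesis using that[of e] e by (auto simp: hit_def)
qed

lemma hit_value:
  assumes g: "continuous_path \<omega>" and e: "0 \<le> e" "s \<le> W e \<omega>" "\<And>u. 0 \<le> u \<Longrightarrow> u < e \<Longrightarrow> W u \<omega> < s" and s: "0 \<le> s"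
  shows "W e \<omega> = s"
proof (cases "e = 0")
  case True then show ?thesis using g e s by (simp add: continuous_path_def)
next
  case False
  then obtain q where q: "\<And>n. 0 < q n" "\<And>n. q n < e" "q \<longlonglongrightarrow> e"
    using rational_left_approach[of e] e by (metis less_le)
  have "(\<lambda>n. W (q n) \<omega>) \<longlonglongrightarrow> W e \<omega>"
    by (rule path_LIMSEQ[OF g e(1) q(3)]) (use q in \<open>auto intro: less_imp_le\<close>)
  then have "W e \<omega> \<le> s" by (rule LIMSEQ_le_const2) (use e(3) q less_imp_le in blast)
  then show ?thesis using e by simp
qed

lemma hit_le_iff:
  assumes g: "continuous_path \<omega>" and t: "0 \<le> t" shows "hit s \<omega> \<le> ennreal t \<longleftrightarrow> s \<le> running_sup W t \<omega>"
proof
  assume le: "hit s \<omega> \<le> ennreal t"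
  then have "hit s \<omega> < \<top>" by (simp add: le_less_trans)
  then obtain e where "0 \<le> e" "hit s \<omega> = ennreal e" "s \<le> W e \<omega>" using hit_attained[OF g] by metis
  then show "s \<le> running_sup W t \<omega>" using le t sup_ge_iff[OF g t] by (auto intro!: bexI[of _ e])
next
  assume "s \<le> running_sup W t \<omega>"
  then obtain u where "u \<in> {0..t}" "s \<le> W u \<omega>" using sup_ge_iff[OF g t] by blast
  then have "hit s \<omega> \<le> ennreal u" "ennreal u \<le> ennreal t"
    unfolding hit_def by (auto intro!: Inf_lower ennreal_leI)
  then show "hit s \<omega> \<le> ennreal t" by (rule order_trans)
qed

lemma below_hit:
  assumes g: "continuous_path \<omega>" and v: "0 \<le> v" "ennreal v \<le> hit a \<omega>" and a: "0 \<le> a" shows "W v \<omega> \<le> a"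
proof (rule ccontr)
  assume n: "\<not> W v \<omega> \<le> a"
  then have "hit a \<omega> \<le> ennreal v" unfolding hit_def using v by (intro Inf_lower) auto
  then have eq: "hit a \<omega> = ennreal v" using v by simp
  then obtain e where e: "0 \<le> e" "hit a \<omega> = ennreal e" "a \<le> W e \<omega>" "\<And>u. 0 \<le> u \<Longrightarrow> u < e \<Longrightarrow> W u \<omega> < a"
    using hit_attained[OF g, of a] by auto
  then have "W e \<omega> = a" using hit_value[OF g e(1,3,4) a] by simp
  moreover have "e = v" using e eq v by (simp add: ennreal_inj)
  ultimately show False using n by simp
qed

lemma bounded_until_min:
  assumes b: "bounded_until \<tau> K" and \<sigma>: "stopping_time \<F> \<sigma>"
  shows "bounded_until (\<lambda>\<omega>. min (\<tau> \<omega>) (\<sigma> \<omega>)) K"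
proof -
  have eq: "\<exists>u\<ge>0. stopped_process W (\<lambda>\<omega>. min (\<tau> \<omega>) (\<sigma> \<omega>)) t \<omega> = stopped_process W \<tau> u \<omega>" for t \<omega>
  proof (intro exI[of _ "enn2real (min (ennreal t) (\<sigma> \<omega>))"] conjI)
    have "min (ennreal t) (\<sigma> \<omega>) < \<top>" by (simp add: min_less_iff_disj)
    then show "stopped_process W (\<lambda>\<omega>. min (\<tau> \<omega>) (\<sigma> \<omega>)) t \<omega> = stopped_process W \<tau> (enn2real (min (ennreal t) (\<sigma> \<omega>))) \<omega>"
      by (simp add: stopped_process_def at_time_def ac_simps)
  qed simp
  have "AE \<omega> in M. min (\<tau> \<omega>) (\<sigma> \<omega>) < \<top>"
    using b unfolding bounded_until_def by (auto elim!: eventually_mono simp: min_less_iff_disj)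
  moreover have "AE \<omega> in M. \<forall>t\<ge>0. \<bar>stopped_process W (\<lambda>\<omega>. min (\<tau> \<omega>) (\<sigma> \<omega>)) t \<omega>\<bar> \<le> K"
  proof -
    have "AE \<omega> in M. \<forall>t\<ge>0. \<bar>stopped_process W \<tau> t \<omega>\<bar> \<le> K" using b unfolding bounded_until_def by blast
    then show ?thesis
    proof eventually_elim
      fix \<omega> assume *: "\<forall>t\<ge>0. \<bar>stopped_process W \<tau> t \<omega>\<bar> \<le> K"
      show "\<forall>t\<ge>0. \<bar>stopped_process W (\<lambda>\<omega>. min (\<tau> \<omega>) (\<sigma> \<omega>)) t \<omega>\<bar> \<le> K"
      proof (intro allI impI)
        fix t :: real
        obtain u where "0 \<le> u" "stopped_process W (\<lambda>\<omega>. min (\<tau> \<omega>) (\<sigma> \<omega>)) t \<omega> = stopped_process W \<tau> u \<omega>"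
          using eq[of t \<omega>] by blast
        then show "\<bar>stopped_process W (\<lambda>\<omega>. min (\<tau> \<omega>) (\<sigma> \<omega>)) t \<omega>\<bar> \<le> K" using * by simp
      qed
    qed
  qed
  ultimately show ?thesis
    using b \<sigma> stopping_time_min[of \<F> \<tau> \<sigma>] unfolding bounded_until_def by blast
qed

text \<open>
  The event that the running supremum at \<open>\<tau>\<close> is at least \<open>s\<close> is the event that \<open>s\<close> is hit before \<open>\<tau>\<close>.
\<close>

lemma sup_at_time_measurable:
  assumes "stopping_time \<F> \<tau>" "AE \<omega> in M. \<tau> \<omega> < \<top>"
  shows "at_time (running_sup W) \<tau> \<in> borel_measurable M"
proof -
  have "{\<omega>\<in>space M. s \<le> at_time (running_sup W) \<tau> \<omega>} \<in> sets M" for s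
  proof (rule in_sets_AE)
    have [measurable]: "hit s \<in> borel_measurable M" "\<tau> \<in> borel_measurable M"
      using stopping_time_measurable hit_stopping_time assms by auto
    show "{\<omega>\<in>space M. hit s \<omega> \<le> \<tau> \<omega>} \<in> sets M" by measurable
    show "AE \<omega> in M. (\<omega> \<in> {\<omega>\<in>space M. hit s \<omega> \<le> \<tau> \<omega>}) = (\<omega> \<in> {\<omega>\<in>space M. s \<le> at_time (running_sup W) \<tau> \<omega>})"
      using AE_continuous_path assms(2)
    proof eventually_elim
      fix \<omega> assume g: "continuous_path \<omega>" and f: "\<tau> \<omega> < \<top>"
      have "ennreal (enn2real (\<tau> \<omega>)) = \<tau> \<omega>" using f by simp
      then show "(\<omega> \<in> {\<omega>\<in>space M. hit s \<omega> \<le> \<tau> \<omega>}) = (\<omega> \<in> {\<omega>\<in>space M. s \<le> at_time (running_sup W) \<tau> \<omega>})"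
        using hit_le_iff[OF g, of "enn2real (\<tau> \<omega>)" s] by (simp add: at_time_def)
    qed
  qed auto
  then show ?thesis by (simp add: borel_measurable_iff_ge)
qed

text \<open>
  The difference of \<open>W\<close> at \<open>\<tau>\<close> and at \<open>min \<tau> (hit s)\<close>, both of mean \<open>0\<close>: the latter equals \<open>s\<close> if level \<open>s\<close>
  is reached and \<open>W\<close> at \<open>\<tau>\<close> otherwise.
\<close>

lemma doob_identity:
  assumes b: "bounded_until \<tau> K" and s: "0 < s"
  shows "expectation (\<lambda>\<omega>. (at_time W \<tau> \<omega> - s) * indicator {\<omega>\<in>space M. s \<le> at_time (running_sup W) \<tau> \<omega>} \<omega>) = 0"
proof -
  define \<sigma> where "\<sigma> \<omega> = min (\<tau> \<omega>) (hit s \<omega>)" for \<omega>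
  have b2: "bounded_until \<sigma> K" unfolding \<sigma>_def[abs_def] by (rule bounded_until_min[OF b hit_stopping_time])
  have \<tau>: "stopping_time \<F> \<tau>" "AE \<omega> in M. \<tau> \<omega> < \<top>" using b by (auto simp: bounded_until_def)
  note S[measurable] = sup_at_time_measurable[OF \<tau>]
  note B = bounded_until_at_time[OF b] and B2 = bounded_until_at_time[OF b2]
  note [measurable] = B(1) B2(1)
  have "expectation (\<lambda>\<omega>. (at_time W \<tau> \<omega> - s) * indicator {\<omega>\<in>space M. s \<le> at_time (running_sup W) \<tau> \<omega>} \<omega>)
      = expectation (\<lambda>\<omega>. at_time W \<tau> \<omega> - at_time W \<sigma> \<omega>)"
  proof (rule integral_cong_AE)
    show "AE \<omega> in M. (at_time W \<tau> \<omega> - s) * indicator {\<omega>\<in>space M. s \<le> at_time (running_sup W) \<tau> \<omega>} \<omega>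
       = at_time W \<tau> \<omega> - at_time W \<sigma> \<omega>"
      using AE_continuous_path \<tau>(2) AE_space
    proof eventually_elim
      fix \<omega> assume g: "continuous_path \<omega>" and f: "\<tau> \<omega> < \<top>" and sp: "\<omega> \<in> space M"
      have e\<tau>: "ennreal (enn2real (\<tau> \<omega>)) = \<tau> \<omega>" using f by simp
      have iff: "s \<le> at_time (running_sup W) \<tau> \<omega> \<longleftrightarrow> hit s \<omega> \<le> \<tau> \<omega>"
        using hit_le_iff[OF g, of "enn2real (\<tau> \<omega>)" s] e\<tau> by (simp add: at_time_def)
      show "(at_time W \<tau> \<omega> - s) * indicator {\<omega>\<in>space M. s \<le> at_time (running_sup W) \<tau> \<omega>} \<omega>
         = at_time W \<tau> \<omega> - at_time W \<sigma> \<omega>"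
      proof (cases "hit s \<omega> \<le> \<tau> \<omega>")
        case True
        then obtain e where e: "0 \<le> e" "hit s \<omega> = ennreal e" "s \<le> W e \<omega>" "\<And>u. 0 \<le> u \<Longrightarrow> u < e \<Longrightarrow> W u \<omega> < s"
          using hit_attained[OF g, of s] f by (metis le_less_trans)
        have "\<sigma> \<omega> = ennreal e" using True e by (simp add: \<sigma>_def min_absorb2)
        moreover have "W e \<omega> = s" using hit_value[OF g e(1,3,4)] s by simp
        ultimately have "at_time W \<sigma> \<omega> = s" using e by (simp add: at_time_def)
        then show ?thesis using True iff sp by simp
      next
        case False
        then have "\<sigma> \<omega> = \<tau> \<omega>" by (simp add: \<sigma>_def)
        then show ?thesis using False iff by (simp add: at_time_def)
      qed
    qed
  qed measurable
  also have "\<dots> = 0" using B B2 by simp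
  finally show ?thesis .
qed

lemma sup_at_time_zero:
  assumes "AE \<omega> in M. \<tau> \<omega> < \<top>"
  shows "AE \<omega> in M. 0 \<le> at_time (running_sup W) \<tau> \<omega> \<and> at_time W \<tau> \<omega> \<le> at_time (running_sup W) \<tau> \<omega>"
  using AE_continuous_path
proof eventually_elim
  fix \<omega> assume g: "continuous_path \<omega>"
  show "0 \<le> at_time (running_sup W) \<tau> \<omega> \<and> at_time W \<tau> \<omega> \<le> at_time (running_sup W) \<tau> \<omega>"
    unfolding at_time_def using sup_nonneg[OF g enn2real_nonneg] sup_upper[OF g enn2real_nonneg order_refl] by blast
qed

lemma increment_small:
  assumes t: "0 < t" and K: "0 \<le> K"
  shows "emeasure M {\<omega>\<in>space M. \<bar>W t \<omega> - W 0 \<omega>\<bar> \<le> K} \<le> ennreal (2 * K / sqrt (2 * pi * t))"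
proof -
  have d: "distributed M lborel (\<lambda>\<omega>. W t \<omega> - W 0 \<omega>) (\<lambda>x. ennreal (normal_density 0 (sqrt t) x))"
    using increment_normal[of 0 t] t by simp
  have "{\<omega>\<in>space M. \<bar>W t \<omega> - W 0 \<omega>\<bar> \<le> K} = (\<lambda>\<omega>. W t \<omega> - W 0 \<omega>) -` {-K..K} \<inter> space M" by auto
  then have "emeasure M {\<omega>\<in>space M. \<bar>W t \<omega> - W 0 \<omega>\<bar> \<le> K}
      = (\<integral>\<^sup>+x. ennreal (normal_density 0 (sqrt t) x) * indicator {-K..K} x \<partial>lborel)"
    using distributed_emeasure[OF d, of "{-K..K}"] by simp
  also have "\<dots> \<le> (\<integral>\<^sup>+x. ennreal (1 / sqrt (2 * pi * t)) * indicator {-K..K} x \<partial>lborel)"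
  proof (intro nn_integral_mono mult_right_mono ennreal_leI)
    fix x
    have "normal_density 0 (sqrt t) x = 1 / sqrt (2 * pi * t) * exp (- (x\<^sup>2) / (2 * t))"
      using t by (simp add: normal_density_def)
    also have "\<dots> \<le> 1 / sqrt (2 * pi * t) * 1" using t by (intro mult_left_mono) (auto simp: field_simps)
    finally show "normal_density 0 (sqrt t) x \<le> 1 / sqrt (2 * pi * t)" by simp
  qed simp
  also have "\<dots> = ennreal (1 / sqrt (2 * pi * t)) * ennreal (2 * K)"
    using K by (simp add: nn_integral_cmult_indicator)
  also have "\<dots> = ennreal (2 * K / sqrt (2 * pi * t))"
    using K t by (simp add: ennreal_mult[symmetric])
  finally show ?thesis .
qed

lemma W_nonzero: assumes t: "0 < t" shows "AE \<omega> in M. W t \<omega> \<noteq> 0"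
proof -
  have [measurable]: "W t \<in> borel_measurable M" "W 0 \<in> borel_measurable M" using W_measurable t by auto
  have "emeasure M {\<omega>\<in>space M. \<bar>W t \<omega> - W 0 \<omega>\<bar> \<le> 0} = 0" using increment_small[OF t, of 0] by simp
  then have "AE \<omega> in M. \<not> \<bar>W t \<omega> - W 0 \<omega>\<bar> \<le> 0" by (subst AE_iff_measurable[OF _ refl]) auto
  then show ?thesis using AE_continuous_path by eventually_elim (simp add: continuous_path_def)
qed

text \<open>
  A normal variable of large variance is unlikely to lie in a given bounded interval.
\<close>

lemma escape:
  assumes \<tau>: "\<tau> \<in> borel_measurable M" and b: "AE \<omega> in M. \<forall>t\<ge>0. ennreal t < \<tau> \<omega> \<longrightarrow> \<bar>W t \<omega>\<bar> \<le> K"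
  shows "AE \<omega> in M. \<tau> \<omega> < \<top>"
proof -
  define A where "A = {\<omega>\<in>space M. \<not> \<tau> \<omega> < \<top>}"
  have A: "A \<in> sets M" unfolding A_def using \<tau> by measurable
  define K' where "K' = max K 0"
  have le: "emeasure M A \<le> ennreal (2 * K' / sqrt (2 * pi * (real (Suc n))))" for n
  proof -
    have [measurable]: "W (real (Suc n)) \<in> borel_measurable M" "W 0 \<in> borel_measurable M" using W_measurable by auto
    have "emeasure M A \<le> emeasure M {\<omega>\<in>space M. \<bar>W (real (Suc n)) \<omega> - W 0 \<omega>\<bar> \<le> K'}"
    proof (rule emeasure_mono_AE)
      show "AE \<omega> in M. \<omega> \<in> A \<longrightarrow> \<omega> \<in> {\<omega>\<in>space M. \<bar>W (real (Suc n)) \<omega> - W 0 \<omega>\<bar> \<le> K'}"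
        using b AE_continuous_path
      proof eventually_elim
        fix \<omega> assume *: "\<forall>t\<ge>0. ennreal t < \<tau> \<omega> \<longrightarrow> \<bar>W t \<omega>\<bar> \<le> K" "continuous_path \<omega>"
        show "\<omega> \<in> A \<longrightarrow> \<omega> \<in> {\<omega>\<in>space M. \<bar>W (real (Suc n)) \<omega> - W 0 \<omega>\<bar> \<le> K'}"
        proof
          assume "\<omega> \<in> A"
          then have "\<tau> \<omega> = \<top>" "\<omega> \<in> space M" by (simp_all add: A_def less_top[symmetric])
          then show "\<omega> \<in> {\<omega>\<in>space M. \<bar>W (real (Suc n)) \<omega> - W 0 \<omega>\<bar> \<le> K'}"
            using *(1)[rule_format, of "real (Suc n)"] *(2) by (simp add: continuous_path_def K'_def del: of_nat_Suc)
        qed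
      qed
    qed measurable
    also have "\<dots> \<le> ennreal (2 * K' / sqrt (2 * pi * (real (Suc n))))"
      by (rule increment_small) (auto simp: K'_def)
    finally show ?thesis .
  qed
  have "(\<lambda>n. ennreal (2 * K' / sqrt (2 * pi * (real (Suc n))))) \<longlonglongrightarrow> ennreal 0"
    by (intro tendsto_ennrealI) real_asymp
  then have "emeasure M A \<le> ennreal 0" by (rule LIMSEQ_le_const) (use le in auto)
  then have "A \<in> null_sets M" using A by auto
  then show ?thesis unfolding AE_iff_null_sets A_def .
qed

end

section \<open>Uniform integrability, gambler's ruin and oscillation at time zero\<close>

context brownian begin

text \<open>
  Rational times determine the path by continuity.
\<close>

lemma stopped_process_range:
  assumes "AE \<omega> in M. \<forall>r\<in>\<rat>. 0 \<le> r \<longrightarrow> ennreal r < \<tau> \<omega> \<longrightarrow> lo \<le> W r \<omega> \<and> W r \<omega> \<le> hi"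
    and "lo \<le> 0" "0 \<le> hi"
  shows "AE \<omega> in M. \<forall>t\<ge>0. lo \<le> stopped_process W \<tau> t \<omega> \<and> stopped_process W \<tau> t \<omega> \<le> hi"
  using assms(1) AE_continuous_path
proof eventually_elim
  fix \<omega> assume *: "\<forall>r\<in>\<rat>. 0 \<le> r \<longrightarrow> ennreal r < \<tau> \<omega> \<longrightarrow> lo \<le> W r \<omega> \<and> W r \<omega> \<le> hi" and g: "continuous_path \<omega>"
  show "\<forall>t\<ge>0. lo \<le> stopped_process W \<tau> t \<omega> \<and> stopped_process W \<tau> t \<omega> \<le> hi"
  proof (intro allI impI)
    fix t :: real assume t: "0 \<le> t"
    define s where "s = enn2real (min (ennreal t) (\<tau> \<omega>))"
    have fin: "min (ennreal t) (\<tau> \<omega>) < \<top>" by (simp add: min_less_iff_disj)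
    then have es: "ennreal s \<le> \<tau> \<omega>" by (simp add: s_def)
    have s0: "0 \<le> s" by (simp add: s_def)
    have "lo \<le> W s \<omega> \<and> W s \<omega> \<le> hi"
    proof (cases "s = 0")
      case True then show ?thesis using g assms(2,3) by (simp add: continuous_path_def)
    next
      case False
      then obtain q where q: "\<And>n. q n \<in> \<rat>" "\<And>n. 0 < q n" "\<And>n. q n < s" "q \<longlonglongrightarrow> s"
        using rational_left_approach[of s] s0 by (metis less_le)
      have l: "(\<lambda>n. W (q n) \<omega>) \<longlonglongrightarrow> W s \<omega>"
        by (rule path_LIMSEQ[OF g s0 q(4)]) (use q(2) in \<open>auto intro: less_imp_le\<close>)
      have "ennreal (q n) < \<tau> \<omega>" for n
        using q(2,3)[of n] es by (meson ennreal_lessI less_le_trans less_trans)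
      then have b: "lo \<le> W (q n) \<omega> \<and> W (q n) \<omega> \<le> hi" for n
        using * q(1,2)[of n] by (meson less_imp_le)
      show ?thesis using LIMSEQ_le_const[OF l, of lo] LIMSEQ_le_const2[OF l, of hi] b by blast
    qed
    then show "lo \<le> stopped_process W \<tau> t \<omega> \<and> stopped_process W \<tau> t \<omega> \<le> hi"
      by (simp add: stopped_process_def at_time_def s_def)
  qed
qed

text \<open>
  Uniform integrability allows the passage \<open>t \<rightarrow> \<infinity>\<close> in \<open>optional_stopping_conditional\<close>: truncating the
  stopped process costs at most \<open>e\<close>, uniformly in time.
\<close>

lemma ui_closed:
  assumes \<tau>: "stopping_time \<F> \<tau>" "AE \<omega> in M. \<tau> \<omega> < \<top>"
    and ui: "uniformly_integrable M {0..} (stopped_process W \<tau>)"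
    and bd: "AE \<omega> in M. \<bar>at_time W \<tau> \<omega>\<bar> \<le> L"
    and A: "A \<in> sets (\<F> (ennreal r))" and r: "0 \<le> r"
  shows "expectation (\<lambda>\<omega>. indicator A \<omega> * stopped_process W \<tau> r \<omega>)
       = expectation (\<lambda>\<omega>. indicator A \<omega> * at_time W \<tau> \<omega>)"
proof -
  let ?X = "\<lambda>n. stopped_process W \<tau> (real n)" and ?Y = "at_time W \<tau>"
  have AM: "A \<in> sets M" using A sets_F_subset by blast
  have Xm[measurable]: "?X n \<in> borel_measurable M" for n using stopped_process_measurable[OF \<tau>(1)] by simp
  have Ym[measurable]: "?Y \<in> borel_measurable M" by (rule at_time_measurable[OF \<tau>])
  have Xi: "integrable M (?X n)" for n using optional_stopping[OF \<tau>(1)] by simp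
  have iA: "integrable M (\<lambda>\<omega>. indicator A \<omega> * f \<omega>)" if "integrable M f" for f :: "'a \<Rightarrow> real"
    using integrable_mult_indicator[OF AM that] by simp
  have le: "\<bar>expectation (\<lambda>\<omega>. indicator A \<omega> * stopped_process W \<tau> r \<omega>)
       - expectation (\<lambda>\<omega>. indicator A \<omega> * ?Y \<omega>)\<bar> \<le> e" if e: "0 < e" for e
  proof -
    let ?U = "\<lambda>K::real. SUP i\<in>{0..}. \<integral>\<^sup>+\<omega>. ennreal \<bar>stopped_process W \<tau> i \<omega>\<bar> * indicator {\<omega>. K < \<bar>stopped_process W \<tau> i \<omega>\<bar>} \<omega> \<partial>M"
    have "(?U \<longlongrightarrow> 0) at_top" using ui unfolding uniformly_integrable_def by blast
    then have "\<forall>\<^sub>F K in at_top. ?U K < ennreal e" using e by (intro order_tendstoD(2)) auto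
    moreover have "\<forall>\<^sub>F K in at_top. max L 0 \<le> K" by (rule eventually_ge_at_top)
    ultimately obtain K where K: "?U K < ennreal e" "L \<le> K" "0 \<le> K"
      using eventually_happens[OF eventually_conj] by (metis (no_types, lifting) max.bounded_iff trivial_limit_at_top_linorder)
    define cl where "cl x = max (- K) (min K x)" for x :: real
    have clm[measurable]: "cl \<in> borel_measurable borel" unfolding cl_def[abs_def] by measurable
    have cli: "integrable M (\<lambda>\<omega>. cl (Z \<omega>))" if [measurable]: "Z \<in> borel_measurable M" for Z :: "'a \<Rightarrow> real"
      by (rule integrable_const_bound[of _ K]) (use K in \<open>auto simp: cl_def\<close>)
    have err: "\<bar>expectation (\<lambda>\<omega>. indicator A \<omega> * ?X n \<omega>) - expectation (\<lambda>\<omega>. indicator A \<omega> * cl (?X n \<omega>))\<bar> \<le> e" for n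
    proof -
      have "(\<integral>\<^sup>+\<omega>. ennreal \<bar>?X n \<omega> - cl (?X n \<omega>)\<bar> \<partial>M) \<le> (\<integral>\<^sup>+\<omega>. ennreal \<bar>?X n \<omega>\<bar> * indicator {\<omega>. K < \<bar>?X n \<omega>\<bar>} \<omega> \<partial>M)"
        by (intro nn_integral_mono) (use K in \<open>auto simp: cl_def indicator_def max_def min_def intro!: ennreal_leI\<close>)
      also have "\<dots> \<le> ?U K" by (intro SUP_upper) auto
      also have "\<dots> \<le> ennreal e" using K by simp
      finally have n: "(\<integral>\<^sup>+\<omega>. ennreal \<bar>?X n \<omega> - cl (?X n \<omega>)\<bar> \<partial>M) \<le> ennreal e" .
      have di: "integrable M (\<lambda>\<omega>. \<bar>?X n \<omega> - cl (?X n \<omega>)\<bar>)" using Xi cli by auto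
      have "ennreal (expectation (\<lambda>\<omega>. \<bar>?X n \<omega> - cl (?X n \<omega>)\<bar>)) \<le> ennreal e"
        using n nn_integral_eq_integral[OF di] by simp
      then have ee: "expectation (\<lambda>\<omega>. \<bar>?X n \<omega> - cl (?X n \<omega>)\<bar>) \<le> e" using e by (simp add: ennreal_le_iff)
      have "\<bar>expectation (\<lambda>\<omega>. indicator A \<omega> * ?X n \<omega>) - expectation (\<lambda>\<omega>. indicator A \<omega> * cl (?X n \<omega>))\<bar>
         = \<bar>expectation (\<lambda>\<omega>. indicator A \<omega> * ?X n \<omega> - indicator A \<omega> * cl (?X n \<omega>))\<bar>"
        using iA[OF Xi] iA[OF cli[OF Xm]] by simp
      also have "\<dots> \<le> expectation (\<lambda>\<omega>. \<bar>indicator A \<omega> * ?X n \<omega> - indicator A \<omega> * cl (?X n \<omega>)\<bar>)"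
        by (rule integral_abs_bound)
      also have "\<dots> \<le> expectation (\<lambda>\<omega>. \<bar>?X n \<omega> - cl (?X n \<omega>)\<bar>)"
      proof (rule integral_mono[OF _ di])
        show "integrable M (\<lambda>\<omega>. \<bar>indicator A \<omega> * ?X n \<omega> - indicator A \<omega> * cl (?X n \<omega>)\<bar>)"
          using iA[OF Xi] iA[OF cli[OF Xm]] by simp
      qed (auto simp: indicator_def)
      finally show ?thesis using ee by simp
    qed
    have lim: "(\<lambda>n. expectation (\<lambda>\<omega>. indicator A \<omega> * cl (?X n \<omega>))) \<longlonglongrightarrow> expectation (\<lambda>\<omega>. indicator A \<omega> * ?Y \<omega>)"
    proof (rule integral_dominated_convergence[where w="\<lambda>_. K"])
      show "AE \<omega> in M. (\<lambda>n. indicator A \<omega> * cl (?X n \<omega>)) \<longlonglongrightarrow> indicator A \<omega> * ?Y \<omega>"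
        using stopped_process_LIMSEQ[OF \<tau>(2)] bd
      proof eventually_elim
        fix \<omega> assume *: "(\<lambda>n. ?X n \<omega>) \<longlonglongrightarrow> ?Y \<omega>" "\<bar>?Y \<omega>\<bar> \<le> L"
        have "cl (?Y \<omega>) = ?Y \<omega>" using *(2) K by (simp add: cl_def)
        moreover have "(\<lambda>n. cl (?X n \<omega>)) \<longlonglongrightarrow> cl (?Y \<omega>)" unfolding cl_def by (intro tendsto_intros *(1))
        ultimately show "(\<lambda>n. indicator A \<omega> * cl (?X n \<omega>)) \<longlonglongrightarrow> indicator A \<omega> * ?Y \<omega>"
          by (intro tendsto_mult_left) simp
      qed
      show "AE \<omega> in M. norm (indicator A \<omega> * cl (?X n \<omega>)) \<le> K" for n
        using K by (auto simp: cl_def indicator_def)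
    qed (use AM in auto)
    have "\<bar>expectation (\<lambda>\<omega>. indicator A \<omega> * stopped_process W \<tau> r \<omega>) - expectation (\<lambda>\<omega>. indicator A \<omega> * cl (?X n \<omega>))\<bar> \<le> e"
      if "r \<le> real n" for n
      using err[of n] optional_stopping_conditional[OF \<tau>(1) r that A] by simp
    then show ?thesis
      by (intro LIMSEQ_le_const2[OF tendsto_rabs[OF tendsto_diff[OF tendsto_const lim]]])
         (meson nat_ceiling_le_eq order_trans real_nat_ceiling_ge)
  qed
  have "\<bar>expectation (\<lambda>\<omega>. indicator A \<omega> * stopped_process W \<tau> r \<omega>)
       - expectation (\<lambda>\<omega>. indicator A \<omega> * ?Y \<omega>)\<bar> \<le> 0"
    by (rule field_le_epsilon) (use le in simp)
  then show ?thesis by simp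
qed

text \<open>
  A uniformly integrable embedding never leaves the convex hull of the support of its target: on the event that
  \<open>W\<close> exceeds \<open>hi\<close> at time \<open>r\<close> before \<open>\<tau>\<close>, \<open>ui_closed\<close> equates the mean of \<open>W\<close> at time \<open>r\<close> with that of a
  variable bounded by \<open>hi\<close>.
\<close>

lemma ui_range:
  assumes \<tau>: "stopping_time \<F> \<tau>" "AE \<omega> in M. \<tau> \<omega> < \<top>"
    and ui: "uniformly_integrable M {0..} (stopped_process W \<tau>)"
    and bd: "AE \<omega> in M. lo \<le> at_time W \<tau> \<omega> \<and> at_time W \<tau> \<omega> \<le> hi" and lh: "lo \<le> 0" "0 \<le> hi"
  shows "AE \<omega> in M. \<forall>t\<ge>0. lo \<le> stopped_process W \<tau> t \<omega> \<and> stopped_process W \<tau> t \<omega> \<le> hi"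
proof (rule stopped_process_range[OF _ lh])
  have Ym[measurable]: "at_time W \<tau> \<in> borel_measurable M" by (rule at_time_measurable[OF \<tau>])
  have b2: "AE \<omega> in M. \<bar>at_time W \<tau> \<omega>\<bar> \<le> max (- lo) hi" using bd by eventually_elim auto
  have Yi: "integrable M (at_time W \<tau>)" by (rule integrable_const_bound[of _ "max (-lo) hi"]) (use b2 in auto)
  have one: "AE \<omega> in M. ennreal r < \<tau> \<omega> \<longrightarrow> \<epsilon> * W r \<omega> \<le> b"
    if r: "0 \<le> r" and b: "AE \<omega> in M. \<epsilon> * at_time W \<tau> \<omega> \<le> b" for r \<epsilon> b :: real
  proof -
    define A where "A = {\<omega>\<in>space M. ennreal r < \<tau> \<omega>} \<inter> {\<omega>\<in>space M. b < \<epsilon> * W r \<omega>}"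
    have "{\<omega>\<in>space (\<F> (ennreal r)). b < \<epsilon> * W r \<omega>} \<in> sets (\<F> (ennreal r))"
      using W_measurable_F[OF r] by measurable
    then have A: "A \<in> sets (\<F> (ennreal r))"
      using stopping_time_gt[OF \<tau>(1), of "ennreal r"] by (simp add: A_def space_F)
    then have AM[measurable]: "A \<in> sets M" using sets_F_subset by blast
    have Xr: "integrable M (stopped_process W \<tau> r)" using optional_stopping[OF \<tau>(1) r] by simp
    have on: "indicator A \<omega> * stopped_process W \<tau> r \<omega> = indicator A \<omega> * W r \<omega>" for \<omega>
      using r by (auto simp: A_def stopped_process_def at_time_def indicator_def min_def)
    have iA: "integrable M (\<lambda>\<omega>. indicator A \<omega> * f \<omega>)" if "integrable M f" for f :: "'a \<Rightarrow> real"
      using integrable_mult_indicator[OF AM that] by simp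
    note i1 = iA[OF Xr] and i2 = iA[OF Yi]
    have i1': "integrable M (\<lambda>\<omega>. indicator A \<omega> * W r \<omega>)" using i1 unfolding on .
    have iI: "integrable M (\<lambda>\<omega>. indicator A \<omega> :: real)" by (rule integrable_const_bound[of _ 1]) auto
    have e: "expectation (\<lambda>\<omega>. indicator A \<omega> * W r \<omega>) = expectation (\<lambda>\<omega>. indicator A \<omega> * at_time W \<tau> \<omega>)"
      using ui_closed[OF \<tau> ui b2 A r] unfolding on .
    define f where "f \<omega> = \<epsilon> * (indicator A \<omega> * W r \<omega>) - b * indicator A \<omega>" for \<omega>
    have fi: "integrable M f" unfolding f_def using i1' iI by simp
    have "expectation f = expectation (\<lambda>\<omega>. \<epsilon> * (indicator A \<omega> * at_time W \<tau> \<omega>) - b * indicator A \<omega>)"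
      unfolding f_def using i1' i2 iI e by simp
    also have "\<dots> \<le> expectation (\<lambda>\<omega>. 0)"
    proof (rule integral_mono_AE)
      show "AE \<omega> in M. \<epsilon> * (indicator A \<omega> * at_time W \<tau> \<omega>) - b * indicator A \<omega> \<le> 0"
        using b by eventually_elim (auto simp: indicator_def)
    qed (use i2 iI in auto)
    finally have "expectation f \<le> 0" by simp
    moreover have f0: "0 \<le> f \<omega>" for \<omega> by (auto simp: f_def A_def indicator_def)
    ultimately have "expectation f = 0" using integral_nonneg_AE[of f M] by (simp add: antisym)
    then have "AE \<omega> in M. f \<omega> = 0" using integral_nonneg_eq_0_iff_AE[OF fi] f0 by simp
    then show ?thesis using AE_space
      by eventually_elim (auto simp: f_def A_def indicator_def split: if_splits)
  qed
  have "AE \<omega> in M. \<forall>r\<in>\<rat>. 0 \<le> r \<longrightarrow> ennreal r < \<tau> \<omega> \<longrightarrow> lo \<le> W r \<omega> \<and> W r \<omega> \<le> hi"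
  proof (rule AE_ball_countable[THEN iffD2, OF countable_rat], intro ballI)
    fix r :: real
    show "AE \<omega> in M. 0 \<le> r \<longrightarrow> ennreal r < \<tau> \<omega> \<longrightarrow> lo \<le> W r \<omega> \<and> W r \<omega> \<le> hi"
    proof (cases "0 \<le> r")
      case True
      have "AE \<omega> in M. ennreal r < \<tau> \<omega> \<longrightarrow> 1 * W r \<omega> \<le> hi" by (rule one[OF True]) (use bd in \<open>auto elim!: eventually_mono\<close>)
      moreover have "AE \<omega> in M. ennreal r < \<tau> \<omega> \<longrightarrow> -1 * W r \<omega> \<le> - lo" by (rule one[OF True]) (use bd in \<open>auto elim!: eventually_mono\<close>)
      ultimately show ?thesis by eventually_elim auto
    qed simp
  qed
  then show "AE \<omega> in M. \<forall>r\<in>\<rat>. 0 \<le> r \<longrightarrow> ennreal r < \<tau> \<omega> \<longrightarrow> lo \<le> W r \<omega> \<and> W r \<omega> \<le> hi" .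
qed

lemma bounded_until_of_range:
  assumes "stopping_time \<F> \<tau>" "AE \<omega> in M. \<tau> \<omega> < \<top>"
    and "AE \<omega> in M. \<forall>t\<ge>0. lo \<le> stopped_process W \<tau> t \<omega> \<and> stopped_process W \<tau> t \<omega> \<le> hi"
  shows "bounded_until \<tau> (max (- lo) hi)"
proof -
  have "AE \<omega> in M. \<forall>t\<ge>0. \<bar>stopped_process W \<tau> t \<omega>\<bar> \<le> max (- lo) hi"
    using assms(3) by eventually_elim (auto simp: abs_le_iff le_max_iff_disj)
  then show ?thesis unfolding bounded_until_def using assms(1,2) by blast
qed

text \<open>
  The mean of \<open>W\<close> at the exit from \<open>(- b, a)\<close> is \<open>0\<close>.  The event is covered by a measurable one, since it is
  an uncountable union over \<open>u\<close>.
\<close>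

lemma gamblers_ruin:
  assumes ab: "0 < a" "0 < b"
  shows "\<exists>A\<in>sets M. prob A \<le> a / (a + b) \<and>
     (AE \<omega> in M. (\<exists>u\<ge>0. b \<le> running_sup (\<lambda>t \<omega>. - W t \<omega>) u \<omega> \<and> running_sup W u \<omega> < a) \<longrightarrow> \<omega> \<in> A)"
proof -
  interpret N: brownian M \<F> "\<lambda>t \<omega>. - W t \<omega>" by (rule neg_brownian)
  define \<sigma> where "\<sigma> \<omega> = min (hit a \<omega>) (N.hit b \<omega>)" for \<omega>
  have st: "stopping_time \<F> \<sigma>"
    unfolding \<sigma>_def[abs_def] by (intro stopping_time_min hit_stopping_time N.hit_stopping_time)
  have continuous_path: "N.continuous_path \<omega>" if "continuous_path \<omega>" for \<omega>
    using that by (auto simp: continuous_path_def N.continuous_path_def intro!: continuous_on_minus)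
  have rng: "- b \<le> W v \<omega> \<and> W v \<omega> \<le> a" if g: "continuous_path \<omega>" and v: "0 \<le> v" "ennreal v \<le> \<sigma> \<omega>" for v \<omega>
    using below_hit[OF g v(1), of a] N.below_hit[OF continuous_path[OF g] v(1), of b] v(2) ab by (simp add: \<sigma>_def)
  have [measurable]: "hit a \<in> borel_measurable M" "N.hit b \<in> borel_measurable M"
    using stopping_time_measurable hit_stopping_time N.hit_stopping_time by auto
  have fin: "AE \<omega> in M. \<sigma> \<omega> < \<top>"
  proof (rule escape[OF stopping_time_measurable[OF st], of "max a b"])
    show "AE \<omega> in M. \<forall>t\<ge>0. ennreal t < \<sigma> \<omega> \<longrightarrow> \<bar>W t \<omega>\<bar> \<le> max a b"
      using AE_continuous_path
    proof eventually_elim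
      fix \<omega> assume g: "continuous_path \<omega>"
      show "\<forall>t\<ge>0. ennreal t < \<sigma> \<omega> \<longrightarrow> \<bar>W t \<omega>\<bar> \<le> max a b"
        using rng[OF g] by (force simp: abs_le_iff le_max_iff_disj)
    qed
  qed
  have "AE \<omega> in M. \<forall>t\<ge>0. - b \<le> stopped_process W \<sigma> t \<omega> \<and> stopped_process W \<sigma> t \<omega> \<le> a"
    by (rule stopped_process_range) (use AE_continuous_path rng ab in \<open>auto elim!: eventually_mono\<close>)
  then have bu: "bounded_until \<sigma> (max (- (- b)) a)" by (rule bounded_until_of_range[OF st fin])
  note B = bounded_until_at_time[OF bu]
  define A where "A = {\<omega>\<in>space M. N.hit b \<omega> < hit a \<omega>}"
  have A[measurable]: "A \<in> sets M" unfolding A_def by measurable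
  have iI: "integrable M (\<lambda>\<omega>. indicator A \<omega> :: real)" by (rule integrable_const_bound[of _ 1]) auto
  have "0 \<le> expectation (\<lambda>\<omega>. a - (a + b) * indicator A \<omega>)"
    unfolding B(4)[symmetric]
  proof (rule integral_mono_AE[OF B(3)])
    show "integrable M (\<lambda>\<omega>. a - (a + b) * indicator A \<omega>)" using iI by simp
    show "AE \<omega> in M. at_time W \<sigma> \<omega> \<le> a - (a + b) * indicator A \<omega>"
      using AE_continuous_path fin
    proof eventually_elim
      fix \<omega> assume g: "continuous_path \<omega>" and f: "\<sigma> \<omega> < \<top>"
      have e\<sigma>: "ennreal (enn2real (\<sigma> \<omega>)) = \<sigma> \<omega>" using f by simp
      show "at_time W \<sigma> \<omega> \<le> a - (a + b) * indicator A \<omega>"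
      proof (cases "\<omega> \<in> A")
        case True
        then have h: "N.hit b \<omega> < hit a \<omega>" by (simp add: A_def)
        then have \<sigma>e: "\<sigma> \<omega> = N.hit b \<omega>" by (simp add: \<sigma>_def)
        then obtain e where e: "0 \<le> e" "N.hit b \<omega> = ennreal e" "b \<le> - W e \<omega>" "\<And>u. 0 \<le> u \<Longrightarrow> u < e \<Longrightarrow> - W u \<omega> < b"
          using N.hit_attained[OF continuous_path[OF g], of b] f by metis
        then have "at_time W \<sigma> \<omega> = W e \<omega>" using \<sigma>e by (simp add: at_time_def)
        then show ?thesis using e(3) True by simp
      next
        case False
        then show ?thesis using rng[OF g enn2real_nonneg, of "\<sigma> \<omega>"] e\<sigma> by (simp add: at_time_def)
      qed
    qed
  qed
  also have "\<dots> = a - (a + b) * prob A" using iI by (simp add: prob_space)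
  finally have "prob A \<le> a / (a + b)" using ab by (simp add: pos_le_divide_eq mult.commute)
  moreover have "AE \<omega> in M. (\<exists>u\<ge>0. b \<le> running_sup (\<lambda>t \<omega>. - W t \<omega>) u \<omega> \<and> running_sup W u \<omega> < a) \<longrightarrow> \<omega> \<in> A"
    using AE_continuous_path AE_space
  proof eventually_elim
    fix \<omega> assume g: "continuous_path \<omega>" and sp: "\<omega> \<in> space M"
    show "(\<exists>u\<ge>0. b \<le> running_sup (\<lambda>t \<omega>. - W t \<omega>) u \<omega> \<and> running_sup W u \<omega> < a) \<longrightarrow> \<omega> \<in> A"
    proof
      assume "\<exists>u\<ge>0. b \<le> running_sup (\<lambda>t \<omega>. - W t \<omega>) u \<omega> \<and> running_sup W u \<omega> < a"
      then obtain u where u: "0 \<le> u" "b \<le> running_sup (\<lambda>t \<omega>. - W t \<omega>) u \<omega>" "running_sup W u \<omega> < a" by blast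
      have "N.hit b \<omega> \<le> ennreal u" using N.hit_le_iff[OF continuous_path[OF g] u(1)] u(2) by blast
      moreover have "ennreal u < hit a \<omega>" using hit_le_iff[OF g u(1), of a] u(3) by (simp add: not_le[symmetric])
      ultimately show "\<omega> \<in> A" using sp unfolding A_def by (auto intro: le_less_trans)
    qed
  qed
  ultimately show ?thesis using A by blast
qed

text \<open>
  If the supremum were \<open>0\<close> up to time \<open>t\<close>, the path would almost surely be negative at \<open>t\<close>, so some level \<open>- b\<close>
  would be hit before any \<open>a > 0\<close>; by \<open>gamblers_ruin\<close> this has probability at most \<open>a / b\<close> for every \<open>a\<close>.
\<close>

lemma sup_pos: "AE \<omega> in M. \<forall>t>0. 0 < running_sup W t \<omega>"
proof -
  interpret N: brownian M \<F> "\<lambda>t \<omega>. - W t \<omega>" by (rule neg_brownian)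
  have one: "AE \<omega> in M. 0 < running_sup W t \<omega>" if t: "0 < t" for t
  proof -
    have [measurable]: "running_sup W t \<in> borel_measurable M" "running_sup (\<lambda>t \<omega>. - W t \<omega>) t \<in> borel_measurable M"
      using sup_measurable_F[of t] N.sup_measurable_F[of t] measurable_F t by auto
    have "AE \<omega> in M. \<not> (running_sup W t \<omega> \<le> 0 \<and> 1 / Suc m \<le> running_sup (\<lambda>t \<omega>. - W t \<omega>) t \<omega>)" for m :: nat
    proof -
      define b where "b = 1 / real (Suc m)"
      have b: "0 < b" by (simp add: b_def)
      define Q where "Q = {\<omega>\<in>space M. running_sup W t \<omega> \<le> 0 \<and> b \<le> running_sup (\<lambda>t \<omega>. - W t \<omega>) t \<omega>}"
      have Q[measurable]: "Q \<in> sets M" unfolding Q_def by measurable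
      have le: "prob Q \<le> a / b" if a: "0 < a" for a
      proof -
        obtain A where A: "A \<in> sets M" "prob A \<le> a / (a + b)"
          "AE \<omega> in M. (\<exists>u\<ge>0. b \<le> running_sup (\<lambda>t \<omega>. - W t \<omega>) u \<omega> \<and> running_sup W u \<omega> < a) \<longrightarrow> \<omega> \<in> A"
          using gamblers_ruin[OF a b] by blast
        have "AE \<omega> in M. \<omega> \<in> Q \<longrightarrow> \<omega> \<in> A"
          using A(3) by eventually_elim (use t a in \<open>force simp: Q_def\<close>)
        then have "prob Q \<le> prob A" using A(1) by (intro finite_measure_mono_AE)
        also have "\<dots> \<le> a / b" using A(2) a b by (meson divide_left_mono less_add_same_cancel2 less_imp_le mult_pos_pos order_trans add_pos_pos)
        finally show ?thesis .
      qed
      have "prob Q \<le> 0 + e" if "0 < e" for e using le[of "e * b"] b that by simp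
      then have "prob Q \<le> 0" by (rule field_le_epsilon)
      then have "emeasure M Q = 0" by (simp add: emeasure_eq_measure measure_le_0_iff)
      then have "Q \<in> null_sets M" using Q by auto
      then show ?thesis unfolding AE_iff_null_sets Q_def b_def by simp
    qed
    then have "AE \<omega> in M. \<forall>m::nat. \<not> (running_sup W t \<omega> \<le> 0 \<and> 1 / Suc m \<le> running_sup (\<lambda>t \<omega>. - W t \<omega>) t \<omega>)"
      unfolding AE_all_countable by blast
    then show ?thesis using AE_continuous_path N.AE_continuous_path W_nonzero[OF t]
    proof eventually_elim
      fix \<omega> assume *: "\<forall>m::nat. \<not> (running_sup W t \<omega> \<le> 0 \<and> 1 / Suc m \<le> running_sup (\<lambda>t \<omega>. - W t \<omega>) t \<omega>)"
        "continuous_path \<omega>" "N.continuous_path \<omega>" "W t \<omega> \<noteq> 0"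
      show "0 < running_sup W t \<omega>"
      proof (rule ccontr)
        assume n: "\<not> 0 < running_sup W t \<omega>"
        then have "W t \<omega> < 0" using sup_upper[OF *(2), of t t] *(4) t by simp
        then have "0 < running_sup (\<lambda>t \<omega>. - W t \<omega>) t \<omega>" using N.sup_upper[OF *(3), of t t] t by simp
        then obtain m :: nat where "inverse (real (Suc m)) < running_sup (\<lambda>t \<omega>. - W t \<omega>) t \<omega>"
          using reals_Archimedean by blast
        then show False using *(1)[rule_format, of m] n by (simp add: inverse_eq_divide)
      qed
    qed
  qed
  have "AE \<omega> in M. \<forall>n::nat. 0 < running_sup W (1 / Suc n) \<omega>"
    unfolding AE_all_countable using one by simp
  then show ?thesis using AE_continuous_path
  proof eventually_elim
    fix \<omega> assume *: "\<forall>n::nat. 0 < running_sup W (1 / Suc n) \<omega>" "continuous_path \<omega>"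
    show "\<forall>t>0. 0 < running_sup W t \<omega>"
    proof (intro allI impI)
      fix t :: real assume "0 < t"
      then obtain n :: nat where "inverse (real (Suc n)) < t" using reals_Archimedean by blast
      then have "running_sup W (1 / Suc n) \<omega> \<le> running_sup W t \<omega>"
        using sup_mono[OF *(2), of "1 / Suc n" t] by (simp add: inverse_eq_divide)
      then show "0 < running_sup W t \<omega>" using *(1)[rule_format, of n] by (rule less_le_trans[rotated])
    qed
  qed
qed

end

section \<open>Potentials of centred laws with bounded support\<close>

lemma pos_part_convex: "max ((1 - t) * a + t * b) 0 \<le> (1 - t) * max a 0 + t * max b (0::real)" if "0 \<le> t" "t \<le> 1"
proof -
  have "(1 - t) * a \<le> (1 - t) * max a 0" "t * b \<le> t * max b 0" using that by (auto intro!: mult_left_mono)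
  moreover have "0 \<le> (1 - t) * max a 0" "0 \<le> t * max b 0" using that by auto
  ultimately show ?thesis by simp
qed

locale bounded_law =
  fixes \<mu> :: "real measure" and c h :: real
  assumes rd: "real_distribution \<mu>" and conc: "AE y in \<mu>. c \<le> y \<and> y \<le> h"
    and mean: "(\<integral>y. y \<partial>\<mu>) = 0" and c0: "c < 0" and h0: "0 < h"
begin

sublocale D: real_distribution \<mu> by (rule rd)

lemma prob_UNIV: "measure \<mu> UNIV = 1"
  using D.prob_space D.space_eq_univ by simp

lemma int_bounded:
  assumes "continuous_on UNIV (f :: real \<Rightarrow> real)" shows "integrable \<mu> f"
proof -
  have "compact (f ` {c..h})" using continuous_on_subset[OF assms] by (intro compact_continuous_image) auto
  then obtain B where B: "\<And>y. y \<in> {c..h} \<Longrightarrow> norm (f y) \<le> B"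
    using compact_imp_bounded bounded_iff by (metis imageI)
  show ?thesis
  proof (rule D.integrable_const_bound[of _ B])
    show "AE y in \<mu>. norm (f y) \<le> B" using conc by eventually_elim (use B in auto)
    show "f \<in> borel_measurable \<mu>" using borel_measurable_continuous_onI[OF assms] by (simp cong: measurable_cong_sets)
  qed
qed

lemma int_call: "integrable \<mu> (\<lambda>y. max (y - x) 0)" and int_put: "integrable \<mu> (\<lambda>y. max (x - y) 0)"
  and int_id: "integrable \<mu> (\<lambda>y. y)"
  by (intro int_bounded continuous_intros)+

text \<open>
  Put-call parity for a centred law.
\<close>

lemma put_call: "put \<mu> x = call \<mu> x + x"
proof -
  have "put \<mu> x - call \<mu> x = (\<integral>y. max (x - y) 0 - max (y - x) 0 \<partial>\<mu>)"
    unfolding put_def call_def using int_call int_put by simp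
  also have "\<dots> = (\<integral>y. x - y \<partial>\<mu>)" by (rule Bochner_Integration.integral_cong) (auto simp: max_def)
  also have "\<dots> = x" using int_id mean by (simp add: prob_UNIV)
  finally show ?thesis by simp
qed

lemma call_nonneg: "0 \<le> call \<mu> x" unfolding call_def by (rule integral_nonneg_AE) simp
lemma put_nonneg: "0 \<le> put \<mu> x" unfolding put_def by (rule integral_nonneg_AE) simp

lemma call_convex: "convex_on UNIV (call \<mu>)"
proof (rule convex_onI)
  fix t x y :: real assume t: "0 < t" "t < 1"
  have "call \<mu> ((1 - t) * x + t * y) \<le> (\<integral>z. (1 - t) * max (z - x) 0 + t * max (z - y) 0 \<partial>\<mu>)"
    unfolding call_def
  proof (rule integral_mono)
    show "max (z - ((1 - t) * x + t * y)) 0 \<le> (1 - t) * max (z - x) 0 + t * max (z - y) 0" for z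
      using pos_part_convex[of t "z - x" "z - y"] t by (simp add: algebra_simps)
  qed (use int_call in auto)
  also have "\<dots> = (1 - t) * call \<mu> x + t * call \<mu> y" unfolding call_def using int_call by simp
  finally show "call \<mu> ((1 - t) *\<^sub>R x + t *\<^sub>R y) \<le> (1 - t) * call \<mu> x + t * call \<mu> y" by simp
qed auto

lemma call_antimono: "x \<le> y \<Longrightarrow> call \<mu> y \<le> call \<mu> x"
  unfolding call_def by (rule integral_mono[OF int_call int_call]) auto

lemma call_lipschitz: assumes "x \<le> y" shows "call \<mu> x - call \<mu> y \<le> y - x"
proof -
  have "call \<mu> x - call \<mu> y = (\<integral>z. max (z - x) 0 - max (z - y) 0 \<partial>\<mu>)"
    unfolding call_def using int_call by simp
  also have "\<dots> \<le> (\<integral>z. y - x \<partial>\<mu>)" by (rule integral_mono) (use int_call assms in \<open>auto simp: max_def\<close>)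
  finally show ?thesis by (simp add: prob_UNIV)
qed

lemma call_continuous: "continuous_on UNIV (call \<mu>)"
proof -
  have "\<bar>call \<mu> x - call \<mu> y\<bar> \<le> 1 * \<bar>x - y\<bar>" for x y
    using call_lipschitz[of x y] call_lipschitz[of y x] call_antimono[of x y] call_antimono[of y x]
    by (cases "x \<le> y") auto
  then have "1-lipschitz_on UNIV (call \<mu>)" by (intro lipschitz_onI) (auto simp: dist_real_def)
  then show ?thesis by (rule lipschitz_on_continuous_on)
qed

lemma call_zero: assumes "h \<le> x" shows "call \<mu> x = 0"
proof -
  have "AE y in \<mu>. max (y - x) 0 = 0" using conc by eventually_elim (use assms in auto)
  then have "call \<mu> x = (\<integral>y. 0 \<partial>\<mu>)" unfolding call_def by (intro integral_cong_AE) auto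
  then show ?thesis by simp
qed

lemma put_zero: assumes "x \<le> c" shows "put \<mu> x = 0"
proof -
  have "AE y in \<mu>. max (x - y) 0 = 0" using conc by eventually_elim (use assms in auto)
  then have "put \<mu> x = (\<integral>y. 0 \<partial>\<mu>)" unfolding put_def by (intro integral_cong_AE) auto
  then show ?thesis by simp
qed

lemma put_mono: "x \<le> y \<Longrightarrow> put \<mu> x \<le> put \<mu> y"
  unfolding put_def by (rule integral_mono[OF int_put int_put]) auto

lemma AY_potential_call: "AY_potential c h (call \<mu>)"
  unfolding AY_potential_def
proof (intro conjI allI impI)
  show "- x \<le> call \<mu> x" for x using put_call[of x] put_nonneg[of x] by simp
  show "call \<mu> x = - x" if "x \<le> c" for x using put_call[of x] put_zero[OF that] by simp
qed (use call_convex call_continuous call_nonneg call_zero call_antimono call_lipschitz in auto)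

lemma potential_call: "potential h (call \<mu>)"
  unfolding potential_def
  using call_convex call_continuous call_nonneg call_zero call_antimono
  by (auto intro: convex_on_subset continuous_on_subset)

end

lemma distr_uminus_uminus:
  assumes "sets \<mu> = sets (borel :: real measure)" shows "distr (distr \<mu> borel uminus) borel uminus = \<mu>"
proof -
  have "distr (distr \<mu> borel uminus) borel uminus = distr \<mu> borel (uminus \<circ> uminus :: real \<Rightarrow> real)"
    by (rule distr_distr) (auto simp: measurable_cong_sets[OF assms refl])
  also have "\<dots> = distr \<mu> \<mu> (\<lambda>x. x)" by (rule distr_cong) (auto simp: assms)
  finally show ?thesis by simp
qed

context bounded_law begin

lemma uminus_measurable: "uminus \<in> borel_measurable \<mu>"
  by (simp cong: measurable_cong_sets)

lemma reflect: "bounded_law (distr \<mu> borel uminus) (- h) (- c)"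
proof (rule bounded_law.intro)
  note [measurable] = uminus_measurable
  show "real_distribution (distr \<mu> borel uminus)" by (rule D.real_distribution_distr) measurable
  show "AE y in distr \<mu> borel uminus. - h \<le> y \<and> y \<le> - c"
  proof -
    have "AE y in \<mu>. - h \<le> - y \<and> - y \<le> - c" using conc by eventually_elim auto
    then show ?thesis by (subst AE_distr_iff) auto
  qed
  show "(\<integral>y. y \<partial>distr \<mu> borel uminus) = 0"
    using mean by (subst integral_distr) auto
qed (use c0 h0 in auto)

lemma call_reflect: "call (distr \<mu> borel uminus) x = put \<mu> (- x)"
  unfolding call_def put_def using uminus_measurable
  by (subst integral_distr) (auto intro!: Bochner_Integration.integral_cong simp: algebra_simps)

lemma put_reflect: "put (distr \<mu> borel uminus) x = call \<mu> (- x)"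
  unfolding call_def put_def using uminus_measurable
  by (subst integral_distr) (auto intro!: Bochner_Integration.integral_cong simp: algebra_simps)

lemma potential_put: "potential (- c) (\<lambda>y. put \<mu> (- y))"
proof -
  interpret R: bounded_law "distr \<mu> borel uminus" "- h" "- c" by (rule reflect)
  show ?thesis using R.potential_call by (simp add: call_reflect[abs_def])
qed

text \<open>
  The difference quotient is the mean of a ramp of height \<open>1\<close> over \<open>[x, x + e n]\<close>, which converges boundedly to
  the indicator of the half-line.
\<close>

lemma call_difference_limit:
  assumes e: "e \<longlonglongrightarrow> 0" "\<And>n::nat. 0 < e n"
  shows "(\<lambda>n. (call \<mu> x - call \<mu> (x + e n)) / e n) \<longlonglongrightarrow> measure \<mu> {x<..}"
proof -
  have eq: "(call \<mu> x - call \<mu> (x + e n)) / e n = (\<integral>y. (max (y - x) 0 - max (y - (x + e n)) 0) / e n \<partial>\<mu>)" for n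
    unfolding call_def using int_call by simp
  have "(\<lambda>n. \<integral>y. (max (y - x) 0 - max (y - (x + e n)) 0) / e n \<partial>\<mu>) \<longlonglongrightarrow> (\<integral>y. indicator {x<..} y \<partial>\<mu>)"
  proof (rule integral_dominated_convergence[where w="\<lambda>_. 1"])
    show "AE y in \<mu>. (\<lambda>n. (max (y - x) 0 - max (y - (x + e n)) 0) / e n) \<longlonglongrightarrow> indicator {x<..} y"
    proof (rule AE_I2)
      fix y
      show "(\<lambda>n. (max (y - x) 0 - max (y - (x + e n)) 0) / e n) \<longlonglongrightarrow> indicator {x<..} y"
      proof (rule tendsto_eventually)
        show "\<forall>\<^sub>F n in sequentially. (max (y - x) 0 - max (y - (x + e n)) 0) / e n = indicator {x<..} y"
        proof (cases "x < y")
          case True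
          then have "\<forall>\<^sub>F n in sequentially. e n < y - x" using order_tendstoD(2)[OF e(1), of "y - x"] by simp
          then show ?thesis
          proof eventually_elim
            case (elim n)
            then have "max (y - x) 0 - max (y - (x + e n)) 0 = e n" using True e(2)[of n] by simp
            then show ?case using True e(2)[of n] by simp
          qed
        next
          case False
          then have "max (y - x) 0 = 0" "max (y - (x + e n)) 0 = 0" for n using e(2)[of n] by auto
          then show ?thesis using False by simp
        qed
      qed
    qed
    show "AE y in \<mu>. norm ((max (y - x) 0 - max (y - (x + e n)) 0) / e n) \<le> 1" for n
    proof (rule AE_I2)
      fix y
      have "\<bar>max (y - x) 0 - max (y - (x + e n)) 0\<bar> \<le> e n" using e(2)[of n] by (auto simp: max_def)
      then show "norm ((max (y - x) 0 - max (y - (x + e n)) 0) / e n) \<le> 1" using e(2)[of n] by simp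
    qed
  qed auto
  then show ?thesis unfolding eq by simp
qed

end

text \<open>
  Laws with equal call functions have equal tails, by differentiation.
\<close>

lemma law_eqI:
  assumes "bounded_law \<mu> c h" "bounded_law \<nu> c h" and eq: "\<And>x. call \<mu> x = call \<nu> x"
  shows "\<mu> = \<nu>"
proof -
  interpret A: bounded_law \<mu> c h by fact
  interpret B: bounded_law \<nu> c h by fact
  define e where "e n = 1 / real (Suc n)" for n
  have e: "e \<longlonglongrightarrow> 0" "\<And>n. 0 < e n" unfolding e_def by (rule LIMSEQ_Suc[OF lim_const_over_n]) auto
  have "measure \<mu> {x<..} = measure \<nu> {x<..}" for x
    using LIMSEQ_unique[OF A.call_difference_limit[OF e, of x]] B.call_difference_limit[OF e, of x] eq by simp
  note m = this
  have "cdf \<mu> x = cdf \<nu> x" for x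
  proof -
    have c: "{..x} = UNIV - {x<..}" by auto
    have "cdf \<mu> x = 1 - measure \<mu> {x<..}" unfolding cdf_def c using A.D.prob_compl[of "{x<..}"] by simp
    moreover have "cdf \<nu> x = 1 - measure \<nu> {x<..}" unfolding cdf_def c using B.D.prob_compl[of "{x<..}"] by simp
    ultimately show ?thesis using m by simp
  qed
  then show ?thesis by (intro cdf_unique) (auto intro: A.rd B.rd)
qed

text \<open>
  The interval \<open>[c, h]\<close> is the convex hull of the support: on its interior both potentials are positive.
\<close>

locale target = bounded_law +
  assumes call_pos: "x < h \<Longrightarrow> 0 < call \<mu> x" and put_pos: "c < x \<Longrightarrow> 0 < put \<mu> x"
begin

lemma reflect_target: "target (distr \<mu> borel uminus) (- h) (- c)"
proof -
  interpret R: bounded_law "distr \<mu> borel uminus" "- h" "- c" by (rule reflect)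
  show ?thesis
    by unfold_locales (use call_pos put_pos in \<open>auto simp: call_reflect put_reflect\<close>)
qed

lemma upper_end_eq: "upper_end \<mu> = ereal h"
  unfolding upper_end_def
proof (rule Sup_eqI)
  fix y assume "y \<in> ereal ` {x. 0 < call \<mu> x}"
  then obtain x where x: "y = ereal x" "0 < call \<mu> x" by auto
  then show "y \<le> ereal h" using call_zero[of x] by (cases "h \<le> x") auto
next
  fix y assume y: "\<And>z. z \<in> ereal ` {x. 0 < call \<mu> x} \<Longrightarrow> z \<le> y"
  show "ereal h \<le> y"
  proof (rule ccontr)
    assume "\<not> ereal h \<le> y"
    then obtain r where "y < ereal r" "ereal r < ereal h" using ereal_dense2[of y "ereal h"] by (auto simp: not_le)
    then show False using y[of "ereal r"] call_pos[of r] by auto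
  qed
qed

lemma lower_end_eq: "lower_end \<mu> = ereal c"
  unfolding lower_end_def
proof (rule Inf_eqI)
  fix y assume "y \<in> ereal ` {x. 0 < put \<mu> x}"
  then obtain x where x: "y = ereal x" "0 < put \<mu> x" by auto
  then show "ereal c \<le> y" using put_zero[of x] by (cases "x \<le> c") auto
next
  fix y assume y: "\<And>z. z \<in> ereal ` {x. 0 < put \<mu> x} \<Longrightarrow> y \<le> z"
  show "y \<le> ereal c"
  proof (rule ccontr)
    assume "\<not> y \<le> ereal c"
    then obtain r where "ereal c < ereal r" "ereal r < y" using ereal_dense2[of "ereal c" y] by (auto simp: not_le)
    then show False using y[of "ereal r"] put_pos[of r] by auto
  qed
qed

end

lemma support_conc:
  fixes \<mu> :: "real measure"
  assumes s: "sets \<mu> = sets borel" and b: "bounded (measure_support \<mu>)"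
  obtains R where "AE y in \<mu>. \<bar>y\<bar> \<le> R"
proof -
  obtain R where R: "\<And>x. x \<in> measure_support \<mu> \<Longrightarrow> \<bar>x\<bar> \<le> R" using b by (auto simp: bounded_iff)
  define U where "U = {S :: real set. open S \<and> emeasure \<mu> S = 0}"
  obtain U' where U': "U' \<subseteq> U" "countable U'" "\<Union>U' = \<Union>U"
    using Lindelof[of U] by (auto simp: U_def)
  have "(\<Union>S\<in>U'. S) \<in> null_sets \<mu>"
  proof (rule null_sets_UN'[OF U'(2)])
    fix S assume "S \<in> U'"
    then have "open S" "emeasure \<mu> S = 0" using U'(1) by (auto simp: U_def)
    then show "S \<in> null_sets \<mu>" using s by (auto simp: null_sets_def)
  qed
  then have "\<Union>U' \<in> null_sets \<mu>" by simp
  moreover have "{y \<in> space \<mu>. \<not> \<bar>y\<bar> \<le> R} \<subseteq> \<Union>U'"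
  proof
    fix y assume "y \<in> {y \<in> space \<mu>. \<not> \<bar>y\<bar> \<le> R}"
    then have "y \<notin> measure_support \<mu>" using R by auto
    then obtain S where "open S" "y \<in> S" "emeasure \<mu> S = 0" by (auto simp: measure_support_def not_less)
    then show "y \<in> \<Union>U'" unfolding U'(3) by (auto simp: U_def)
  qed
  ultimately have "AE y in \<mu>. \<bar>y\<bar> \<le> R" by (rule AE_I')
  then show thesis by (rule that)
qed

lemma target_exists:
  assumes rd: "real_distribution \<mu>" and "centered \<mu>" and nz: "\<mu> \<noteq> return borel 0" and "bounded (measure_support \<mu>)"
  obtains c h where "target \<mu> c h"
proof -
  interpret D: real_distribution \<mu> by fact
  obtain R where R: "AE y in \<mu>. \<bar>y\<bar> \<le> R" using support_conc[OF D.events_eq_borel assms(4)] by auto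
  have m: "(\<integral>y. y \<partial>\<mu>) = 0" using assms(2) by (simp add: centered_def)
  have "AE y in \<mu>. - max R 1 \<le> y \<and> y \<le> max R 1" using R by eventually_elim (auto simp: abs_le_iff le_max_iff_disj)
  then interpret B: bounded_law \<mu> "- max R 1" "max R 1"
    by unfold_locales (use m in auto)
  have AEz: "AE y in \<mu>. y \<le> x" if "call \<mu> x = 0" for x
  proof -
    have "AE y in \<mu>. max (y - x) 0 = 0"
      using integral_nonneg_eq_0_iff_AE[OF B.int_call, of x] that by (simp add: call_def)
    then show ?thesis by eventually_elim (auto simp: max_def split: if_splits)
  qed
  have AEp: "AE y in \<mu>. x \<le> y" if "put \<mu> x = 0" for x
  proof -
    have "AE y in \<mu>. max (x - y) 0 = 0"
      using integral_nonneg_eq_0_iff_AE[OF B.int_put, of x] that by (simp add: put_def)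
    then show ?thesis by eventually_elim (auto simp: max_def split: if_splits)
  qed
  have c0: "0 < call \<mu> 0"
  proof (rule ccontr)
    assume "\<not> 0 < call \<mu> 0"
    then have z: "call \<mu> 0 = 0" using B.call_nonneg[of 0] by simp
    then have pz: "put \<mu> 0 = 0" using B.put_call[of 0] by simp
    have "AE y in \<mu>. y = 0" using AEz[OF z] AEp[OF pz] by eventually_elim simp
    then have "\<mu> = return borel 0"
    proof (intro measure_eqI)
      fix A assume ae: "AE y in \<mu>. y = 0" and A: "A \<in> sets \<mu>"
      have "emeasure \<mu> A = (\<integral>\<^sup>+y. indicator A y \<partial>\<mu>)" using A by simp
      also have "\<dots> = (\<integral>\<^sup>+y. indicator A 0 \<partial>\<mu>)"
        by (rule nn_integral_cong_AE) (use ae in \<open>auto elim!: eventually_mono\<close>)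
      also have "\<dots> = emeasure (return borel 0) A" using A D.emeasure_space_1 D.space_eq_univ by simp
      finally show "emeasure \<mu> A = emeasure (return borel 0) A" .
    qed auto
    then show False using nz by simp
  qed
  have fz: "\<exists>z>0. f z = 0 \<and> (\<forall>x\<ge>0. x < z \<longrightarrow> 0 < f x)"
    if "potential (max R 1) f" "0 < f 0" for f
    by (rule first_zero[of f "max R 1"]) (use potentialD[OF that(1)] that(2) in auto)
  obtain h where h: "0 < h" "call \<mu> h = 0" "\<And>x. 0 \<le> x \<Longrightarrow> x < h \<Longrightarrow> 0 < call \<mu> x"
    using fz[OF B.potential_call c0] by blast
  have pp: "potential (max R 1) (\<lambda>y. put \<mu> (- y))" using B.potential_put by simp
  have p0: "0 < put \<mu> (- 0)" using c0 B.put_call[of 0] by simp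
  obtain k where k: "0 < k" "put \<mu> (- k) = 0" "\<And>x. 0 \<le> x \<Longrightarrow> x < k \<Longrightarrow> 0 < put \<mu> (- x)"
    using fz[OF pp p0] by blast
  have "target \<mu> (- k) h"
  proof unfold_locales
    show "AE y in \<mu>. - k \<le> y \<and> y \<le> h" using AEz[OF h(2)] AEp[OF k(2)] by eventually_elim simp
    show "0 < call \<mu> x" if "x < h" for x
      using h(3)[of x] B.put_call[of x] B.put_nonneg[of x] that by (cases "0 \<le> x") auto
    show "0 < put \<mu> x" if "- k < x" for x
      using k(3)[of "- x"] B.put_call[of x] B.call_nonneg[of x] that by (cases "x \<le> 0") auto
  qed (use m h k in auto)
  then show thesis by (rule that)
qed

section \<open>The Azema--Yor barrier\<close>

text \<open>
  Extremal minimisers exist although the domain \<open>P\<close> is an open half-line, as soon as the objective is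
  larger outside some compact interval than somewhere inside.
\<close>

lemma compact_arg_min:
  fixes r :: "real \<Rightarrow> real"
  assumes c: "continuous_on {l..u} r" and lu: "l \<le> u" and P: "\<And>z. z \<in> {l..u} \<Longrightarrow> P z"
    and out: "\<And>z. P z \<Longrightarrow> z \<notin> {l..u} \<Longrightarrow> \<exists>w\<in>{l..u}. r w < r z"
  obtains a b where "is_arg_min r P a" "is_arg_min r P b" "a \<in> {l..u}" "b \<in> {l..u}"
    "\<And>z. is_arg_min r P z \<Longrightarrow> a \<le> z \<and> z \<le> b"
proof -
  obtain z0 where z0: "z0 \<in> {l..u}" "\<And>z. z \<in> {l..u} \<Longrightarrow> r z0 \<le> r z"
    using continuous_attains_inf[of "{l..u}" r] c lu by auto
  define K where "K = {z \<in> {l..u}. r z = r z0}"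
  have "closed K" unfolding K_def by (rule continuous_closed_preimage_constant) (use c in auto)
  moreover have "K = {l..u} \<inter> K" by (auto simp: K_def)
  ultimately have "compact K" by (metis compact_Icc compact_Int_closed)
  moreover have "K \<noteq> {}" using z0 by (auto simp: K_def)
  ultimately obtain a b where ab: "a \<in> K" "\<And>z. z \<in> K \<Longrightarrow> a \<le> z" "b \<in> K" "\<And>z. z \<in> K \<Longrightarrow> z \<le> b"
    using compact_attains_inf compact_attains_sup by metis
  have iff: "is_arg_min r P z \<longleftrightarrow> z \<in> K" for z
  proof
    assume m: "is_arg_min r P z"
    then have "z \<in> {l..u}" using out[of z] P unfolding is_arg_min_def by blast
    moreover have "r z = r z0"
      using m z0 \<open>z \<in> {l..u}\<close> P[OF z0(1)] unfolding is_arg_min_def by (meson antisym not_less)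
    ultimately show "z \<in> K" by (simp add: K_def)
  next
    assume z: "z \<in> K"
    have "r z0 \<le> r y" if Py: "P y" for y
    proof (cases "y \<in> {l..u}")
      case False
      then obtain w where w: "w \<in> {l..u}" "r w < r y" using out[OF Py] by blast
      then show ?thesis using z0(2)[OF w(1)] by simp
    qed (rule z0(2))
    then show "is_arg_min r P z" using z P by (auto simp: is_arg_min_def K_def not_less)
  qed
  show thesis by (rule that[of a b]) (use ab iff in \<open>auto simp: K_def\<close>)
qed

context target begin

text \<open>
  The barrier as a real function; its values are finite because the support is bounded.
\<close>

definition beta :: "real \<Rightarrow> real" where
  "beta s = (if h \<le> s then s else if s = 0 then c
     else (GREATEST y. is_arg_min (\<lambda>y. call \<mu> y / (s - y)) (\<lambda>y. y < s) y))"

lemma AY_beta_eq: "AY_beta \<mu> s = ereal (beta s)"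
  by (auto simp: AY_beta_def beta_def upper_end_eq lower_end_eq)

lemma call_lower: "x \<le> c \<Longrightarrow> call \<mu> x = - x"
  using put_call[of x] put_zero[of x] by simp

lemma call_above: "c < x \<Longrightarrow> - x < call \<mu> x"
  using put_call[of x] put_pos[of x] by simp

text \<open>
  Close to \<open>s\<close> the quotient is large because \<open>C (s) > 0\<close>, and on the left of \<open>c\<close> it is larger than at \<open>c\<close>; so all
  minimisers lie in a compact interval.
\<close>

lemma beta_arg_min:
  assumes s: "0 < s" "s < h"
  shows "is_arg_min (\<lambda>y. call \<mu> y / (s - y)) (\<lambda>y. y < s) (beta s)" "c \<le> beta s" "beta s < s"
    "\<And>z. is_arg_min (\<lambda>y. call \<mu> y / (s - y)) (\<lambda>y. y < s) z \<Longrightarrow> z \<le> beta s"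
proof -
  let ?r = "\<lambda>y. call \<mu> y / (s - y)"
  \<comment> \<open>closer than \<open>d\<close> to \<open>s\<close> the quotient exceeds its value \<open>C (0) / s\<close> at \<open>0\<close>\<close>
  define d where "d = call \<mu> s * s / call \<mu> 0"
  have p: "0 < call \<mu> s" "0 < call \<mu> 0" "call \<mu> s \<le> call \<mu> 0"
    using call_pos h0 s call_antimono[of 0 s] by auto
  have d: "0 < d" "d \<le> s" using p s by (auto simp: d_def pos_divide_le_eq mult.commute mult_left_mono)
  obtain a b where ab: "is_arg_min ?r (\<lambda>y. y < s) a" "is_arg_min ?r (\<lambda>y. y < s) b" "b \<in> {c..s - d}"
    "\<And>z. is_arg_min ?r (\<lambda>y. y < s) z \<Longrightarrow> a \<le> z \<and> z \<le> b"
  proof (rule compact_arg_min[of c "s - d" ?r "\<lambda>y. y < s"])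
    show "continuous_on {c..s - d} ?r"
      by (intro continuous_intros continuous_on_subset[OF call_continuous]) (use d in auto)
    show "c \<le> s - d" using d c0 by simp
    show "z < s" if "z \<in> {c..s - d}" for z using that d by simp
    fix z assume z: "z < s" "z \<notin> {c..s - d}"
    show "\<exists>w\<in>{c..s - d}. ?r w < ?r z"
    proof (cases "z < c")
      case True
      have "- c / (s - c) < - z / (s - z)"
      proof -
        have "- c * (s - z) < - z * (s - c)" using True s c0 by (simp add: algebra_simps)
        then show ?thesis using True s c0 z by (simp add: pos_divide_less_eq pos_less_divide_eq)
      qed
      then show ?thesis using True d c0 by (intro bexI[of _ c]) (auto simp: call_lower)
    next
      case False
      then have zd: "s - z < d" using z by auto
      have "call \<mu> 0 / s = call \<mu> s / d" using p s by (simp add: d_def)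
      also have "\<dots> < call \<mu> s / (s - z)" using zd z p by (intro divide_strict_left_mono) auto
      also have "\<dots> \<le> call \<mu> z / (s - z)" using z call_antimono[of z s] by (intro divide_right_mono) auto
      finally show ?thesis using d c0 by (intro bexI[of _ 0]) auto
    qed
  qed (rule that)
  have "(GREATEST y. is_arg_min ?r (\<lambda>y. y < s) y) = b"
    by (rule Greatest_equality) (use ab in auto)
  then have "beta s = b" using s by (simp add: beta_def)
  then show "is_arg_min ?r (\<lambda>y. y < s) (beta s)" "c \<le> beta s" "beta s < s"
    "\<And>z. is_arg_min ?r (\<lambda>y. y < s) z \<Longrightarrow> z \<le> beta s"
    using ab d by auto
qed

lemma AY_tangency_target: "AY_tangency (call \<mu>) c h beta"
  unfolding AY_tangency_def
proof (intro ballI conjI)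
  fix s assume "s \<in> {0<..<h}"
  then have s: "0 < s" "s < h" by auto
  note B = beta_arg_min[OF s]
  show "c \<le> beta s" "beta s < s" using B by auto
  define p where "p = call \<mu> (beta s) / (s - beta s)"
  have min: "p \<le> call \<mu> y / (s - y)" if "y < s" for y
    using B(1) that unfolding is_arg_min_def p_def by (meson not_less)
  have p0: "0 \<le> p" using B call_nonneg by (simp add: p_def)
  have "p \<le> - c / (s - c)" using min[of c] c0 s call_lower[of c] by simp
  also have "\<dots> \<le> 1" using s c0 by (subst pos_divide_le_eq) auto
  finally have p1: "p \<le> 1" .
  have "(s - y) * p \<le> call \<mu> y" for y
  proof (cases "y < s")
    case True then show ?thesis using min[OF True] by (simp add: pos_le_divide_eq mult.commute)
  next
    case False
    then have "(s - y) * p \<le> 0" using p0 by (simp add: mult_nonpos_nonneg)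
    then show ?thesis using call_nonneg[of y] by simp
  qed
  moreover have "call \<mu> (beta s) = (s - beta s) * p" using B by (simp add: p_def)
  ultimately show "\<exists>p\<in>{0..1}. call \<mu> (beta s) = (s - beta s) * p \<and> (\<forall>y. (s - y) * p \<le> call \<mu> y)"
    using p0 p1 by auto
qed

lemma AY_touches:
  assumes "0 < s" "s < h"
  obtains m where "m \<in> {-1..0}" "touches UNIV (\<lambda>y. call \<mu> (- y)) 0 s (- beta s) m" "m < 0"
proof -
  obtain p where p: "p \<in> {0..1}" "call \<mu> (beta s) = (s - beta s) * p" "\<And>y. (s - y) * p \<le> call \<mu> y"
    using AY_tangency_target assms unfolding AY_tangency_def by (metis greaterThanLessThan_iff)
  have "0 < call \<mu> (beta s)" using call_pos[of "beta s"] beta_arg_min[OF assms] assms by simp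
  then have "p \<noteq> 0" using p(2) by auto
  have "0 - (s + z) * - p \<le> call \<mu> (- z)" for z using p(3)[of "- z"] by simp
  then have "touches UNIV (\<lambda>y. call \<mu> (- y)) 0 s (- beta s) (- p)"
    using p(2) by (auto simp: touches_def algebra_simps)
  then show thesis using that[of "- p"] p(1) \<open>p \<noteq> 0\<close> by auto
qed

lemma beta_le: "0 \<le> s \<Longrightarrow> beta s \<le> s"
  using beta_arg_min(3)[of s] c0 by (cases "s = 0"; cases "h \<le> s") (auto simp: beta_def not_le less_imp_le)

lemma beta_lower: "0 \<le> s \<Longrightarrow> c \<le> beta s"
  using beta_arg_min(2)[of s] c0 by (cases "s = 0"; cases "h \<le> s") (auto simp: beta_def not_le)

lemma beta_mono:
  assumes "0 \<le> s" "s \<le> t" shows "beta s \<le> beta t"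
proof -
  consider "s = t" | "h \<le> t" | "s = 0" | "0 < s" "s < t" "t < h" using assms by linarith
  then show ?thesis
  proof cases
    case 1 then show ?thesis by simp
  next
    case 2 then show ?thesis using beta_le[OF assms(1)] assms by (simp add: beta_def)
  next
    case 3 then show ?thesis using beta_lower[of t] assms h0 by (simp add: beta_def)
  next
    case 4
    obtain m where m: "touches UNIV (\<lambda>y. call \<mu> (- y)) 0 t (- beta t) m" "m < 0"
      using AY_touches[of t] 4 by auto
    obtain l where l: "touches UNIV (\<lambda>y. call \<mu> (- y)) 0 s (- beta s) l"
      using AY_touches[of s] 4 by auto
    have "- beta t \<le> - beta s"
      by (rule AY_touches_mono[OF m(1) l m(2)]) (use 4 beta_le[of s] in auto)
    then show ?thesis by simp
  qed
qed

text \<open>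
  A limit of contact points from the right is a minimiser at \<open>s\<close>, and \<open>\<beta> (s)\<close> is the largest one.  At \<open>s = 0\<close> the
  tangent has slope \<open>- 1\<close>, and contact is possible only where \<open>C (y) = - y\<close>.
\<close>

lemma beta_right_limit:
  assumes s: "0 \<le> s" "s < h" and e: "0 < e"
  shows "\<exists>t. s < t \<and> t < h \<and> beta t < beta s + e"
proof (rule ccontr)
  assume n: "\<not> ?thesis"
  obtain u where u: "\<And>n. u n < h" "\<And>n. s < u n" "u \<longlonglongrightarrow> s" using right_approach[OF s(2)] by metis
  have u0: "0 < u n" for n using u(2)[of n] s by simp
  have "\<forall>n. \<exists>m\<in>{-1..0}. touches UNIV (\<lambda>y. call \<mu> (- y)) 0 (u n) (- beta (u n)) m"
    using AY_touches[OF u0 u(1)] by metis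
  then obtain m where m: "\<And>n. m n \<in> {-1..0}" "\<And>n. touches UNIV (\<lambda>y. call \<mu> (- y)) 0 (u n) (- beta (u n)) (m n)"
    by metis
  have cont: "continuous_on UNIV (\<lambda>y. call \<mu> (- y))"
    by (rule continuous_on_compose2[OF call_continuous]) (auto intro!: continuous_intros)
  have rng: "- beta (u n) \<in> {- h..- (beta s + e)}" for n
  proof -
    have "\<not> beta (u n) < beta s + e" using n u(1,2)[of n] by blast
    then show ?thesis using beta_le[of "u n"] u0[of n] u(1)[of n] by simp
  qed
  have sb: "- u n \<le> - beta (u n)" for n using beta_le[of "u n"] u0[of n] by simp
  obtain b m0 where b: "b \<in> {- h..- (beta s + e)}" "- s \<le> b" and t: "m0 \<in> {-1..0}" "touches UNIV (\<lambda>y. call \<mu> (- y)) 0 s b m0"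
    using touches_limit[OF m(2) rng m(1) subset_UNIV tendsto_const u(3) cont sb] by blast
  have T: "call \<mu> (- b) = (s - - b) * - m0" "\<And>y. (s - y) * - m0 \<le> call \<mu> y"
  proof -
    show "call \<mu> (- b) = (s - - b) * - m0" using t by (simp add: touches_def)
    show "(s - y) * - m0 \<le> call \<mu> y" for y
      using t(2) by (auto simp: touches_def dest: spec[of _ "- y"])
  qed
  have bs: "- b \<noteq> s" using T(1) call_pos[OF s(2)] by auto
  then have bs: "- b < s" using b by simp
  have p: "beta s + e \<le> - b" using b by simp
  show False
  proof (cases "s = 0")
    case False
    have "is_arg_min (\<lambda>y. call \<mu> y / (s - y)) (\<lambda>y. y < s) (- b)"
      unfolding is_arg_min_def
    proof (intro conjI notI)
      show "- b < s" by (rule bs)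
      assume "\<exists>y<s. call \<mu> y / (s - y) < call \<mu> (- b) / (s - - b)"
      then obtain y where y: "y < s" "call \<mu> y / (s - y) < call \<mu> (- b) / (s - - b)" by blast
      have "call \<mu> (- b) / (s - - b) = - m0" using T(1) bs by simp
      then show False using y T(2)[of y] by (simp add: pos_divide_less_eq mult.commute)
    qed
    then show False using beta_arg_min(4)[of s "- b"] False s p e by simp
  next
    case True
    then have "beta s = c" using h0 by (simp add: beta_def)
    then have "- (- b) < call \<mu> (- b)" using call_above[of "- b"] p e by simp
    moreover have "b * - m0 \<le> b * 1" using True t(1) bs by (intro mult_left_mono) auto
    ultimately show False using T(1) True by simp
  qed
qed

text \<open>
  Monotonicity and right-continuity make the barrier upper semicontinuous; this is why the
  Azema--Yor time is attained.
\<close>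

lemma beta_usc:
  assumes s: "0 \<le> s" and e: "0 < e"
  obtains d where "0 < d" "\<And>t. 0 \<le> t \<Longrightarrow> t < s + d \<Longrightarrow> beta t < beta s + e"
proof (cases "h \<le> s")
  case True
  have "beta t < beta s + e" if "0 \<le> t" "t < s + e" for t
    using beta_le[OF that(1)] that True by (simp add: beta_def)
  then show thesis using that e by blast
next
  case False
  then obtain t where t: "s < t" "t < h" "beta t < beta s + e" using beta_right_limit[OF s _ e] by auto
  have "beta u < beta s + e" if "0 \<le> u" "u < s + (t - s)" for u
    using beta_mono[of u t] that t by simp
  then show thesis using that[of "t - s"] t by simp
qed

lemma beta_near_lower: assumes "c < x" shows "\<exists>s. 0 < s \<and> s < h \<and> beta s < x"
  using beta_right_limit[of 0 "x - c"] assms h0 by (auto simp: beta_def)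

text \<open>
  \<open>AY_comparison\<close> in both directions.  Its hypotheses on the strict positivity of the potentials of \<open>\<rho>\<close>
  follow from the tangents as well, because \<open>\<beta> (s)\<close> comes arbitrarily close to \<open>c\<close>.
\<close>

lemma AY_unique:
  assumes \<rho>: "bounded_law \<rho> c h" and t: "AY_tangency (call \<rho>) c h beta"
  shows "\<rho> = \<mu>"
proof (rule law_eqI[OF \<rho> bounded_law_axioms])
  interpret R: bounded_law \<rho> c h by fact
  have pr: "0 < put \<rho> x" if x: "c < x" for x
  proof (rule ccontr)
    assume "\<not> 0 < put \<rho> x"
    then have z: "put \<rho> x = 0" using R.put_nonneg[of x] by simp
    obtain s where s: "0 < s" "s < h" "beta s < x" using beta_near_lower[OF x] by blast
    obtain p where p: "p \<in> {0..1}" "call \<rho> (beta s) = (s - beta s) * p" "\<And>y. (s - y) * p \<le> call \<rho> y"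
      using t s unfolding AY_tangency_def by (metis greaterThanLessThan_iff)
    have "put \<rho> (beta s) = 0" using R.put_mono[of "beta s" x] R.put_nonneg[of "beta s"] z s by simp
    then have e1: "- beta s = (s - beta s) * p" using R.put_call[of "beta s"] p(2) by simp
    have e2: "(s - x) * p \<le> - x" using R.put_call[of x] p(3)[of x] z by simp
    have "p \<noteq> 1" using e1 s by auto
    then have p1: "p < 1" using p(1) by simp
    have "(x - beta s) * (1 - p) \<le> 0" using e1 e2 by (simp add: algebra_simps)
    then show False using s p1 by (simp add: mult_le_0_iff)
  qed
  have c0': "0 < call \<rho> 0" using pr[of 0] c0 R.put_call[of 0] by simp
  note P = R.AY_potential_call AY_potential_call
  have cp: "0 < call \<rho> x" if "x < h" for x
    by (rule AY_positivity[OF P t AY_tangency_target call_pos h0 c0' that])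
  have "- x < call \<rho> x" if "c < x" for x using pr[OF that] R.put_call[of x] by simp
  then have "call \<mu> x \<le> call \<rho> x" for x
    by (intro AY_comparison[OF P(2,1) AY_tangency_target t cp _ c0 h0])
  moreover have "call \<rho> x \<le> call \<mu> x" for x
    by (intro AY_comparison[OF P t AY_tangency_target call_pos call_above c0 h0])
  ultimately show "call \<rho> x = call \<mu> x" for x by (simp add: antisym)
qed

end

locale skorokhod = brownian M \<F> W + target \<mu> c h
  for M :: "'a measure" and \<F> W \<mu> c h
begin

lemma sup_usc:
  assumes g: "continuous_path \<omega>" and u: "0 \<le> u" and d: "0 < d"
  obtains e where "0 < e" "\<And>r. 0 \<le> r \<Longrightarrow> r < u + e \<Longrightarrow> running_sup W r \<omega> < running_sup W u \<omega> + d"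
proof -
  have "continuous_on {0..} (\<lambda>t. W t \<omega>)" using g by (simp add: continuous_path_def)
  then obtain e where e: "0 < e" "\<And>v. v \<in> {0..} \<Longrightarrow> dist v u < e \<Longrightarrow> dist (W v \<omega>) (W u \<omega>) < d"
    using u d unfolding continuous_on_iff by (metis atLeast_iff)
  have "running_sup W r \<omega> < running_sup W u \<omega> + d" if r: "0 \<le> r" "r < u + e" for r
  proof -
    obtain v where v: "0 \<le> v" "v \<le> r" "W v \<omega> = running_sup W r \<omega>" using sup_attained[OF g r(1)] by metis
    show ?thesis
    proof (cases "v \<le> u")
      case True then show ?thesis using sup_upper[OF g v(1) True] v d by simp
    next
      case False
      then have "dist v u < e" using v r by (simp add: dist_real_def)
      then have "W v \<omega> < W u \<omega> + d" using e(2)[of v] v by (simp add: dist_real_def abs_less_iff)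
      then show ?thesis using v sup_upper[OF g u order_refl] by simp
    qed
  qed
  then show thesis using that e by blast
qed

text \<open>
  The running supremum is nearly constant to the right of \<open>u\<close> and not larger to the left, so upper
  semicontinuity of the barrier applies along any sequence of times.
\<close>

lemma AY_closed:
  assumes g: "continuous_path \<omega>" and r: "\<And>n::nat. 0 \<le> r n" "r \<longlonglongrightarrow> u" and u: "0 \<le> u"
    and le: "\<And>n. W (r n) \<omega> \<le> beta (running_sup W (r n) \<omega>) + e n" and e: "e \<longlonglongrightarrow> 0"
  shows "W u \<omega> \<le> beta (running_sup W u \<omega>)"
proof (rule field_le_epsilon)
  fix \<epsilon> :: real assume \<epsilon>: "0 < \<epsilon>"
  obtain d where d: "0 < d" "\<And>t. 0 \<le> t \<Longrightarrow> t < running_sup W u \<omega> + d \<Longrightarrow> beta t < beta (running_sup W u \<omega>) + \<epsilon>"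
    using beta_usc[OF sup_nonneg[OF g u] \<epsilon>] by metis
  obtain \<delta> where \<delta>: "0 < \<delta>" "\<And>r. 0 \<le> r \<Longrightarrow> r < u + \<delta> \<Longrightarrow> running_sup W r \<omega> < running_sup W u \<omega> + d"
    using sup_usc[OF g u d(1)] by metis
  have "(\<lambda>n. W (r n) \<omega>) \<longlonglongrightarrow> W u \<omega>" by (rule path_LIMSEQ[OF g u r(2,1)])
  moreover have "(\<lambda>n. beta (running_sup W u \<omega>) + \<epsilon> + e n) \<longlonglongrightarrow> beta (running_sup W u \<omega>) + \<epsilon> + 0"
    by (intro tendsto_intros e)
  moreover have "\<forall>\<^sub>F n in sequentially. W (r n) \<omega> \<le> beta (running_sup W u \<omega>) + \<epsilon> + e n"
  proof -
    have "\<forall>\<^sub>F n in sequentially. r n < u + \<delta>" using order_tendstoD(2)[OF r(2)] \<delta> by simp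
    then show ?thesis
    proof eventually_elim
      case (elim n)
      have "beta (running_sup W (r n) \<omega>) < beta (running_sup W u \<omega>) + \<epsilon>"
        by (rule d(2)) (use \<delta>(2)[OF r(1) elim] sup_nonneg[OF g r(1)] in auto)
      then show ?case using le[of n] by simp
    qed
  qed
  ultimately show "W u \<omega> \<le> beta (running_sup W u \<omega>) + \<epsilon>"
    using tendsto_le[OF sequentially_bot] by fastforce
qed

definition AY_set :: "'a \<Rightarrow> real set" where
  "AY_set \<omega> = {u. 0 \<le> u \<and> W u \<omega> \<le> beta (running_sup W u \<omega>)}"

lemma tau_AY_eq: "tau_AY \<mu> W = (\<lambda>\<omega>. Inf (ennreal ` AY_set \<omega>))"
  by (auto simp: tau_AY_def AY_beta_eq AY_set_def)

lemma AY_set_closed: assumes g: "continuous_path \<omega>" shows "closed (AY_set \<omega>)"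
  unfolding closed_sequential_limits
proof (intro allI impI)
  fix r u assume *: "(\<forall>n. r n \<in> AY_set \<omega>) \<and> r \<longlonglongrightarrow> u"
  then have r: "\<And>n. 0 \<le> r n" "r \<longlonglongrightarrow> u" "\<And>n. W (r n) \<omega> \<le> beta (running_sup W (r n) \<omega>) + 0"
    by (auto simp: AY_set_def)
  have u: "0 \<le> u" using LIMSEQ_le_const[OF r(2)] r(1) by blast
  show "u \<in> AY_set \<omega>" using AY_closed[OF g r(1,2) u r(3) tendsto_const] u by (simp add: AY_set_def)
qed

lemma beta_measurable: "(\<lambda>x. beta (max x 0)) \<in> borel_measurable borel"
  by (rule borel_measurable_mono) (auto simp: mono_def intro!: beta_mono)

text \<open>
  From left to right: immediately after \<open>u\<close> the path is still close to \<open>W u\<close>, whereas the barrier cannot have decreased.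
  From right to left: compactness and \<open>AY_closed\<close>.  The maximum with \<open>0\<close> only serves
  measurability, as \<open>\<beta>\<close> is monotone on \<open>[0, \<infinity>)\<close>.
\<close>

lemma AY_set_rational:
  assumes g: "continuous_path \<omega>" and q: "0 \<le> q" "q \<in> \<rat>"
  shows "(\<exists>u\<in>AY_set \<omega>. u \<le> q) \<longleftrightarrow>
     (\<forall>n::nat. \<exists>r\<in>\<rat> \<inter> {0..q}. W r \<omega> < beta (max (running_sup W r \<omega>) 0) + 1 / Suc n)"
proof
  interpret N: brownian M \<F> "\<lambda>t \<omega>. - W t \<omega>" by (rule neg_brownian)
  assume "\<exists>u\<in>AY_set \<omega>. u \<le> q"
  then obtain u where u: "0 \<le> u" "W u \<omega> \<le> beta (running_sup W u \<omega>)" "u \<le> q" by (auto simp: AY_set_def)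
  show "\<forall>n::nat. \<exists>r\<in>\<rat> \<inter> {0..q}. W r \<omega> < beta (max (running_sup W r \<omega>) 0) + 1 / Suc n"
  proof
    fix n :: nat
    have 1: "W u \<omega> < W u \<omega> + 1 / Suc n" by simp
    obtain r where r: "r \<in> \<rat>" "u \<le> r" "r \<le> q" "W r \<omega> < W u \<omega> + 1 / Suc n"
    proof (cases "u = q")
      case True then show ?thesis using that[of q] q by simp
    next
      case False
      have Ng: "N.continuous_path \<omega>" using g by (auto simp: continuous_path_def N.continuous_path_def intro!: continuous_on_minus)
      obtain r where "r \<in> \<rat>" "u < r" "r < q" "- (W u \<omega> + 1 / Suc n) < - W r \<omega>"
        using N.path_rational_above[OF Ng u(1), of q "- (W u \<omega> + 1 / Suc n)"] u False 1 by auto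
      then show ?thesis using that[of r] by simp
    qed
    have "beta (running_sup W u \<omega>) \<le> beta (running_sup W r \<omega>)"
      using beta_mono sup_nonneg[OF g u(1)] sup_mono[OF g u(1) r(2)] by blast
    moreover have "max (running_sup W r \<omega>) 0 = running_sup W r \<omega>" using sup_nonneg[OF g, of r] u r by simp
    ultimately show "\<exists>r\<in>\<rat> \<inter> {0..q}. W r \<omega> < beta (max (running_sup W r \<omega>) 0) + 1 / Suc n"
      using r u by (intro bexI[of _ r]) auto
  qed
next
  assume "\<forall>n::nat. \<exists>r\<in>\<rat> \<inter> {0..q}. W r \<omega> < beta (max (running_sup W r \<omega>) 0) + 1 / Suc n"
  then obtain r where r: "\<And>n::nat. r n \<in> {0..q}" "\<And>n. W (r n) \<omega> < beta (max (running_sup W (r n) \<omega>) 0) + 1 / Suc n"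
    by (metis IntD2)
  have "seq_compact {0..q}" by (simp add: compact_imp_seq_compact)
  then obtain u k where u: "u \<in> {0..q}" "strict_mono (k :: nat \<Rightarrow> nat)" "(r \<circ> k) \<longlonglongrightarrow> u"
    using r(1) by (metis seq_compactE)
  have r0: "0 \<le> (r \<circ> k) n" for n using r(1)[of "k n"] by simp
  have "W u \<omega> \<le> beta (running_sup W u \<omega>)"
  proof (rule AY_closed[OF g r0 u(3)])
    show "W ((r \<circ> k) n) \<omega> \<le> beta (running_sup W ((r \<circ> k) n) \<omega>) + ((\<lambda>n. 1 / Suc n) \<circ> k) n" for n
      using r(2)[of "k n"] sup_nonneg[OF g r0, of n] by (simp add: max_absorb1 less_imp_le)
    show "((\<lambda>n. 1 / real (Suc n)) \<circ> k) \<longlonglongrightarrow> 0"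
      by (rule LIMSEQ_subseq_LIMSEQ[OF LIMSEQ_Suc[OF lim_const_over_n] u(2)])
  qed (use u in auto)
  then show "\<exists>u\<in>AY_set \<omega>. u \<le> q" using u by (auto simp: AY_set_def)
qed

lemma tau_AY_stopping_time: "stopping_time \<F> (tau_AY \<mu> W)"
  unfolding tau_AY_eq
proof (rule hitting_stopping_time)
  fix t :: real assume t: "0 < t"
  define A where "A = (\<Union>q\<in>\<rat> \<inter> {0..<t}. \<Inter>n::nat. \<Union>r\<in>\<rat> \<inter> {0..q}.
      {\<omega>\<in>space M. W r \<omega> < beta (max (running_sup W r \<omega>) 0) + 1 / Suc n})"
  show "{\<omega> \<in> space M. \<exists>u\<in>AY_set \<omega>. u < t} \<in> sets (\<F> (ennreal t))"
  proof (rule F_AE)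
    have "{\<omega>\<in>space M. W r \<omega> < beta (max (running_sup W r \<omega>) 0) + 1 / Suc n} \<in> sets (\<F> (ennreal t))"
      if "0 \<le> r" "r < t" for r and n :: nat
    proof -
      have 1: "ennreal r \<le> ennreal t" using that by (simp add: ennreal_leI)
      have [measurable]: "W r \<in> borel_measurable (\<F> (ennreal t))" "running_sup W r \<in> borel_measurable (\<F> (ennreal t))"
        using measurable_F_mono[OF W_measurable_F[OF that(1)] 1] measurable_F_mono[OF sup_measurable_F[OF that(1)] 1] .
      have [measurable]: "(\<lambda>\<omega>. beta (max (running_sup W r \<omega>) 0)) \<in> borel_measurable (\<F> (ennreal t))"
        using measurable_compose[OF _ beta_measurable, of "running_sup W r"] by measurable
      have "{\<omega>\<in>space (\<F> (ennreal t)). W r \<omega> < beta (max (running_sup W r \<omega>) 0) + 1 / Suc n} \<in> sets (\<F> (ennreal t))"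
        by measurable
      then show ?thesis by (simp add: space_F)
    qed
    then have "(\<Union>r\<in>\<rat> \<inter> {0..q}. {\<omega>\<in>space M. W r \<omega> < beta (max (running_sup W r \<omega>) 0) + 1 / Suc n})
         \<in> sets (\<F> (ennreal t))" if "q < t" for q and n :: nat
      using countable_rat that by (intro sets.countable_UN') auto
    then have "(\<Inter>n::nat. \<Union>r\<in>\<rat> \<inter> {0..q}. {\<omega>\<in>space M. W r \<omega> < beta (max (running_sup W r \<omega>) 0) + 1 / Suc n})
         \<in> sets (\<F> (ennreal t))" if "q < t" for q
      using that by (intro sets.countable_INT) auto
    then show "A \<in> sets (\<F> (ennreal t))" unfolding A_def
      using countable_rat by (intro sets.countable_UN') auto
    show "AE \<omega> in M. (\<omega> \<in> A) = (\<omega> \<in> {\<omega> \<in> space M. \<exists>u\<in>AY_set \<omega>. u < t})"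
      using AE_continuous_path AE_space
    proof eventually_elim
      fix \<omega> assume g: "continuous_path \<omega>" and sp: "\<omega> \<in> space M"
      have "\<omega> \<in> A \<longleftrightarrow> (\<exists>q\<in>\<rat> \<inter> {0..<t}. \<forall>n::nat. \<exists>r\<in>\<rat> \<inter> {0..q}. W r \<omega> < beta (max (running_sup W r \<omega>) 0) + 1 / Suc n)"
        using sp by (auto simp: A_def)
      also have "\<dots> \<longleftrightarrow> (\<exists>q\<in>\<rat> \<inter> {0..<t}. \<exists>u\<in>AY_set \<omega>. u \<le> q)"
        by (intro bex_cong refl AY_set_rational[OF g, symmetric]) auto
      also have "\<dots> \<longleftrightarrow> (\<exists>u\<in>AY_set \<omega>. u < t)"
      proof
        assume "\<exists>u\<in>AY_set \<omega>. u < t"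
        then obtain u where u: "u \<in> AY_set \<omega>" "u < t" by blast
        then obtain q where "q \<in> \<rat>" "u < q" "q < t" using Rats_dense_in_real by blast
        then show "\<exists>q\<in>\<rat> \<inter> {0..<t}. \<exists>u\<in>AY_set \<omega>. u \<le> q"
        proof (intro bexI)
          show "u \<le> q" "u \<in> AY_set \<omega>" "q \<in> \<rat> \<inter> {0..<t}"
            using u \<open>q \<in> \<rat>\<close> \<open>u < q\<close> \<open>q < t\<close> by (auto simp: AY_set_def)
        qed
      next
        assume "\<exists>q\<in>\<rat> \<inter> {0..<t}. \<exists>u\<in>AY_set \<omega>. u \<le> q"
        then obtain q u where "u \<in> AY_set \<omega>" "u \<le> q" "q < t" by auto
        then show "\<exists>u\<in>AY_set \<omega>. u < t" by (intro bexI[of _ u]) auto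
      qed
      finally show "(\<omega> \<in> A) = (\<omega> \<in> {\<omega> \<in> space M. \<exists>u\<in>AY_set \<omega>. u < t})" using sp by simp
    qed
  qed auto
qed (auto simp: AY_set_def)

end

section \<open>The Azema--Yor embedding\<close>

context skorokhod begin

lemma bounded_until_law:
  assumes \<tau>: "stopping_time \<F> \<tau>" "AE \<omega> in M. \<tau> \<omega> < \<top>"
    and rng: "AE \<omega> in M. \<forall>t\<ge>0. c \<le> stopped_process W \<tau> t \<omega> \<and> stopped_process W \<tau> t \<omega> \<le> h"
  shows "AE \<omega> in M. c \<le> at_time W \<tau> \<omega> \<and> at_time W \<tau> \<omega> \<le> h"
    "bounded_law (distr M borel (at_time W \<tau>)) c h"
proof -
  note B = bounded_until_at_time[OF bounded_until_of_range[OF \<tau> rng]]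
  note [measurable] = B(1)
  show r: "AE \<omega> in M. c \<le> at_time W \<tau> \<omega> \<and> at_time W \<tau> \<omega> \<le> h"
    using \<tau>(2) rng
  proof eventually_elim
    fix \<omega> assume *: "\<tau> \<omega> < \<top>" "\<forall>t\<ge>0. c \<le> stopped_process W \<tau> t \<omega> \<and> stopped_process W \<tau> t \<omega> \<le> h"
    obtain n where "stopped_process W \<tau> (real n) \<omega> = at_time W \<tau> \<omega>"
      using stopped_process_eventually[where \<tau>=\<tau> and \<omega>=\<omega>, OF *(1)] by (auto simp: eventually_sequentially)
    then show "c \<le> at_time W \<tau> \<omega> \<and> at_time W \<tau> \<omega> \<le> h" using *(2) by (metis of_nat_0_le_iff)
  qed
  show "bounded_law (distr M borel (at_time W \<tau>)) c h"
  proof (rule bounded_law.intro)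
    show "real_distribution (distr M borel (at_time W \<tau>))" by (rule real_distribution_distr) measurable
    show "AE y in distr M borel (at_time W \<tau>). c \<le> y \<and> y \<le> h" using r by (subst AE_distr_iff) auto
    show "(\<integral>y. y \<partial>distr M borel (at_time W \<tau>)) = 0" using B by (subst integral_distr) auto
  qed (use c0 h0 in auto)
qed

lemma ui_embeddings_I:
  assumes \<tau>: "stopping_time \<F> \<tau>" "AE \<omega> in M. \<tau> \<omega> < \<top>"
    and rng: "AE \<omega> in M. \<forall>t\<ge>0. c \<le> stopped_process W \<tau> t \<omega> \<and> stopped_process W \<tau> t \<omega> \<le> h"
    and law: "distr M borel (at_time W \<tau>) = \<mu>"
  shows "\<tau> \<in> ui_embeddings M \<F> W \<mu>"
proof -
  have m: "stopped_process W \<tau> t \<in> borel_measurable M" if "0 \<le> t" for t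
    using stopped_process_measurable[OF \<tau>(1) that] .
  have "\<forall>\<^sub>F K in at_top. (SUP i\<in>{0..}. \<integral>\<^sup>+\<omega>. ennreal \<bar>stopped_process W \<tau> i \<omega>\<bar> * indicator {\<omega>. K < \<bar>stopped_process W \<tau> i \<omega>\<bar>} \<omega> \<partial>M) = 0"
    using eventually_ge_at_top[of "max (- c) h"]
  proof eventually_elim
    fix K :: real assume K: "max (- c) h \<le> K"
    have "(\<integral>\<^sup>+\<omega>. ennreal \<bar>stopped_process W \<tau> i \<omega>\<bar> * indicator {\<omega>. K < \<bar>stopped_process W \<tau> i \<omega>\<bar>} \<omega> \<partial>M) = 0"
      if i: "i \<in> {0..}" for i
    proof -
      have "AE \<omega> in M. ennreal \<bar>stopped_process W \<tau> i \<omega>\<bar> * indicator {\<omega>. K < \<bar>stopped_process W \<tau> i \<omega>\<bar>} \<omega> = 0"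
        using rng
      proof eventually_elim
        fix \<omega> assume "\<forall>t\<ge>0. c \<le> stopped_process W \<tau> t \<omega> \<and> stopped_process W \<tau> t \<omega> \<le> h"
        then have "c \<le> stopped_process W \<tau> i \<omega>" "stopped_process W \<tau> i \<omega> \<le> h" using i by auto
        then have "\<not> K < \<bar>stopped_process W \<tau> i \<omega>\<bar>" using K by auto
        then show "ennreal \<bar>stopped_process W \<tau> i \<omega>\<bar> * indicator {\<omega>. K < \<bar>stopped_process W \<tau> i \<omega>\<bar>} \<omega> = 0" by simp
      qed
      then show ?thesis by (subst nn_integral_cong_AE[where v="\<lambda>_. 0"]) auto
    qed
    then have "(SUP i\<in>{0..}. \<integral>\<^sup>+\<omega>. ennreal \<bar>stopped_process W \<tau> i \<omega>\<bar> * indicator {\<omega>. K < \<bar>stopped_process W \<tau> i \<omega>\<bar>} \<omega> \<partial>M)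
        = (SUP i\<in>{0::real..}. 0)" by (intro SUP_cong) auto
    then show "(SUP i\<in>{0..}. \<integral>\<^sup>+\<omega>. ennreal \<bar>stopped_process W \<tau> i \<omega>\<bar> * indicator {\<omega>. K < \<bar>stopped_process W \<tau> i \<omega>\<bar>} \<omega> \<partial>M) = 0"
      by simp
  qed
  then have "uniformly_integrable M {0..} (stopped_process W \<tau>)"
    unfolding uniformly_integrable_def using m by (auto intro: tendsto_eventually)
  then show ?thesis
    using \<tau> law at_time_measurable[OF \<tau>] by (simp add: ui_embeddings_def embeddings_def)
qed

lemma doob_law:
  assumes \<tau>: "stopping_time \<F> \<tau>" "AE \<omega> in M. \<tau> \<omega> < \<top>"
    and rng: "AE \<omega> in M. \<forall>t\<ge>0. c \<le> stopped_process W \<tau> t \<omega> \<and> stopped_process W \<tau> t \<omega> \<le> h"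
    and s: "0 < s"
  shows "expectation (\<lambda>\<omega>. (at_time W \<tau> \<omega> - s) * indicator {\<omega>\<in>space M. s \<le> at_time (running_sup W) \<tau> \<omega>} \<omega>) = 0"
  by (rule doob_identity[OF bounded_until_of_range[OF \<tau> rng] s])

lemma path_left_limit:
  assumes g: "continuous_path \<omega>" and T: "0 \<le> v" "v < T" and b: "\<And>x. v \<le> x \<Longrightarrow> x < T \<Longrightarrow> lo \<le> W x \<omega>"
  shows "lo \<le> W T \<omega>"
proof -
  obtain u where u: "\<And>n. v < u n" "\<And>n. u n < T" "u \<longlonglongrightarrow> T" using left_approach[OF T(2)] by metis
  have "(\<lambda>n. W (u n) \<omega>) \<longlonglongrightarrow> W T \<omega>"
    by (rule path_LIMSEQ[OF g _ u(3)]) (use T u(1) in \<open>auto intro: less_imp_le le_less_trans\<close>)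
  then show ?thesis by (rule LIMSEQ_le_const) (use b u less_imp_le in blast)
qed

lemma tau_AY_attained:
  assumes g: "continuous_path \<omega>" and f: "tau_AY \<mu> W \<omega> < \<top>"
  obtains T where "0 \<le> T" "tau_AY \<mu> W \<omega> = ennreal T" "W T \<omega> \<le> beta (running_sup W T \<omega>)"
    "\<And>v. 0 \<le> v \<Longrightarrow> v < T \<Longrightarrow> beta (running_sup W v \<omega>) < W v \<omega>"
proof -
  have ne: "AY_set \<omega> \<noteq> {}"
  proof
    assume e: "AY_set \<omega> = {}"
    have "tau_AY \<mu> W \<omega> = \<top>" unfolding tau_AY_eq e by (simp only: image_empty Inf_empty)
    then show False using f by simp
  qed
  obtain T where T: "T \<in> AY_set \<omega>" "\<And>u. u \<in> AY_set \<omega> \<Longrightarrow> T \<le> u" "Inf (ennreal ` AY_set \<omega>) = ennreal T"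
    using Inf_ennreal_closed[OF AY_set_closed[OF g] _ ne] by (auto simp: AY_set_def)
  have "beta (running_sup W v \<omega>) < W v \<omega>" if "0 \<le> v" "v < T" for v
    using T(2)[of v] that by (auto simp: AY_set_def not_le[symmetric])
  then show thesis using that[of T] T by (auto simp: AY_set_def tau_AY_eq)
qed

lemma before_tau_AY:
  assumes g: "continuous_path \<omega>" and v: "0 \<le> v" "ennreal v < tau_AY \<mu> W \<omega>"
  shows "c \<le> W v \<omega>" "W v \<omega> \<le> h" "beta (running_sup W v \<omega>) < W v \<omega>"
proof -
  have "v \<notin> AY_set \<omega>"
  proof
    assume "v \<in> AY_set \<omega>"
    then have "tau_AY \<mu> W \<omega> \<le> ennreal v" unfolding tau_AY_eq by (intro Inf_lower) auto
    then show False using v by simp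
  qed
  then show b: "beta (running_sup W v \<omega>) < W v \<omega>" using v by (simp add: AY_set_def)
  show "c \<le> W v \<omega>" using b beta_lower[OF sup_nonneg[OF g v(1)]] by simp
  show "W v \<omega> \<le> h"
  proof (rule ccontr)
    assume n: "\<not> W v \<omega> \<le> h"
    then have "h \<le> running_sup W v \<omega>" using sup_upper[OF g v(1) order_refl] by simp
    then show False using b sup_upper[OF g v(1) order_refl] by (simp add: beta_def)
  qed
qed

lemma tau_AY_finite: "AE \<omega> in M. tau_AY \<mu> W \<omega> < \<top>"
proof (rule escape[OF stopping_time_measurable[OF tau_AY_stopping_time], of "max (- c) h"])
  show "AE \<omega> in M. \<forall>t\<ge>0. ennreal t < tau_AY \<mu> W \<omega> \<longrightarrow> \<bar>W t \<omega>\<bar> \<le> max (- c) h"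
    using AE_continuous_path
  proof eventually_elim
    fix \<omega> assume g: "continuous_path \<omega>"
    show "\<forall>t\<ge>0. ennreal t < tau_AY \<mu> W \<omega> \<longrightarrow> \<bar>W t \<omega>\<bar> \<le> max (- c) h"
    proof (intro allI impI)
      fix t :: real assume "0 \<le> t" "ennreal t < tau_AY \<mu> W \<omega>"
      from before_tau_AY(1,2)[OF g this] show "\<bar>W t \<omega>\<bar> \<le> max (- c) h" by auto
    qed
  qed
qed

lemma tau_AY_range:
  "AE \<omega> in M. \<forall>t\<ge>0. c \<le> stopped_process W (tau_AY \<mu> W) t \<omega> \<and> stopped_process W (tau_AY \<mu> W) t \<omega> \<le> h"
proof (rule stopped_process_range)
  show "AE \<omega> in M. \<forall>r\<in>\<rat>. 0 \<le> r \<longrightarrow> ennreal r < tau_AY \<mu> W \<omega> \<longrightarrow> c \<le> W r \<omega> \<and> W r \<omega> \<le> h"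
    using AE_continuous_path by eventually_elim (use before_tau_AY in blast)
qed (use c0 h0 in auto)

text \<open>
  If \<open>W\<close> is below its supremum \<open>S \<ge> s\<close> at the stopping time, the supremum was constant just before, and there the
  path was above \<open>\<beta> (S) \<ge> \<beta> (s)\<close>.  The second part is monotonicity of \<open>\<beta>\<close>.
\<close>

lemma tau_AY_threshold:
  "AE \<omega> in M. \<forall>s. 0 < s \<longrightarrow> s < h \<longrightarrow>
     (s \<le> at_time (running_sup W) (tau_AY \<mu> W) \<omega> \<longrightarrow> beta s \<le> at_time W (tau_AY \<mu> W) \<omega>) \<and>
     (at_time (running_sup W) (tau_AY \<mu> W) \<omega> < s \<longrightarrow> at_time W (tau_AY \<mu> W) \<omega> \<le> beta s)"
  using AE_continuous_path tau_AY_finite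
proof eventually_elim
  fix \<omega> assume g: "continuous_path \<omega>" and f: "tau_AY \<mu> W \<omega> < \<top>"
  obtain T where T: "0 \<le> T" "tau_AY \<mu> W \<omega> = ennreal T" "W T \<omega> \<le> beta (running_sup W T \<omega>)"
    "\<And>v. 0 \<le> v \<Longrightarrow> v < T \<Longrightarrow> beta (running_sup W v \<omega>) < W v \<omega>"
    using tau_AY_attained[OF g f] by metis
  have at: "at_time X (tau_AY \<mu> W) \<omega> = X T \<omega>" for X :: "real \<Rightarrow> 'a \<Rightarrow> real"
    using T by (simp add: at_time_def)
  show "\<forall>s. 0 < s \<longrightarrow> s < h \<longrightarrow>
     (s \<le> at_time (running_sup W) (tau_AY \<mu> W) \<omega> \<longrightarrow> beta s \<le> at_time W (tau_AY \<mu> W) \<omega>) \<and>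
     (at_time (running_sup W) (tau_AY \<mu> W) \<omega> < s \<longrightarrow> at_time W (tau_AY \<mu> W) \<omega> \<le> beta s)"
    unfolding at
  proof (intro allI impI conjI)
    fix s assume s: "0 < s" "s < h"
    show "W T \<omega> \<le> beta s" if "running_sup W T \<omega> < s"
      using T(3) beta_mono[OF sup_nonneg[OF g T(1)], of s] that by simp
    show "beta s \<le> W T \<omega>" if sT: "s \<le> running_sup W T \<omega>"
    proof -
      obtain v where v: "0 \<le> v" "v \<le> T" "W v \<omega> = running_sup W T \<omega>" using sup_attained[OF g T(1)] by metis
      show ?thesis
      proof (cases "v = T")
        case True then show ?thesis using v sT beta_le[of s] s by simp
      next
        case False
        show ?thesis
        proof (rule path_left_limit[OF g v(1)])
          show "v < T" using False v by simp
          fix x assume x: "v \<le> x" "x < T"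
          have "running_sup W T \<omega> \<le> running_sup W x \<omega>" using sup_upper[OF g v(1) x(1)] v by simp
          then have "beta s \<le> beta (running_sup W x \<omega>)" using sT s by (intro beta_mono) auto
          then show "beta s \<le> W x \<omega>" using T(4)[of x] x v by simp
        qed
      qed
    qed
  qed
qed

text \<open>
  The variable \<open>(W - y) 1 (S \<ge> s)\<close> is bounded by \<open>(W - y)\<^sup>+\<close>, with equality at \<open>y = \<beta> (s)\<close> by the threshold
  description; its mean is \<open>(s - y) P (S \<ge> s)\<close> by Doob's identity.
\<close>

lemma AY_tangency_law:
  assumes \<tau>: "stopping_time \<F> \<tau>" "AE \<omega> in M. \<tau> \<omega> < \<top>"
    and rng: "AE \<omega> in M. \<forall>t\<ge>0. c \<le> stopped_process W \<tau> t \<omega> \<and> stopped_process W \<tau> t \<omega> \<le> h"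
    and thr: "AE \<omega> in M. \<forall>s. 0 < s \<longrightarrow> s < h \<longrightarrow>
     (s \<le> at_time (running_sup W) \<tau> \<omega> \<longrightarrow> beta s \<le> at_time W \<tau> \<omega>) \<and>
     (at_time (running_sup W) \<tau> \<omega> < s \<longrightarrow> at_time W \<tau> \<omega> \<le> beta s)"
  shows "AY_tangency (call (distr M borel (at_time W \<tau>))) c h beta"
proof -
  let ?X = "at_time W \<tau>" and ?Y = "at_time (running_sup W) \<tau>"
  note B = bounded_until_at_time[OF bounded_until_of_range[OF \<tau> rng]]
  note [measurable] = B(1) sup_at_time_measurable[OF \<tau>]
  have call: "call (distr M borel ?X) y = expectation (\<lambda>\<omega>. max (?X \<omega> - y) 0)" for y
    unfolding call_def by (subst integral_distr) auto
  have Xi: "integrable M ?X" by (rule B(3))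
  show ?thesis unfolding AY_tangency_def
  proof (intro ballI conjI)
    fix s assume "s \<in> {0<..<h}"
    then have s: "0 < s" "s < h" by auto
    show "c \<le> beta s" "beta s < s" using beta_arg_min[OF s] by auto
    define E where "E = {\<omega>\<in>space M. s \<le> ?Y \<omega>}"
    have [measurable]: "E \<in> sets M" unfolding E_def by measurable
    have iX: "integrable M (\<lambda>\<omega>. (?X \<omega> - y) * indicator E \<omega>)" for y
      using integrable_real_mult_indicator[of E M "\<lambda>\<omega>. ?X \<omega> - y"] Xi by simp
    have iI: "integrable M (\<lambda>\<omega>. indicator E \<omega> :: real)" by (rule integrable_const_bound[of _ 1]) auto
    have iM: "integrable M (\<lambda>\<omega>. max (?X \<omega> - y) 0)" for y using Xi by (intro Bochner_Integration.integrable_max) auto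
    have e: "expectation (\<lambda>\<omega>. (?X \<omega> - y) * indicator E \<omega>) = (s - y) * prob E" for y
    proof -
      have "expectation (\<lambda>\<omega>. (?X \<omega> - y) * indicator E \<omega>)
          = expectation (\<lambda>\<omega>. (?X \<omega> - s) * indicator E \<omega> + (s - y) * indicator E \<omega>)"
        by (rule Bochner_Integration.integral_cong) (auto simp: algebra_simps)
      also have "\<dots> = expectation (\<lambda>\<omega>. (?X \<omega> - s) * indicator E \<omega>) + (s - y) * prob E"
        using iX iI by simp
      finally show ?thesis using doob_law[OF \<tau> rng s(1)] by (simp add: E_def)
    qed
    have "(s - y) * prob E \<le> call (distr M borel ?X) y" for y
      unfolding e[symmetric] call by (rule integral_mono[OF iX iM]) (auto simp: indicator_def)
    moreover have "call (distr M borel ?X) (beta s) = (s - beta s) * prob E"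
      unfolding e[symmetric] call
    proof (rule integral_cong_AE)
      show "AE \<omega> in M. max (?X \<omega> - beta s) 0 = (?X \<omega> - beta s) * indicator E \<omega>"
        using thr AE_space
      proof eventually_elim
        fix \<omega> assume *: "\<forall>s. 0 < s \<longrightarrow> s < h \<longrightarrow> (s \<le> ?Y \<omega> \<longrightarrow> beta s \<le> ?X \<omega>) \<and> (?Y \<omega> < s \<longrightarrow> ?X \<omega> \<le> beta s)"
          and sp: "\<omega> \<in> space M"
        show "max (?X \<omega> - beta s) 0 = (?X \<omega> - beta s) * indicator E \<omega>"
          using *[rule_format, OF s] sp by (cases "s \<le> ?Y \<omega>") (auto simp: E_def)
      qed
    qed measurable
    ultimately show "\<exists>p\<in>{0..1}. call (distr M borel ?X) (beta s) = (s - beta s) * p \<and> (\<forall>y. (s - y) * p \<le> call (distr M borel ?X) y)"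
      by (intro bexI[of _ "prob E"]) auto
  qed
qed

theorem tau_AY_embeds: "tau_AY \<mu> W \<in> ui_embeddings M \<F> W \<mu>"
proof (rule ui_embeddings_I[OF tau_AY_stopping_time tau_AY_finite tau_AY_range])
  show "distr M borel (at_time W (tau_AY \<mu> W)) = \<mu>"
    by (rule AY_unique[OF bounded_until_law(2)[OF tau_AY_stopping_time tau_AY_finite tau_AY_range]
       AY_tangency_law[OF tau_AY_stopping_time tau_AY_finite tau_AY_range tau_AY_threshold]])
qed

end

section \<open>The Perkins barrier\<close>

text \<open>
  The first of the two times of which \<open>\<tau>\<^sub>\<alpha>\<close> is the minimum; the second is the first one for \<open>- W\<close> and the
  reflected law.
\<close>

definition tau_lower :: "real measure \<Rightarrow> (real \<Rightarrow> 'a \<Rightarrow> real) \<Rightarrow> 'a \<Rightarrow> ennreal" where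
  "tau_lower \<mu> W \<omega> = Inf (ennreal ` {u. 0 < u \<and> ereal (W u \<omega>) \<le> perkins_alpha_plus \<mu> (running_sup W u \<omega>)})"

context target begin

definition alpha :: "real \<Rightarrow> real" where
  "alpha s = (LEAST y. is_arg_max (\<lambda>y. (call \<mu> s - put \<mu> y) / (s - y)) (\<lambda>y. y < 0) y)"

lemma perkins_alpha_plus_eq:
  "perkins_alpha_plus \<mu> s = (if 0 < s \<and> s < h then ereal (alpha s) else - \<infinity>)"
  by (simp add: perkins_alpha_plus_def alpha_def upper_end_eq)

lemma is_arg_max_min: "is_arg_max (r :: real \<Rightarrow> real) P = is_arg_min (\<lambda>y. - r y) P"
  by (auto simp: fun_eq_iff is_arg_max_def is_arg_min_def)

lemma put_continuous: "continuous_on A (put \<mu>)"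
proof -
  have "put \<mu> = (\<lambda>x. call \<mu> x + x)" using put_call by auto
  then show ?thesis using continuous_on_subset[OF call_continuous, of A] by (auto intro!: continuous_intros)
qed

text \<open>
  The quotient is negative near \<open>0\<close>, where \<open>P > C (s)\<close>, and increases up to \<open>c\<close>, where \<open>P\<close> is \<open>0\<close>; so all
  maximisers lie in a compact interval.
\<close>

lemma
  assumes s: "0 < s" "s < h"
  shows alpha_arg_max: "is_arg_max (\<lambda>y. (call \<mu> s - put \<mu> y) / (s - y)) (\<lambda>y. y < 0) (alpha s)" "c \<le> alpha s" "alpha s < 0"
    and alpha_least: "\<And>z. is_arg_max (\<lambda>y. (call \<mu> s - put \<mu> y) / (s - y)) (\<lambda>y. y < 0) z \<Longrightarrow> alpha s \<le> z"
proof -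
  let ?r = "\<lambda>y. (call \<mu> s - put \<mu> y) / (s - y)"
  have cs: "0 < call \<mu> s" using call_pos s by simp
  have c0s: "call \<mu> s < put \<mu> 0"
    using potential_strict[OF potential_call _ _ s(1)] h0 call_pos put_call[of 0] by auto
  have "\<exists>u\<ge>c. u \<le> 0 \<and> put \<mu> u = call \<mu> s"
    by (rule IVT') (use cs c0s c0 put_zero[of c] put_continuous in auto)
  then obtain u where u: "c \<le> u" "u \<le> 0" "put \<mu> u = call \<mu> s" by blast
  have u0: "u < 0" using u c0s by (cases "u = 0") auto
  have rc: "?r c = call \<mu> s / (s - c)" using put_zero[of c] by simp
  have rc0: "0 < ?r c" unfolding rc using cs s c0 by simp
  obtain a b where ab: "is_arg_min (\<lambda>y. - ?r y) (\<lambda>y. y < 0) a" "a \<in> {c..u}"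
    "\<And>z. is_arg_min (\<lambda>y. - ?r y) (\<lambda>y. y < 0) z \<Longrightarrow> a \<le> z \<and> z \<le> b"
  proof (rule compact_arg_min[of c u "\<lambda>y. - ?r y" "\<lambda>y. y < 0"])
    show "continuous_on {c..u} (\<lambda>y. - ?r y)"
      by (intro continuous_intros put_continuous) (use u s in auto)
    show "c \<le> u" by fact
    show "z < 0" if "z \<in> {c..u}" for z using that u0 by simp
    fix z :: real assume z: "z < 0" "z \<notin> {c..u}"
    have "?r z < ?r c"
    proof (cases "z < c")
      case True
      have "call \<mu> s / (s - z) < call \<mu> s / (s - c)"
        using True cs s c0 z by (intro divide_strict_left_mono) auto
      then show ?thesis unfolding rc using True put_zero[of z] by simp
    next
      case False
      then have "call \<mu> s \<le> put \<mu> z" using put_mono[of u z] u z by auto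
      then have "?r z \<le> 0" using z s by (simp add: divide_nonpos_pos)
      then show ?thesis using rc0 by simp
    qed
    then show "\<exists>w\<in>{c..u}. - ?r w < - ?r z" using u(1) by (intro bexI[of _ c]) auto
  qed (rule that)
  have "alpha s = a" unfolding alpha_def is_arg_max_min
    by (rule Least_equality) (use ab in auto)
  then show "is_arg_max ?r (\<lambda>y. y < 0) (alpha s)" "c \<le> alpha s" "alpha s < 0"
    "\<And>z. is_arg_max ?r (\<lambda>y. y < 0) z \<Longrightarrow> alpha s \<le> z"
    using ab u0 by (auto simp: is_arg_max_min)
qed

definition slope :: "real \<Rightarrow> real" where
  "slope s = (call \<mu> s - put \<mu> (alpha s)) / (s - alpha s)"

lemma slope_touches:
  assumes s: "0 < s" "s < h"
  shows "touches {0..} (\<lambda>y. put \<mu> (- y)) (call \<mu> s) s (- alpha s) (slope s)" "0 < slope s" "slope s \<le> 1"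
proof -
  note A = alpha_arg_max[OF s]
  have max: "(call \<mu> s - put \<mu> y) / (s - y) \<le> slope s" if "y < 0" for y
    using A(1) that unfolding is_arg_max_def slope_def by (meson not_less)
  have cs: "0 < call \<mu> s" using call_pos s by simp
  have "0 < call \<mu> s / (s - c)" using cs s c0 by simp
  also have "\<dots> \<le> slope s" using max[OF c0] put_zero[of c] by simp
  finally show p: "0 < slope s" .
  have "call \<mu> s \<le> call \<mu> (alpha s)" using A s by (intro call_antimono) auto
  then have "call \<mu> s - put \<mu> (alpha s) \<le> s - alpha s" using put_call[of "alpha s"] s by simp
  then show "slope s \<le> 1" using A s by (simp add: slope_def)
  have e: "put \<mu> (alpha s) = call \<mu> s - (s - alpha s) * slope s" using A s by (simp add: slope_def)
  have "call \<mu> s - (s + y) * slope s \<le> put \<mu> (- y)" if "y \<in> {0..}" for y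
  proof (cases "y = 0")
    case True
    have "call \<mu> s \<le> put \<mu> 0" using call_antimono[of 0 s] put_call[of 0] s by simp
    moreover have "0 \<le> s * slope s" using s p by simp
    ultimately show ?thesis using True by simp
  next
    case False
    then show ?thesis using max[of "- y"] that s by (simp add: pos_divide_le_eq algebra_simps)
  qed
  then show "touches {0..} (\<lambda>y. put \<mu> (- y)) (call \<mu> s) s (- alpha s) (slope s)"
    using e A by (auto simp: touches_def)
qed

lemma perkins_tangency: "tangency 1 (call \<mu>) (\<lambda>y. put \<mu> (- y)) h (- c) (\<lambda>s. - alpha s)"
  unfolding tangency_def
proof (intro ballI conjI)
  fix s assume "s \<in> {0<..<h}"
  then have s: "0 < s" "s < h" by auto
  show "- alpha s \<in> {0..- c}" using alpha_arg_max[OF s] by auto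
  show "\<exists>m\<in>{0..1}. touches {0..} (\<lambda>y. put \<mu> (- y)) (call \<mu> s) s (- alpha s) m"
    using slope_touches[OF s] by (intro bexI[of _ "slope s"]) auto
qed

lemma call_strict: "0 \<le> s \<Longrightarrow> s < t \<Longrightarrow> s < h \<Longrightarrow> call \<mu> t < call \<mu> s"
  using potential_strict[OF potential_call] call_pos by auto

lemma alpha_antimono:
  assumes "0 < s" "s \<le> t" "t < h" shows "alpha t \<le> alpha s"
proof (cases "s = t")
  case False
  have "- alpha s \<le> - alpha t"
    by (rule touches_mono[where f="call \<mu>", OF slope_touches(1)[of t] slope_touches(1)[of s]])
       (use assms False slope_touches(2)[of t] call_strict[of s t] alpha_arg_max(3)[of t] in auto)
  then show ?thesis by simp
qed simp

text \<open>
  The supporting inequality of the tangent from \<open>s\<close> at the contact point of the tangent from \<open>t\<close>.  It bounds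
  \<open>(t - s) / (s - \<alpha>\<^sup>+ (t))\<close> by increments of a bounded monotone function.
\<close>

lemma slope_decrement:
  assumes "0 < s" "s < t" "t < h" shows "(t - s) * slope t \<le> (slope s - slope t) * (s - alpha t)"
proof -
  have at: "alpha t < 0" using alpha_arg_max[of t] assms by auto
  then have "call \<mu> s - (s - alpha t) * slope s \<le> put \<mu> (alpha t)"
    using slope_touches(1)[of s] assms by (auto simp: touches_def dest!: bspec[of _ _ "- alpha t"])
  moreover have "put \<mu> (alpha t) = call \<mu> t - (t - alpha t) * slope t"
    using slope_touches(1)[of t] assms by (auto simp: touches_def)
  moreover have "call \<mu> t \<le> call \<mu> s" using call_antimono assms by auto
  ultimately show ?thesis by (simp add: algebra_simps)
qed

lemma slope_antimono:
  assumes "0 < s" "s \<le> t" "t < h" shows "slope t \<le> slope s"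
proof (cases "s = t")
  case False
  then have "0 < (t - s) * slope t" using assms slope_touches(2)[of t] by simp
  also have "\<dots> \<le> (slope s - slope t) * (s - alpha t)" using slope_decrement[of s t] assms False by simp
  finally have "0 < slope s - slope t" using alpha_arg_max(3)[of t] assms by (simp add: zero_less_mult_iff)
  then show ?thesis by simp
qed simp

end

lemma perkins_alpha_minus_reflect:
  assumes "target \<mu> c h"
  shows "perkins_alpha_minus \<mu> x = - perkins_alpha_plus (distr \<mu> borel uminus) (- x)"
proof -
  interpret target \<mu> c h by fact
  interpret R: target "distr \<mu> borel uminus" "- h" "- c" by (rule reflect_target)
  show ?thesis
  proof (cases "c < x \<and> x < 0")
    case True
    then have x: "0 < - x" "- x < - c" by auto
    define Q where "Q = is_arg_max (\<lambda>y. (put \<mu> x - call \<mu> y) / (y - x)) (\<lambda>y. 0 < y)"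
    define Q' where "Q' = is_arg_max (\<lambda>y. (call (distr \<mu> borel uminus) (- x) - put (distr \<mu> borel uminus) y) / (- x - y)) (\<lambda>y. y < 0)"
    have eq: "Q' z \<longleftrightarrow> Q (- z)" for z
    proof -
      define G where "G y = (put \<mu> x - call \<mu> y) / (y - x)" for y
      have q: "(call (distr \<mu> borel uminus) (- x) - put (distr \<mu> borel uminus) y) / (- x - y) = G (- y)" for y
      proof -
        have "- x - y = - y - x" by simp
        then show ?thesis by (simp only: G_def call_reflect put_reflect minus_minus)
      qed
      have "(\<exists>y<0. f (- y) > f (- z)) \<longleftrightarrow> (\<exists>y>0. f y > f (- z))" for f :: "real \<Rightarrow> real"
        by (metis minus_minus neg_0_less_iff_less neg_less_0_iff_less)
      from this[of G] show ?thesis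
        unfolding Q_def Q'_def is_arg_max_def q G_def[symmetric] by auto
    qed
    have R: "Q' (R.alpha (- x))" using R.alpha_arg_max(1)[OF x] by (simp add: Q'_def)
    have least: "R.alpha (- x) \<le> z" if "Q' z" for z
      using R.alpha_least[OF x] that unfolding Q'_def by blast
    have "(GREATEST y. Q y) = - R.alpha (- x)"
    proof (rule Greatest_equality)
      show "Q (- R.alpha (- x))" using R eq by simp
      show "z \<le> - R.alpha (- x)" if "Q z" for z using least[of "- z"] that eq by simp
    qed
    then show ?thesis using True x
      by (simp add: perkins_alpha_minus_def R.perkins_alpha_plus_eq lower_end_eq Q_def)
  next
    case False
    then show ?thesis
      by (auto simp: perkins_alpha_minus_def R.perkins_alpha_plus_eq lower_end_eq)
  qed
qed

section \<open>The Perkins stopping time\<close>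

context skorokhod begin

lemma reflect_skorokhod: "skorokhod M \<F> (\<lambda>t \<omega>. - W t \<omega>) (distr \<mu> borel uminus) (- h) (- c)"
  by (rule skorokhod.intro[OF neg_brownian reflect_target])

lemma running_inf_eq: "running_inf W t \<omega> = - running_sup (\<lambda>t \<omega>. - W t \<omega>) t \<omega>"
  by (simp add: running_inf_def running_sup_def Inf_real_def image_image)

lemma tau_alpha_eq:
  "tau_alpha \<mu> W \<omega> = min (tau_lower \<mu> W \<omega>) (tau_lower (distr \<mu> borel uminus) (\<lambda>t \<omega>. - W t \<omega>) \<omega>)"
proof -
  have "perkins_alpha_minus \<mu> (running_inf W u \<omega>) \<le> ereal (W u \<omega>) \<longleftrightarrow>
     ereal (- W u \<omega>) \<le> perkins_alpha_plus (distr \<mu> borel uminus) (running_sup (\<lambda>t \<omega>. - W t \<omega>) u \<omega>)" for u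
    unfolding perkins_alpha_minus_reflect[OF target_axioms] running_inf_eq
    by (simp add: ereal_uminus_le_reorder)
  then show ?thesis unfolding tau_alpha_def tau_lower_def by simp
qed

text \<open>
  Paths for which the values of the barriers at \<open>0\<close>, fixed by convention, are irrelevant.
\<close>

definition oscillating_path :: "'a \<Rightarrow> bool" where
  "oscillating_path \<omega> \<longleftrightarrow> continuous_path \<omega> \<and> (\<forall>t>0. 0 < running_sup W t \<omega> \<and> 0 < running_sup (\<lambda>t \<omega>. - W t \<omega>) t \<omega>)"

lemma AE_oscillating_path: "AE \<omega> in M. oscillating_path \<omega>"
proof -
  interpret N: brownian M \<F> "\<lambda>t \<omega>. - W t \<omega>" by (rule neg_brownian)
  show ?thesis using AE_continuous_path sup_pos N.sup_pos by eventually_elim (auto simp: oscillating_path_def)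
qed

lemma oscillating_path_reflect: "skorokhod.oscillating_path (\<lambda>t \<omega>. - W t \<omega>) \<omega> \<longleftrightarrow> oscillating_path \<omega>"
proof -
  interpret R: skorokhod M \<F> "\<lambda>t \<omega>. - W t \<omega>" "distr \<mu> borel uminus" "- h" "- c" by (rule reflect_skorokhod)
  have "continuous_on {0..} (\<lambda>t. - W t \<omega>) \<longleftrightarrow> continuous_on {0..} (\<lambda>t. W t \<omega>)"
    using continuous_on_minus[of "{0..}" "\<lambda>t. W t \<omega>"] continuous_on_minus[of "{0..}" "\<lambda>t. - W t \<omega>"] by auto
  then show ?thesis by (auto simp: R.oscillating_path_def oscillating_path_def R.continuous_path_def continuous_path_def)
qed

definition lower_set :: "'a \<Rightarrow> real set" where
  "lower_set \<omega> = {u. 0 < u \<and> 0 < running_sup W u \<omega> \<and> running_sup W u \<omega> < h \<and> W u \<omega> \<le> alpha (running_sup W u \<omega>)}"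

lemma tau_lower_eq: "tau_lower \<mu> W = (\<lambda>\<omega>. Inf (ennreal ` lower_set \<omega>))"
proof -
  have "{u. 0 < u \<and> ereal (W u \<omega>) \<le> perkins_alpha_plus \<mu> (running_sup W u \<omega>)} = lower_set \<omega>" for \<omega>
    by (auto simp: lower_set_def perkins_alpha_plus_eq split: if_splits)
  then show ?thesis by (simp add: tau_lower_def fun_eq_iff)
qed

lemma alpha_measurable: "(\<lambda>x. if x \<le> 0 then 0 else if x < h then alpha x else c) \<in> borel_measurable borel"
proof -
  have "(\<lambda>x. - (if x \<le> 0 then 0 else if x < h then alpha x else c)) \<in> borel_measurable borel"
    by (rule borel_measurable_mono)
       (use alpha_antimono alpha_arg_max(2,3) c0 in \<open>auto simp: mono_def not_le intro: less_imp_le\<close>)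
  from borel_measurable_uminus[OF this] show ?thesis by simp
qed

lemma sup_constant_below:
  assumes g: "continuous_path \<omega>" and u: "0 \<le> u" "u < t" and w: "W u \<omega> < running_sup W u \<omega>"
  shows "\<exists>q\<in>\<rat>. u < q \<and> q < t \<and> running_sup W q \<omega> = running_sup W u \<omega>"
proof -
  have "continuous_on {0..} (\<lambda>t. W t \<omega>)" using g by (simp add: continuous_path_def)
  then obtain e where e: "0 < e" "\<And>v. v \<in> {0..} \<Longrightarrow> dist v u < e \<Longrightarrow> dist (W v \<omega>) (W u \<omega>) < running_sup W u \<omega> - W u \<omega>"
    using u w unfolding continuous_on_iff by (metis atLeast_iff diff_gt_0_iff_gt)
  obtain q where q: "q \<in> \<rat>" "u < q" "q < min t (u + e)"
    using Rats_dense_in_real[of u "min t (u + e)"] u e by auto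
  have q0: "0 \<le> q" using q u by simp
  obtain v where v: "0 \<le> v" "v \<le> q" "W v \<omega> = running_sup W q \<omega>" using sup_attained[OF g q0] by metis
  have "W v \<omega> \<le> running_sup W u \<omega>"
  proof (cases "v \<le> u")
    case True then show ?thesis using sup_upper[OF g v(1)] by simp
  next
    case False
    then have "dist v u < e" using v q by (simp add: dist_real_def)
    then show ?thesis using e(2)[of v] v by (simp add: dist_real_def abs_less_iff)
  qed
  then have "running_sup W q \<omega> = running_sup W u \<omega>" using v sup_mono[OF g u(1), of q] q by simp
  then show ?thesis using q by (intro bexI[of _ q]) auto
qed

text \<open>
  In terms of the running infimum the condition is inherited backwards to the time at which the infimum
  is attained, and it persists for a short while after \<open>u\<close>, because the supremum is constant there.  Hence rational
  times suffice.
\<close>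

lemma lower_set_rational:
  assumes n: "oscillating_path \<omega>"
  shows "(\<exists>u\<in>lower_set \<omega>. u < t) \<longleftrightarrow> (\<exists>q\<in>\<rat> \<inter> {0<..<t}. 0 < running_sup W q \<omega> \<and> running_sup W q \<omega> < h \<and>
     - alpha (running_sup W q \<omega>) \<le> running_sup (\<lambda>t \<omega>. - W t \<omega>) q \<omega>)"
proof -
  interpret R: skorokhod M \<F> "\<lambda>t \<omega>. - W t \<omega>" "distr \<mu> borel uminus" "- h" "- c" by (rule reflect_skorokhod)
  have g: "continuous_path \<omega>" "R.continuous_path \<omega>" using n oscillating_path_reflect[of \<omega>] by (auto simp: oscillating_path_def R.oscillating_path_def)
  show ?thesis
  proof
    assume "\<exists>u\<in>lower_set \<omega>. u < t"
    then obtain u where u: "0 < u" "u < t" "0 < running_sup W u \<omega>" "running_sup W u \<omega> < h" "W u \<omega> \<le> alpha (running_sup W u \<omega>)"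
      by (auto simp: lower_set_def)
    have "W u \<omega> < running_sup W u \<omega>" using u alpha_arg_max(3)[OF u(3,4)] by simp
    then obtain q where q: "q \<in> \<rat>" "u < q" "q < t" "running_sup W q \<omega> = running_sup W u \<omega>"
      using sup_constant_below[OF g(1) _ u(2)] u by auto
    have "- W u \<omega> \<le> running_sup (\<lambda>t \<omega>. - W t \<omega>) q \<omega>" using R.sup_upper[OF g(2), of u q] u q by simp
    then show "\<exists>q\<in>\<rat> \<inter> {0<..<t}. 0 < running_sup W q \<omega> \<and> running_sup W q \<omega> < h \<and>
     - alpha (running_sup W q \<omega>) \<le> running_sup (\<lambda>t \<omega>. - W t \<omega>) q \<omega>"
      using q u by (intro bexI[of _ q]) auto
  next
    assume "\<exists>q\<in>\<rat> \<inter> {0<..<t}. 0 < running_sup W q \<omega> \<and> running_sup W q \<omega> < h \<and>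
     - alpha (running_sup W q \<omega>) \<le> running_sup (\<lambda>t \<omega>. - W t \<omega>) q \<omega>"
    then obtain q where q: "0 < q" "q < t" "0 < running_sup W q \<omega>" "running_sup W q \<omega> < h"
     "- alpha (running_sup W q \<omega>) \<le> running_sup (\<lambda>t \<omega>. - W t \<omega>) q \<omega>" by auto
    obtain v where v: "0 \<le> v" "v \<le> q" "- W v \<omega> = running_sup (\<lambda>t \<omega>. - W t \<omega>) q \<omega>"
      using R.sup_attained[OF g(2), of q] q by (metis less_imp_le)
    have le: "W v \<omega> \<le> alpha (running_sup W q \<omega>)" using v q by simp
    then have "W v \<omega> < 0" using alpha_arg_max(3)[OF q(3,4)] by simp
    then have v0: "0 < v" using g(1) v by (cases "v = 0") (auto simp: continuous_path_def)
    have Sv: "0 < running_sup W v \<omega>" "running_sup W v \<omega> \<le> running_sup W q \<omega>"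
      using n v0 sup_mono[OF g(1) v(1,2)] by (auto simp: oscillating_path_def)
    then have "alpha (running_sup W q \<omega>) \<le> alpha (running_sup W v \<omega>)" using alpha_antimono q by auto
    then have "v \<in> lower_set \<omega>" using le v0 Sv q by (simp add: lower_set_def)
    then show "\<exists>u\<in>lower_set \<omega>. u < t" using v q by (intro bexI[of _ v]) auto
  qed
qed

lemma tau_lower_stopping_time: "stopping_time \<F> (tau_lower \<mu> W)"
  unfolding tau_lower_eq
proof (rule hitting_stopping_time)
  interpret R: skorokhod M \<F> "\<lambda>t \<omega>. - W t \<omega>" "distr \<mu> borel uminus" "- h" "- c" by (rule reflect_skorokhod)
  fix t :: real assume t: "0 < t"
  let ?a = "\<lambda>x. if x \<le> 0 then 0 else if x < h then alpha x else c"
  define A where "A q = {\<omega>\<in>space M. 0 < running_sup W q \<omega> \<and> running_sup W q \<omega> < h \<and>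
     - ?a (running_sup W q \<omega>) \<le> running_sup (\<lambda>t \<omega>. - W t \<omega>) q \<omega>}" for q
  show "{\<omega> \<in> space M. \<exists>u\<in>lower_set \<omega>. u < t} \<in> sets (\<F> (ennreal t))"
  proof (rule F_AE)
    have "A q \<in> sets (\<F> (ennreal t))" if q: "0 < q" "q < t" for q
    proof -
      have 1: "ennreal q \<le> ennreal t" "0 \<le> q" using q by (auto simp: ennreal_leI)
      have [measurable]: "running_sup W q \<in> borel_measurable (\<F> (ennreal t))"
        "running_sup (\<lambda>t \<omega>. - W t \<omega>) q \<in> borel_measurable (\<F> (ennreal t))"
        using measurable_F_mono[OF sup_measurable_F[OF 1(2)] 1(1)] R.measurable_F_mono[OF R.sup_measurable_F[OF 1(2)] 1(1)] .
      have "(\<lambda>\<omega>. ?a (running_sup W q \<omega>)) \<in> borel_measurable (\<F> (ennreal t))"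
        by (rule measurable_compose[OF _ alpha_measurable]) fact
      have gen: "{\<omega>\<in>space N. 0 < X \<omega> \<and> X \<omega> < h \<and> - Z \<omega> \<le> Y \<omega>} \<in> sets N"
        if [measurable]: "X \<in> borel_measurable N" "Y \<in> borel_measurable N" "Z \<in> borel_measurable N"
        for N :: "'a measure" and X Y Z :: "'a \<Rightarrow> real" by measurable
      show ?thesis unfolding A_def space_F[of "ennreal t", symmetric] by (rule gen; fact)
    qed
    then show "(\<Union>q\<in>\<rat> \<inter> {0<..<t}. A q) \<in> sets (\<F> (ennreal t))"
      using countable_rat by (intro sets.countable_UN') auto
    show "AE \<omega> in M. (\<omega> \<in> (\<Union>q\<in>\<rat> \<inter> {0<..<t}. A q)) = (\<omega> \<in> {\<omega> \<in> space M. \<exists>u\<in>lower_set \<omega>. u < t})"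
      using AE_oscillating_path AE_space
    proof eventually_elim
      fix \<omega> assume n: "oscillating_path \<omega>" and sp: "\<omega> \<in> space M"
      have "\<omega> \<in> (\<Union>q\<in>\<rat> \<inter> {0<..<t}. A q) \<longleftrightarrow> (\<exists>q\<in>\<rat> \<inter> {0<..<t}. 0 < running_sup W q \<omega> \<and> running_sup W q \<omega> < h \<and>
         - alpha (running_sup W q \<omega>) \<le> running_sup (\<lambda>t \<omega>. - W t \<omega>) q \<omega>)"
        using sp by (auto simp: A_def intro!: bexI)
      then show "(\<omega> \<in> (\<Union>q\<in>\<rat> \<inter> {0<..<t}. A q)) = (\<omega> \<in> {\<omega> \<in> space M. \<exists>u\<in>lower_set \<omega>. u < t})"
        using lower_set_rational[OF n, of t] sp by simp
    qed
  qed auto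
qed (auto simp: lower_set_def)

lemma not_in_lower_set: "ennreal v < tau_lower \<mu> W \<omega> \<Longrightarrow> v \<notin> lower_set \<omega>"
  unfolding tau_lower_eq by (meson Inf_lower imageI not_less)

text \<open>
  When \<open>h\<close> is first hit, either the infimum is above \<open>c\<close>, and then \<open>\<alpha>\<^sup>- \<le> h\<close> stops the path, or \<open>c\<close>
  has been hit before, and then \<open>\<alpha>\<^sup>+ \<ge> c\<close> had stopped it.
\<close>

lemma before_tau_alpha_upper:
  assumes n: "oscillating_path \<omega>" and v: "0 \<le> v" "ennreal v < tau_lower \<mu> W \<omega>"
    "ennreal v < tau_lower (distr \<mu> borel uminus) (\<lambda>t \<omega>. - W t \<omega>) \<omega>"
  shows "W v \<omega> < h"
proof (rule ccontr)
  interpret R: skorokhod M \<F> "\<lambda>t \<omega>. - W t \<omega>" "distr \<mu> borel uminus" "- h" "- c" by (rule reflect_skorokhod)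
  have g: "continuous_path \<omega>" "R.continuous_path \<omega>" using n oscillating_path_reflect[of \<omega>] by (auto simp: oscillating_path_def R.oscillating_path_def)
  assume "\<not> W v \<omega> < h"
  then have hv: "hit h \<omega> \<le> ennreal v" using v(1) unfolding hit_def by (intro Inf_lower) auto
  then have "hit h \<omega> < \<top>" by (simp add: le_less_trans)
  then obtain e where e: "0 \<le> e" "hit h \<omega> = ennreal e" "h \<le> W e \<omega>" "\<And>u. 0 \<le> u \<Longrightarrow> u < e \<Longrightarrow> W u \<omega> < h"
    using hit_attained[OF g(1), of h] by metis
  have eh: "W e \<omega> = h" using hit_value[OF g(1) e(1,3,4)] h0 by simp
  have e0: "0 < e" using e eh g(1) h0 by (cases "e = 0") (auto simp: continuous_path_def)
  have ev: "e \<le> v" using hv e v by (simp add: ennreal_le_iff)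
  have le: "ennreal x < tau_lower \<mu> W \<omega>" "ennreal x < tau_lower (distr \<mu> borel uminus) (\<lambda>t \<omega>. - W t \<omega>) \<omega>"
    if "0 \<le> x" "x \<le> e" for x
    using v that ev by (meson ennreal_leI le_less_trans order_trans)+
  show False
  proof (cases "running_sup (\<lambda>t \<omega>. - W t \<omega>) e \<omega> < - c")
    case True
    let ?s = "running_sup (\<lambda>t \<omega>. - W t \<omega>) e \<omega>"
    have s: "0 < ?s" "?s < - c" using True n e0 by (auto simp: oscillating_path_def)
    have "- h \<le> R.alpha ?s" using R.alpha_arg_max(2)[OF s] .
    then have "e \<in> R.lower_set \<omega>" using e0 s eh by (simp add: R.lower_set_def)
    then show False using R.not_in_lower_set[OF le(2)[of e]] e by simp
  next
    case False
    obtain x where x: "0 \<le> x" "x \<le> e" "- W x \<omega> = running_sup (\<lambda>t \<omega>. - W t \<omega>) e \<omega>"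
      using R.sup_attained[OF g(2) e(1)] by metis
    have Wx: "W x \<omega> \<le> c" using x False by simp
    have x0: "0 < x" using Wx c0 x g(1) by (cases "x = 0") (auto simp: continuous_path_def)
    have xe: "x < e" using Wx eh c0 h0 x by (cases "x = e") auto
    obtain y where y: "0 \<le> y" "y \<le> x" "W y \<omega> = running_sup W x \<omega>" using sup_attained[OF g(1) x(1)] by metis
    have Sx: "0 < running_sup W x \<omega>" "running_sup W x \<omega> < h"
      using n x0 e(4)[of y] y xe by (auto simp: oscillating_path_def)
    have "x \<in> lower_set \<omega>" using Wx x0 Sx alpha_arg_max(2)[OF Sx] by (simp add: lower_set_def)
    then show False using not_in_lower_set[OF le(1)[of x]] x by simp
  qed
qed

lemma before_tau_alpha:
  assumes n: "oscillating_path \<omega>" and v: "0 \<le> v" "ennreal v < tau_alpha \<mu> W \<omega>"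
  shows "c \<le> W v \<omega>" "W v \<omega> \<le> h"
proof -
  interpret R: skorokhod M \<F> "\<lambda>t \<omega>. - W t \<omega>" "distr \<mu> borel uminus" "- h" "- c" by (rule reflect_skorokhod)
  have uu: "distr (distr \<mu> borel uminus) borel uminus = \<mu>" by (rule distr_uminus_uminus) simp
  have v2: "ennreal v < tau_lower \<mu> W \<omega>" "ennreal v < tau_lower (distr \<mu> borel uminus) (\<lambda>t \<omega>. - W t \<omega>) \<omega>"
    using v(2) by (auto simp: tau_alpha_eq)
  show "W v \<omega> \<le> h" using before_tau_alpha_upper[OF n v(1) v2] by simp
  have "- W v \<omega> < - c" using R.before_tau_alpha_upper[of \<omega> v] v(1) v2 n oscillating_path_reflect[of \<omega>] by (simp add: uu)
  then show "c \<le> W v \<omega>" by simp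
qed

text \<open>
  Monotonicity of \<open>\<alpha>\<^sup>+\<close> suffices: along times decreasing to \<open>T\<close> the barrier is at most its value at \<open>T\<close>.
\<close>

lemma tau_lower_attained:
  assumes n: "oscillating_path \<omega>" and T: "0 < T" "tau_lower \<mu> W \<omega> = ennreal T"
  shows "running_sup W T \<omega> < h" "W T \<omega> \<le> alpha (running_sup W T \<omega>)"
proof -
  have g: "continuous_path \<omega>" using n by (simp add: oscillating_path_def)
  have ex: "\<exists>u\<in>lower_set \<omega>. T \<le> u \<and> u < T + 1 / Suc k" for k :: nat
  proof -
    have "Inf (ennreal ` lower_set \<omega>) < ennreal (T + 1 / Suc k)"
      using T by (simp add: tau_lower_eq ennreal_less_iff del: ennreal_plus)
    then obtain u where u: "u \<in> lower_set \<omega>" "ennreal u < ennreal (T + 1 / Suc k)" by (auto simp: Inf_less_iff)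
    have u0: "0 < u" using u by (simp add: lower_set_def)
    have "ennreal T \<le> ennreal u" using Inf_lower[of "ennreal u" "ennreal ` lower_set \<omega>"] u T by (simp add: tau_lower_eq)
    then have "T \<le> u" using u0 by (simp add: ennreal_le_iff)
    moreover have "u < T + 1 / Suc k" using u(2) u0 by (simp only: ennreal_less_iff less_imp_le)
    ultimately show ?thesis using u by (intro bexI[of _ u]) auto
  qed
  then obtain u where u: "\<And>k::nat. u k \<in> lower_set \<omega>" "\<And>k. T \<le> u k" "\<And>k. u k < T + 1 / Suc k" by metis
  have T0: "0 \<le> T" using T by simp
  have S0: "0 < running_sup W T \<omega>" using n T by (simp add: oscillating_path_def)
  have Su: "running_sup W T \<omega> \<le> running_sup W (u k) \<omega>" "running_sup W (u k) \<omega> < h" for k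
    using sup_mono[OF g T0 u(2)] u(1)[of k] by (auto simp: lower_set_def)
  show "running_sup W T \<omega> < h" using Su[of 0] by simp
  have le: "W (u k) \<omega> \<le> alpha (running_sup W T \<omega>)" for k
    using u(1)[of k] alpha_antimono[OF S0 Su(1,2), of k] by (simp add: lower_set_def)
  have "(\<lambda>k. T + 1 / real (Suc k)) \<longlonglongrightarrow> T + 0" by (intro tendsto_add tendsto_const LIMSEQ_Suc[OF lim_const_over_n])
  then have "u \<longlonglongrightarrow> T"
    by (intro tendsto_sandwich[OF _ _ tendsto_const, of T u]) (use u in \<open>auto intro!: always_eventually less_imp_le\<close>)
  then have "(\<lambda>k. W (u k) \<omega>) \<longlonglongrightarrow> W T \<omega>"
    by (rule path_LIMSEQ[OF g T0]) (use T0 u(2) in \<open>meson order_trans\<close>)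
  then show "W T \<omega> \<le> alpha (running_sup W T \<omega>)" by (rule LIMSEQ_le_const2) (use le in auto)
qed

text \<open>
  A path stopped by the upper barrier is at its running supremum, for otherwise it would have been stopped
  when the supremum was attained; so only stopping at the lower barrier leaves \<open>W < s \<le> S\<close>.
\<close>

lemma tau_alpha_threshold:
  assumes n: "oscillating_path \<omega>" and T: "0 < T" "tau_alpha \<mu> W \<omega> = ennreal T" and s: "0 < s" "s < h"
  shows "running_sup W T \<omega> < s \<Longrightarrow> alpha s \<le> W T \<omega>"
    "s \<le> running_sup W T \<omega> \<Longrightarrow> W T \<omega> < s \<Longrightarrow> W T \<omega> \<le> alpha s"
    "W T \<omega> \<noteq> 0"
proof -
  interpret R: skorokhod M \<F> "\<lambda>t \<omega>. - W t \<omega>" "distr \<mu> borel uminus" "- h" "- c" by (rule reflect_skorokhod)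
  have g: "continuous_path \<omega>" "R.continuous_path \<omega>" and nR: "R.oscillating_path \<omega>" using n oscillating_path_reflect[of \<omega>] by (auto simp: oscillating_path_def R.oscillating_path_def)
  have T0: "0 \<le> T" using T by simp
  let ?N = "\<lambda>u. running_sup (\<lambda>t \<omega>. - W t \<omega>) u \<omega>"
  have pos: "0 < running_sup W u \<omega>" "0 < ?N u" if "0 < u" for u using n that by (auto simp: oscillating_path_def)
  have before: "v \<notin> lower_set \<omega>" "v \<notin> R.lower_set \<omega>" if "0 \<le> v" "v < T" for v
  proof -
    have "ennreal v < ennreal T" using that by (simp add: ennreal_lessI)
    then have "ennreal v < tau_lower \<mu> W \<omega>" "ennreal v < tau_lower (distr \<mu> borel uminus) (\<lambda>t \<omega>. - W t \<omega>) \<omega>"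
      unfolding T(2)[symmetric] by (auto simp: tau_alpha_eq)
    then show "v \<notin> lower_set \<omega>" "v \<notin> R.lower_set \<omega>" by (simp_all add: not_in_lower_set R.not_in_lower_set)
  qed
  show "alpha s \<le> W T \<omega>" if lt: "running_sup W T \<omega> < s"
  proof (rule path_left_limit[OF g(1), of "T / 2"])
    fix x assume x: "T / 2 \<le> x" "x < T"
    have x0: "0 < x" using x T by simp
    have Sx: "running_sup W x \<omega> \<le> running_sup W T \<omega>" using sup_mono[OF g(1)] x x0 by simp
    have "alpha (running_sup W x \<omega>) < W x \<omega>"
      using before(1)[of x] x x0 pos[OF x0] Sx lt s by (auto simp: lower_set_def)
    moreover have "alpha s \<le> alpha (running_sup W x \<omega>)" using pos[OF x0] Sx lt s by (intro alpha_antimono) auto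
    ultimately show "alpha s \<le> W x \<omega>" by simp
  qed (use T in auto)
  consider "tau_lower \<mu> W \<omega> = ennreal T" | "tau_lower (distr \<mu> borel uminus) (\<lambda>t \<omega>. - W t \<omega>) \<omega> = ennreal T"
    using T(2) unfolding tau_alpha_eq by (metis min_def)
  note C = this
  have L: "running_sup W T \<omega> < h \<and> W T \<omega> \<le> alpha (running_sup W T \<omega>) \<and> W T \<omega> < 0" if "tau_lower \<mu> W \<omega> = ennreal T"
    using tau_lower_attained[OF n T(1) that] alpha_arg_max(3)[OF pos(1)[OF T(1)]] by auto
  have U: "?N T < - c \<and> - W T \<omega> \<le> R.alpha (?N T) \<and> 0 < W T \<omega>"
    if "tau_lower (distr \<mu> borel uminus) (\<lambda>t \<omega>. - W t \<omega>) \<omega> = ennreal T"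
    using R.tau_lower_attained[OF nR T(1) that] R.alpha_arg_max(3)[OF pos(2)[OF T(1)]] by auto
  show "W T \<omega> \<noteq> 0" using C L U by (metis less_irrefl)
  show "W T \<omega> \<le> alpha s" if sT: "s \<le> running_sup W T \<omega>" "W T \<omega> < s"
  proof (cases rule: C)
    case 1
    then show ?thesis using L[OF 1] alpha_antimono[OF s(1) sT(1)] by simp
  next
    case 2
    obtain v where v: "0 \<le> v" "v \<le> T" "W v \<omega> = running_sup W T \<omega>" using sup_attained[OF g(1) T0] by metis
    have "v \<noteq> T" using v sT by auto
    then have vT: "v < T" using v by simp
    have "W v \<omega> \<noteq> 0" using v sT s by simp
    then have v0: "0 < v" using v g(1) by (cases "v = 0") (auto simp: continuous_path_def)
    have Nv: "0 < ?N v" "?N v \<le> ?N T" using pos v0 R.sup_mono[OF g(2) v(1,2)] by auto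
    have "R.alpha (?N T) \<le> R.alpha (?N v)" using Nv U[OF 2] by (intro R.alpha_antimono) auto
    then have "v \<in> R.lower_set \<omega>" using U[OF 2] v sT Nv v0 by (simp add: R.lower_set_def)
    then show ?thesis using before(2)[OF v(1) vT] by simp
  qed
qed

text \<open>
  Stopping while \<open>S\<close> is between \<open>s (Suc n)\<close> and \<open>s n = 2 s (Suc n)\<close> requires that level \<open>\<alpha>\<^sup>+ (s (Suc n))\<close> is
  reached before \<open>s n\<close>.  By \<open>gamblers_ruin\<close> and \<open>slope_decrement\<close> these probabilities are bounded by a
  telescoping series, so that almost surely only finitely many of the events occur.
\<close>

lemma tau_lower_positive: "AE \<omega> in M. 0 < tau_lower \<mu> W \<omega>"
proof -
  \<comment> \<open>the exponent \<open>n + 1\<close> keeps all levels strictly below \<open>h\<close>\<close>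
  define s where "s n = h / 2 ^ (n + 1)" for n :: nat
  have s0: "0 < s n" "s n < h" for n
  proof -
    show "0 < s n" using h0 by (simp add: s_def)
    have "(1::real) < 2 ^ (n + 1)" by (rule one_less_power) auto
    then show "s n < h" using h0 by (simp add: s_def pos_divide_less_eq)
  qed
  have sS: "s (Suc n) = s n / 2" for n by (simp add: s_def)
  have sd: "s m \<le> s n" if "n \<le> m" for m n
    unfolding s_def using that h0 by (intro divide_left_mono) auto
  define b where "b n = - alpha (s (Suc n))" for n
  have b0: "0 < b n" for n using alpha_arg_max(3)[OF s0] by (simp add: b_def)
  define P where "P n A \<longleftrightarrow> A \<in> sets M \<and> prob A \<le> s n / (s n + b n) \<and>
     (AE \<omega> in M. (\<exists>u\<ge>0. b n \<le> running_sup (\<lambda>t \<omega>. - W t \<omega>) u \<omega> \<and> running_sup W u \<omega> < s n) \<longrightarrow> \<omega> \<in> A)" for n A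
  have "\<forall>n. \<exists>A. P n A"
  proof
    fix n show "\<exists>A. P n A" using gamblers_ruin[OF s0(1)[of n] b0[of n]] unfolding P_def by blast
  qed
  then obtain A where "\<And>n. P n (A n)" using choice[of P] by blast
  then have A: "\<And>n. A n \<in> sets M" "\<And>n. prob (A n) \<le> s n / (s n + b n)"
    "\<And>n. AE \<omega> in M. (\<exists>u\<ge>0. b n \<le> running_sup (\<lambda>t \<omega>. - W t \<omega>) u \<omega> \<and> running_sup W u \<omega> < s n) \<longrightarrow> \<omega> \<in> A n"
    unfolding P_def by blast+
  define m where "m n = slope (s n)" for n
  have m: "0 < m n" "m n \<le> 1" "m 0 \<le> m n" for n
    using slope_touches(2,3)[OF s0] slope_antimono[OF s0(1) sd[of 0 n] s0(2)] by (auto simp: m_def)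
  have bound: "prob (A n) \<le> 4 / m 0 * (m (Suc (Suc n)) - m (Suc n))" for n
  proof -
    define D where "D = m (Suc (Suc n)) - m (Suc n)"
    have lt: "s (Suc (Suc n)) < s (Suc n)" using sS[of "Suc n"] s0(1)[of "Suc n"] by simp
    have "(s (Suc n) - s (Suc (Suc n))) * m (Suc n) \<le> (m (Suc (Suc n)) - m (Suc n)) * (s (Suc (Suc n)) - alpha (s (Suc n)))"
      using slope_decrement[OF s0(1) lt s0(2)] by (simp add: m_def)
    also have "\<dots> \<le> (m (Suc (Suc n)) - m (Suc n)) * (s n + b n)"
    proof (rule mult_left_mono)
      show "s (Suc (Suc n)) - alpha (s (Suc n)) \<le> s n + b n" using sd[of n "Suc (Suc n)"] by (simp add: b_def)
      show "0 \<le> m (Suc (Suc n)) - m (Suc n)"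
        using slope_antimono[OF s0(1) _ s0(2), of "Suc (Suc n)" "Suc n"] lt by (simp add: m_def)
    qed
    finally have "s n / 4 * m (Suc n) \<le> (m (Suc (Suc n)) - m (Suc n)) * (s n + b n)"
      by (simp add: sS)
    then have 1: "s n / 4 * m (Suc n) \<le> D * (s n + b n)" by (simp only: D_def)
    have 2: "s n / 4 * m 0 \<le> s n / 4 * m (Suc n)" using m(3)[of "Suc n"] s0(1)[of n] by (intro mult_left_mono) auto
    have "s n / 4 * m 0 = s n * m 0 / 4" "4 * D * (s n + b n) = 4 * (D * (s n + b n))" by simp_all
    then have *: "s n * m 0 \<le> 4 * D * (s n + b n)" using order_trans[OF 2 1] by linarith
    have "s n / (s n + b n) \<le> 4 / m 0 * D"
    proof -
      have "0 < s n + b n" using s0(1)[of n] b0[of n] by simp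
      moreover have "s n \<le> 4 / m 0 * D * (s n + b n)" using * m(1)[of 0] by (simp add: pos_le_divide_eq)
      ultimately show ?thesis by (simp only: pos_divide_le_eq)
    qed
    then have "s n / (s n + b n) \<le> 4 / m 0 * (m (Suc (Suc n)) - m (Suc n))" by (simp only: D_def)
    then show ?thesis using A(2)[of n] by simp
  qed
  have "summable (\<lambda>n. prob (A n))"
  proof (rule summableI_nonneg_bounded)
    fix n
    have "(\<Sum>i<n. prob (A i)) \<le> (\<Sum>i<n. 4 / m 0 * (m (Suc (Suc i)) - m (Suc i)))" by (intro sum_mono bound)
    also have "\<dots> = 4 / m 0 * (m (Suc n) - m (Suc 0))"
      unfolding sum_distrib_left[symmetric] by (subst sum_lessThan_telescope) simp
    also have "\<dots> \<le> 4 / m 0 * 1" using m(2)[of "Suc n"] m(1)[of "Suc 0"] m(1)[of 0] by (intro mult_left_mono) auto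
    finally show "(\<Sum>i<n. prob (A i)) \<le> 4 / m 0" by simp
  qed simp
  then have "AE \<omega> in M. \<forall>\<^sub>F n in sequentially. \<omega> \<in> space M - A n"
    by (intro borel_cantelli_AE1) (use A(1) in \<open>auto simp: emeasure_eq_measure\<close>)
  moreover have "AE \<omega> in M. \<forall>n. (\<exists>u\<ge>0. b n \<le> running_sup (\<lambda>t \<omega>. - W t \<omega>) u \<omega> \<and> running_sup W u \<omega> < s n) \<longrightarrow> \<omega> \<in> A n"
    unfolding AE_all_countable using A(3) by blast
  ultimately show ?thesis using AE_oscillating_path
  proof eventually_elim
    fix \<omega> assume ev: "\<forall>\<^sub>F n in sequentially. \<omega> \<in> space M - A n"
      and imp: "\<forall>n. (\<exists>u\<ge>0. b n \<le> running_sup (\<lambda>t \<omega>. - W t \<omega>) u \<omega> \<and> running_sup W u \<omega> < s n) \<longrightarrow> \<omega> \<in> A n"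
      and n: "oscillating_path \<omega>"
    interpret R: skorokhod M \<F> "\<lambda>t \<omega>. - W t \<omega>" "distr \<mu> borel uminus" "- h" "- c" by (rule reflect_skorokhod)
    have g: "continuous_path \<omega>" "R.continuous_path \<omega>" using n oscillating_path_reflect[of \<omega>] by (auto simp: oscillating_path_def R.oscillating_path_def)
    obtain N where N: "\<And>k. N \<le> k \<Longrightarrow> \<omega> \<notin> A k" using ev by (auto simp: eventually_sequentially)
    have high: "s N \<le> running_sup W u \<omega>" if u: "u \<in> lower_set \<omega>" for u
    proof (rule ccontr)
      assume lt: "\<not> s N \<le> running_sup W u \<omega>"
      have u0: "0 < u" "0 < running_sup W u \<omega>" "running_sup W u \<omega> < h" "W u \<omega> \<le> alpha (running_sup W u \<omega>)"
        using u by (auto simp: lower_set_def)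
      have "(\<lambda>n. h * (1 / 2) ^ n) \<longlonglongrightarrow> h * 0" by (intro tendsto_mult tendsto_const LIMSEQ_realpow_zero) auto
      then have "\<forall>\<^sub>F n in sequentially. h * (1 / 2) ^ n < running_sup W u \<omega>" using u0 by (intro order_tendstoD(2)) auto
      then obtain k where "h * (1 / 2) ^ k < running_sup W u \<omega>" by (auto simp: eventually_sequentially)
      moreover have "s k \<le> h * (1 / 2) ^ k" using h0 by (simp add: s_def power_one_over divide_simps)
      ultimately have ex: "s k \<le> running_sup W u \<omega>" by simp
      define j where "j = (LEAST k. s k \<le> running_sup W u \<omega>)"
      have j: "s j \<le> running_sup W u \<omega>" unfolding j_def using ex by (rule LeastI)
      have "N < j" using lt j sd[of j N] by (cases "N < j") auto
      then obtain i where i: "j = Suc i" "N \<le> i" by (cases j) auto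
      have "running_sup W u \<omega> < s i" using not_less_Least[of i "\<lambda>k. s k \<le> running_sup W u \<omega>"] i by (simp add: j_def not_le)
      moreover have "alpha (running_sup W u \<omega>) \<le> alpha (s j)" using j u0 s0 by (intro alpha_antimono) auto
      then have "b i \<le> - W u \<omega>" using u0 i by (simp add: b_def)
      then have "b i \<le> running_sup (\<lambda>t \<omega>. - W t \<omega>) u \<omega>" using R.sup_upper[OF g(2), of u u] u0 by simp
      ultimately have "\<omega> \<in> A i" using imp u0 by (meson less_imp_le)
      then show False using N[OF i(2)] by simp
    qed
    have le: "hit (s N) \<omega> \<le> tau_lower \<mu> W \<omega>"
      unfolding tau_lower_eq
    proof (rule Inf_greatest)
      fix x assume "x \<in> ennreal ` lower_set \<omega>"
      then obtain u where u: "x = ennreal u" "u \<in> lower_set \<omega>" by auto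
      then have "0 \<le> u" by (auto simp: lower_set_def)
      then show "hit (s N) \<omega> \<le> x" using hit_le_iff[OF g(1), of u "s N"] high[OF u(2)] u by simp
    qed
    have "\<not> hit (s N) \<omega> \<le> ennreal 0" using hit_le_iff[OF g(1), of 0 "s N"] sup_zero[OF g(1)] s0(1)[of N] by simp
    then have "0 < hit (s N) \<omega>" by (simp add: zero_less_iff_neq_zero)
    then show "0 < tau_lower \<mu> W \<omega>" using le by (rule less_le_trans)
  qed
qed

end

section \<open>The Perkins embedding\<close>

lemma potential_scale:
  assumes p: "potential h f" and l: "0 \<le> l" shows "potential h (\<lambda>x. l * f x)"
proof -
  have "convex_on {0..} (\<lambda>x. l * f x)" using convex_on_cmul[OF l potential_convex[OF p]] .
  then show ?thesis unfolding potential_def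
    using potentialD[OF p] l by (auto intro!: continuous_on_mult_left mult_left_mono)
qed

lemma tangency_scale:
  assumes t: "tangency B f g h k a" and l: "0 \<le> l" shows "tangency (l * B) (\<lambda>x. l * f x) (\<lambda>x. l * g x) h k a"
  unfolding tangency_def
proof (intro ballI conjI)
  fix s assume s: "s \<in> {0<..<h}"
  show "a s \<in> {0..k}" using t s unfolding tangency_def by blast
  obtain m where m: "m \<in> {0..B}" "touches {0..} g (f s) s (a s) m" using t s unfolding tangency_def by blast
  have "touches {0..} (\<lambda>x. l * g x) (l * f s) s (a s) (l * m)"
    unfolding touches_def
  proof (intro conjI ballI)
    show "a s \<in> {0..}" using m(2) by (simp add: touches_def)
    have "g (a s) = f s - (s + a s) * m" using m(2) by (simp add: touches_def)
    then show "l * g (a s) = l * f s - (s + a s) * (l * m)" by (simp only:) (simp add: algebra_simps)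
    fix y :: real assume "y \<in> {0..}"
    then have "l * (f s - (s + y) * m) \<le> l * g y" using m(2) l by (intro mult_left_mono) (auto simp: touches_def)
    then show "l * f s - (s + y) * (l * m) \<le> l * g y" by (simp add: algebra_simps)
  qed
  then show "\<exists>m\<in>{0..l * B}. touches {0..} (\<lambda>x. l * g x) (l * f s) s (a s) m"
    using m(1) l by (intro bexI[of _ "l * m"]) (auto intro: mult_left_mono)
qed

lemma tangency_weaken: "tangency B f g h k a \<Longrightarrow> B \<le> C \<Longrightarrow> tangency C f g h k a"
  unfolding tangency_def by (meson atLeastAtMost_iff order_trans)

context bounded_law begin

lemma put_difference_limit:
  assumes e: "e \<longlonglongrightarrow> 0" "\<And>n::nat. 0 < e n"
  shows "(\<lambda>n. (put \<mu> 0 - put \<mu> (- e n)) / e n) \<longlonglongrightarrow> measure \<mu> {..<0}"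
proof -
  interpret R: bounded_law "distr \<mu> borel uminus" "- h" "- c" by (rule reflect)
  have "measure (distr \<mu> borel uminus) {0<..} = measure \<mu> {..<0}"
    using uminus_measurable by (subst measure_distr) (auto simp: vimage_def lessThan_def)
  then show ?thesis using R.call_difference_limit[OF e, of 0] by (simp add: call_reflect)
qed

lemma mass_split: "measure \<mu> {0<..} + measure \<mu> {..<0} + measure \<mu> {0} = 1"
proof -
  have "measure \<mu> ({0<..} \<union> {..<0}) = measure \<mu> {0<..} + measure \<mu> {..<0}"
    by (rule D.finite_measure_Union) auto
  moreover have "measure \<mu> (({0<..} \<union> {..<0}) \<union> {0}) = measure \<mu> ({0<..} \<union> {..<0}) + measure \<mu> {0}"
    by (rule D.finite_measure_Union) auto
  moreover have "({0<..} \<union> {..<0}) \<union> {0} = (UNIV :: real set)" by auto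
  ultimately show ?thesis using prob_UNIV by simp
qed

lemma call_zero_mass: assumes "call \<mu> 0 = 0" shows "measure \<mu> {0} = 1"
proof -
  have "put \<mu> 0 = 0" using put_call[of 0] assms by simp
  then have a: "AE y in \<mu>. max (0 - y) 0 = 0" using integral_nonneg_eq_0_iff_AE[OF int_put, of 0] by (simp add: put_def)
  have b: "AE y in \<mu>. max (y - 0) 0 = 0" using integral_nonneg_eq_0_iff_AE[OF int_call, of 0] assms by (simp add: call_def)
  have "AE y in \<mu>. y \<in> {0}" using a b by eventually_elim (auto simp: max_def split: if_splits)
  then show ?thesis using D.prob_eq_1[of "{0}"] by simp
qed

end

context target begin

text \<open>
  \<open>perkins_comparison\<close> in both directions, after scaling the potentials of \<open>\<mu>\<close> so that they agree with those of \<open>\<rho>\<close> at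
  \<open>0\<close>.  The derivatives at \<open>0\<close> compare the masses of the two open half-lines, and equality of the atoms at
  \<open>0\<close> makes the scaling factor \<open>1\<close>.
\<close>

lemma perkins_unique:
  assumes \<rho>: "bounded_law \<rho> c h"
    and ta: "tangency 1 (call \<rho>) (\<lambda>y. put \<rho> (- y)) h (- c) (\<lambda>s. - alpha s)"
    and tb: "tangency 1 (\<lambda>y. put \<rho> (- y)) (call \<rho>) (- c) h (\<lambda>x. - target.alpha (distr \<mu> borel uminus) x)"
    and z: "measure \<rho> {0} = measure \<mu> {0}"
  shows "\<rho> = \<mu>"
proof -
  interpret R: bounded_law \<rho> c h by fact
  interpret N: target "distr \<mu> borel uminus" "- h" "- c" by (rule reflect_target)
  note p1 = R.potential_call R.potential_put and p2 = potential_call potential_put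
  have tb2: "tangency 1 (\<lambda>y. put \<mu> (- y)) (call \<mu>) (- c) h (\<lambda>x. - N.alpha x)"
    using N.perkins_tangency by (simp add: call_reflect[abs_def] put_reflect[abs_def])
  note ta2 = perkins_tangency
  have pos2: "\<forall>x\<in>{0..<h}. 0 < call \<mu> x" "\<forall>x\<in>{0..<- c}. 0 < put \<mu> (- x)"
    using call_pos put_pos by auto
  have hk: "0 < h" "0 < - c" using c0 h0 by auto
  have m1: "measure \<mu> {0} \<noteq> 1"
  proof
    assume "measure \<mu> {0} = 1"
    then have "measure \<mu> {0<..} = 0" using mass_split by (smt (verit) measure_nonneg)
    then have "AE y in \<mu>. y \<notin> {0<..}" using D.prob_eq_0[of "{0<..}"] by simp
    then have "AE y in \<mu>. max (y - 0) 0 = 0" by eventually_elim auto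
    then have "call \<mu> 0 = 0" unfolding call_def by (subst integral_cong_AE[where g="\<lambda>_. 0"]) auto
    then show False using call_pos[OF h0] by simp
  qed
  have z2: "call \<mu> 0 = put \<mu> (- 0)" "call \<rho> 0 = put \<rho> (- 0)" using put_call[of 0] R.put_call[of 0] by auto
  have c2: "0 < call \<mu> 0" using call_pos[OF h0] .
  have c1: "0 < call \<rho> 0" using R.call_nonneg[of 0] R.call_zero_mass z m1 by (cases "call \<rho> 0 = 0") auto
  have pos1: "\<forall>x\<in>{0..<h}. 0 < call \<rho> x" "\<forall>x\<in>{0..<- c}. 0 < put \<rho> (- x)"
    using perkins_positivity[OF p1 p2 ta ta2 tb tb2 pos2 hk c1 z2(2)] by auto
  define l where "l = call \<rho> 0 / call \<mu> 0"
  have l: "0 < l" using c1 c2 by (simp add: l_def)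
  define B where "B = max 1 l"
  have sc: "potential h (\<lambda>x. l * call \<mu> x)" "potential (- c) (\<lambda>x. l * put \<mu> (- x))"
    using potential_scale[OF p2(1), of l] potential_scale[OF p2(2), of l] l by auto
  have T: "tangency B (call \<rho>) (\<lambda>y. put \<rho> (- y)) h (- c) (\<lambda>s. - alpha s)"
    "tangency B (\<lambda>y. put \<rho> (- y)) (call \<rho>) (- c) h (\<lambda>x. - N.alpha x)"
    "tangency B (\<lambda>x. l * call \<mu> x) (\<lambda>y. l * put \<mu> (- y)) h (- c) (\<lambda>s. - alpha s)"
    "tangency B (\<lambda>y. l * put \<mu> (- y)) (\<lambda>x. l * call \<mu> x) (- c) h (\<lambda>x. - N.alpha x)"
    using tangency_weaken[OF ta, of B] tangency_weaken[OF tb, of B]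
      tangency_weaken[OF tangency_scale[OF ta2, of l], of B] tangency_weaken[OF tangency_scale[OF tb2, of l], of B] l
    by (auto simp: B_def)
  have e0: "call \<rho> 0 = l * call \<mu> 0" using c2 by (simp add: l_def)
  have e0': "l * call \<mu> 0 = l * put \<mu> (- 0)" using z2 by simp
  have spos: "\<forall>x\<in>{0..<h}. 0 < l * call \<mu> x" "\<forall>x\<in>{0..<- c}. 0 < l * put \<mu> (- x)" using pos2 l by auto
  have le: "call \<rho> x \<le> l * call \<mu> x \<and> put \<rho> (- x) \<le> l * put \<mu> (- x)" if "0 \<le> x" for x
    using perkins_comparison[OF p1 sc T(1,3,2,4) spos hk z2(2) e0' e0 that] .
  have ge: "l * call \<mu> x \<le> call \<rho> x \<and> l * put \<mu> (- x) \<le> put \<rho> (- x)" if "0 \<le> x" for x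
    using perkins_comparison[OF sc p1 T(3,1,4,2) pos1 hk e0' z2(2) e0[symmetric] that] .
  have eqc: "call \<rho> x = l * call \<mu> x" and eqp: "put \<rho> (- x) = l * put \<mu> (- x)" if "0 \<le> x" for x
    using le[OF that] ge[OF that] by (auto intro: antisym)
  define e where "e n = 1 / real (Suc n)" for n
  have e: "e \<longlonglongrightarrow> 0" "\<And>n. 0 < e n" unfolding e_def by (rule LIMSEQ_Suc[OF lim_const_over_n]) auto
  have q1: "(call \<rho> 0 - call \<rho> (0 + e n)) / e n = l * ((call \<mu> 0 - call \<mu> (0 + e n)) / e n)" for n
    using eqc[of 0] eqc[of "0 + e n"] e(2)[of n] by (simp add: right_diff_distrib)
  have "(\<lambda>n. (call \<rho> 0 - call \<rho> (0 + e n)) / e n) \<longlonglongrightarrow> l * measure \<mu> {0<..}"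
    unfolding q1 by (intro tendsto_mult_left call_difference_limit e)
  then have mp: "measure \<rho> {0<..} = l * measure \<mu> {0<..}"
    by (rule LIMSEQ_unique[OF R.call_difference_limit[OF e]])
  have q2: "(put \<rho> 0 - put \<rho> (- e n)) / e n = l * ((put \<mu> 0 - put \<mu> (- e n)) / e n)" for n
    using eqp[of 0] eqp[of "e n"] e(2)[of n] by (simp add: right_diff_distrib)
  have "(\<lambda>n. (put \<rho> 0 - put \<rho> (- e n)) / e n) \<longlonglongrightarrow> l * measure \<mu> {..<0}"
    unfolding q2 by (intro tendsto_mult_left put_difference_limit e)
  then have mm: "measure \<rho> {..<0} = l * measure \<mu> {..<0}"
    by (rule LIMSEQ_unique[OF R.put_difference_limit[OF e]])
  have e1: "1 - measure \<mu> {0} = measure \<mu> {0<..} + measure \<mu> {..<0}" using mass_split by simp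
  have e2: "l * measure \<mu> {0<..} + l * measure \<mu> {..<0} = 1 - measure \<mu> {0}"
    using R.mass_split unfolding mp mm z by simp
  have "l * (1 - measure \<mu> {0}) = 1 - measure \<mu> {0}"
  proof -
    have "l * (1 - measure \<mu> {0}) = l * measure \<mu> {0<..} + l * measure \<mu> {..<0}"
      unfolding e1 by (rule distrib_left)
    then show ?thesis using e2 by (rule trans)
  qed
  then have l1: "l = 1" using m1 by simp
  show ?thesis
  proof (rule law_eqI[OF \<rho> bounded_law_axioms])
    fix x show "call \<rho> x = call \<mu> x"
    proof (cases "0 \<le> x")
      case True then show ?thesis using eqc l1 by simp
    next
      case False
      then show ?thesis using eqp[of "- x"] put_call[of x] R.put_call[of x] l1 by simp
    qed
  qed
qed

end

context skorokhod begin

text \<open>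
  As for Azema--Yor, with the variable \<open>(y - W) 1 (W < s \<le> S)\<close>, which is bounded by \<open>(y - W)\<^sup>+\<close> with equality at
  \<open>y = \<alpha>\<^sup>+ (s)\<close>.
\<close>

lemma perkins_tangency_law:
  assumes \<tau>: "stopping_time \<F> \<tau>" "AE \<omega> in M. \<tau> \<omega> < \<top>"
    and rng: "AE \<omega> in M. \<forall>t\<ge>0. c \<le> stopped_process W \<tau> t \<omega> \<and> stopped_process W \<tau> t \<omega> \<le> h"
    and thr: "AE \<omega> in M. \<forall>s. 0 < s \<longrightarrow> s < h \<longrightarrow>
     (at_time (running_sup W) \<tau> \<omega> < s \<longrightarrow> alpha s \<le> at_time W \<tau> \<omega>) \<and>
     (s \<le> at_time (running_sup W) \<tau> \<omega> \<longrightarrow> at_time W \<tau> \<omega> < s \<longrightarrow> at_time W \<tau> \<omega> \<le> alpha s)"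
  shows "tangency 1 (call (distr M borel (at_time W \<tau>))) (\<lambda>y. put (distr M borel (at_time W \<tau>)) (- y)) h (- c) (\<lambda>s. - alpha s)"
proof -
  let ?X = "at_time W \<tau>" and ?Y = "at_time (running_sup W) \<tau>" and ?\<rho> = "distr M borel (at_time W \<tau>)"
  note B = bounded_until_at_time[OF bounded_until_of_range[OF \<tau> rng]]
  note [measurable] = B(1) sup_at_time_measurable[OF \<tau>]
  have call: "call ?\<rho> y = expectation (\<lambda>\<omega>. max (?X \<omega> - y) 0)" for y
    unfolding call_def by (subst integral_distr) auto
  have put: "put ?\<rho> y = expectation (\<lambda>\<omega>. max (y - ?X \<omega>) 0)" for y
    unfolding put_def by (subst integral_distr) auto
  have Xi: "integrable M ?X" by (rule B(3))
  have up: "AE \<omega> in M. ?X \<omega> \<le> ?Y \<omega>" using sup_at_time_zero[OF \<tau>(2)] by eventually_elim simp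
  show ?thesis unfolding tangency_def
  proof (intro ballI conjI)
    fix s assume "s \<in> {0<..<h}"
    then have s: "0 < s" "s < h" by auto
    note A = alpha_arg_max[OF s]
    show "- alpha s \<in> {0..- c}" using A by auto
    define E where "E = {\<omega>\<in>space M. s \<le> ?Y \<omega> \<and> ?X \<omega> < s}"
    have [measurable]: "E \<in> sets M" unfolding E_def by measurable
    have iX: "integrable M (\<lambda>\<omega>. (y - ?X \<omega>) * indicator E \<omega>)" for y
      using integrable_real_mult_indicator[of E M "\<lambda>\<omega>. y - ?X \<omega>"] Xi by simp
    have iI: "integrable M (\<lambda>\<omega>. indicator E \<omega> :: real)" by (rule integrable_const_bound[of _ 1]) auto
    have iM: "integrable M (\<lambda>\<omega>. max (?X \<omega> - y) 0)" "integrable M (\<lambda>\<omega>. max (y - ?X \<omega>) 0)" for y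
      using Xi by (auto intro!: Bochner_Integration.integrable_max)
    have "call ?\<rho> s - expectation (\<lambda>\<omega>. (s - ?X \<omega>) * indicator E \<omega>)
       = expectation (\<lambda>\<omega>. max (?X \<omega> - s) 0 - (s - ?X \<omega>) * indicator E \<omega>)"
      unfolding call using iM iX by simp
    also have "\<dots> = expectation (\<lambda>\<omega>. (?X \<omega> - s) * indicator {\<omega>\<in>space M. s \<le> ?Y \<omega>} \<omega>)"
    proof (rule integral_cong_AE)
      show "AE \<omega> in M. max (?X \<omega> - s) 0 - (s - ?X \<omega>) * indicator E \<omega> = (?X \<omega> - s) * indicator {\<omega>\<in>space M. s \<le> ?Y \<omega>} \<omega>"
        using up AE_space
      proof eventually_elim
        fix \<omega> assume "?X \<omega> \<le> ?Y \<omega>" "\<omega> \<in> space M"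
        then show "max (?X \<omega> - s) 0 - (s - ?X \<omega>) * indicator E \<omega> = (?X \<omega> - s) * indicator {\<omega>\<in>space M. s \<le> ?Y \<omega>} \<omega>"
          by (cases "?X \<omega> < s"; cases "s \<le> ?Y \<omega>") (auto simp: E_def)
      qed
    qed measurable
    also have "\<dots> = 0" by (rule doob_law[OF \<tau> rng s(1)])
    finally have cs: "call ?\<rho> s = expectation (\<lambda>\<omega>. (s - ?X \<omega>) * indicator E \<omega>)" by simp
    have e: "expectation (\<lambda>\<omega>. (y - ?X \<omega>) * indicator E \<omega>) = call ?\<rho> s - (s - y) * prob E" for y
    proof -
      have "expectation (\<lambda>\<omega>. (y - ?X \<omega>) * indicator E \<omega>)
          = expectation (\<lambda>\<omega>. (s - ?X \<omega>) * indicator E \<omega> - (s - y) * indicator E \<omega>)"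
        by (rule Bochner_Integration.integral_cong) (auto simp: algebra_simps)
      also have "\<dots> = call ?\<rho> s - (s - y) * prob E"
        using iX iI by (simp add: cs)
      finally show ?thesis .
    qed
    have le: "call ?\<rho> s - (s - y) * prob E \<le> put ?\<rho> y" for y
      unfolding e[symmetric] put by (rule integral_mono[OF iX iM(2)]) (auto simp: indicator_def)
    have eq: "put ?\<rho> (alpha s) = call ?\<rho> s - (s - alpha s) * prob E"
      unfolding e[symmetric] put
    proof (rule integral_cong_AE)
      show "AE \<omega> in M. max (alpha s - ?X \<omega>) 0 = (alpha s - ?X \<omega>) * indicator E \<omega>"
        using thr AE_space
      proof eventually_elim
        fix \<omega> assume *: "\<forall>s. 0 < s \<longrightarrow> s < h \<longrightarrow> (?Y \<omega> < s \<longrightarrow> alpha s \<le> ?X \<omega>) \<and>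
            (s \<le> ?Y \<omega> \<longrightarrow> ?X \<omega> < s \<longrightarrow> ?X \<omega> \<le> alpha s)"
          and sp: "\<omega> \<in> space M"
        show "max (alpha s - ?X \<omega>) 0 = (alpha s - ?X \<omega>) * indicator E \<omega>"
          using *[rule_format, OF s] sp A s
          by (cases "s \<le> ?Y \<omega>"; cases "?X \<omega> < s") (auto simp: E_def)
      qed
    qed measurable
    have "touches {0..} (\<lambda>y. put ?\<rho> (- y)) (call ?\<rho> s) s (- alpha s) (prob E)"
      unfolding touches_def using eq le[of "- y" for y] A by auto
    then show "\<exists>m\<in>{0..1}. touches {0..} (\<lambda>y. put ?\<rho> (- y)) (call ?\<rho> s) s (- alpha s) m"
      by (intro bexI[of _ "prob E"]) auto
  qed
qed

end

text \<open>
  The randomisation is known at time \<open>0\<close>: the randomised time is a stopping time, and Doob's identity for it takes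
  care of the conditioning.
\<close>

locale skorokhod_randomised = skorokhod +
  fixes Z :: "'a \<Rightarrow> real"
  assumes Z_unif: "uniform_rv M Z" and Z0: "Z \<in> borel_measurable (\<F> 0)"
begin

lemma tau_perkins_cases: "tau_perkins \<mu> W Z \<omega> = 0 \<and> Z \<omega> \<le> measure \<mu> {0} \<and> measure \<mu> {0} \<noteq> 0
    \<or> tau_perkins \<mu> W Z \<omega> = tau_alpha \<mu> W \<omega> \<and> (measure \<mu> {0} \<noteq> 0 \<longrightarrow> \<not> Z \<omega> \<le> measure \<mu> {0})"
  by (auto simp: tau_perkins_def)

lemma tau_perkins_stopping_time: "stopping_time \<F> (tau_perkins \<mu> W Z)"
proof -
  interpret R: skorokhod M \<F> "\<lambda>t \<omega>. - W t \<omega>" "distr \<mu> borel uminus" "- h" "- c" by (rule reflect_skorokhod)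
  have a: "stopping_time \<F> (tau_alpha \<mu> W)"
    unfolding tau_alpha_eq[abs_def] by (intro stopping_time_min tau_lower_stopping_time R.tau_lower_stopping_time)
  show ?thesis
  proof (rule stopping_timeI)
    fix t
    have "Z \<in> borel_measurable (\<F> t)" by (rule measurable_F_mono[OF Z0]) simp
    then have z: "Measurable.pred (\<F> t) (\<lambda>\<omega>. Z \<omega> \<le> measure \<mu> {0})" by measurable
    have "(\<lambda>\<omega>. tau_perkins \<mu> W Z \<omega> \<le> t) = (\<lambda>\<omega>. (measure \<mu> {0} \<noteq> 0 \<and> Z \<omega> \<le> measure \<mu> {0}) \<or> tau_alpha \<mu> W \<omega> \<le> t)"
      by (auto simp: tau_perkins_def fun_eq_iff)
    then show "Measurable.pred (\<F> t) (\<lambda>\<omega>. tau_perkins \<mu> W Z \<omega> \<le> t)"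
      using z stopping_timeD[OF a, of t] by simp
  qed
qed

lemma tau_perkins_le: "tau_perkins \<mu> W Z \<omega> \<le> tau_alpha \<mu> W \<omega>"
  using tau_perkins_cases[of \<omega>] by auto

lemma tau_perkins_finite: "AE \<omega> in M. tau_perkins \<mu> W Z \<omega> < \<top>"
proof (rule escape[OF stopping_time_measurable[OF tau_perkins_stopping_time], of "max (- c) h"])
  show "AE \<omega> in M. \<forall>t\<ge>0. ennreal t < tau_perkins \<mu> W Z \<omega> \<longrightarrow> \<bar>W t \<omega>\<bar> \<le> max (- c) h"
    using AE_oscillating_path
  proof eventually_elim
    fix \<omega> assume n: "oscillating_path \<omega>"
    show "\<forall>t\<ge>0. ennreal t < tau_perkins \<mu> W Z \<omega> \<longrightarrow> \<bar>W t \<omega>\<bar> \<le> max (- c) h"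
    proof (intro allI impI)
      fix t :: real assume t: "0 \<le> t" "ennreal t < tau_perkins \<mu> W Z \<omega>"
      then have "ennreal t < tau_alpha \<mu> W \<omega>" using tau_perkins_le less_le_trans by blast
      from before_tau_alpha[OF n t(1) this] show "\<bar>W t \<omega>\<bar> \<le> max (- c) h" by auto
    qed
  qed
qed

lemma tau_perkins_range:
  "AE \<omega> in M. \<forall>t\<ge>0. c \<le> stopped_process W (tau_perkins \<mu> W Z) t \<omega> \<and> stopped_process W (tau_perkins \<mu> W Z) t \<omega> \<le> h"
proof (rule stopped_process_range)
  show "AE \<omega> in M. \<forall>r\<in>\<rat>. 0 \<le> r \<longrightarrow> ennreal r < tau_perkins \<mu> W Z \<omega> \<longrightarrow> c \<le> W r \<omega> \<and> W r \<omega> \<le> h"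
    using AE_oscillating_path
  proof eventually_elim
    fix \<omega> assume n: "oscillating_path \<omega>"
    show "\<forall>r\<in>\<rat>. 0 \<le> r \<longrightarrow> ennreal r < tau_perkins \<mu> W Z \<omega> \<longrightarrow> c \<le> W r \<omega> \<and> W r \<omega> \<le> h"
      using before_tau_alpha[OF n] tau_perkins_le[of \<omega>] less_le_trans by blast
  qed
qed (use c0 h0 in auto)

lemma tau_alpha_positive: "AE \<omega> in M. 0 < tau_alpha \<mu> W \<omega>"
proof -
  interpret R: skorokhod M \<F> "\<lambda>t \<omega>. - W t \<omega>" "distr \<mu> borel uminus" "- h" "- c" by (rule reflect_skorokhod)
  show ?thesis using tau_lower_positive R.tau_lower_positive by eventually_elim (simp add: tau_alpha_eq)
qed

text \<open>
  On the event \<open>Z \<le> \<mu> {0}\<close> the path is stopped at \<open>W = S = 0\<close>, which satisfies the threshold description trivially;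
  elsewhere the stopping time is positive and the path is stopped away from \<open>0\<close>.
\<close>

lemma tau_perkins_position:
  "AE \<omega> in M. (\<forall>s. 0 < s \<longrightarrow> s < h \<longrightarrow>
     (at_time (running_sup W) (tau_perkins \<mu> W Z) \<omega> < s \<longrightarrow> alpha s \<le> at_time W (tau_perkins \<mu> W Z) \<omega>) \<and>
     (s \<le> at_time (running_sup W) (tau_perkins \<mu> W Z) \<omega> \<longrightarrow> at_time W (tau_perkins \<mu> W Z) \<omega> < s
        \<longrightarrow> at_time W (tau_perkins \<mu> W Z) \<omega> \<le> alpha s))
   \<and> (at_time W (tau_perkins \<mu> W Z) \<omega> = 0 \<longleftrightarrow> measure \<mu> {0} \<noteq> 0 \<and> Z \<omega> \<le> measure \<mu> {0})"
  using AE_oscillating_path tau_perkins_finite tau_alpha_positive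
proof eventually_elim
  fix \<omega> assume n: "oscillating_path \<omega>" and f: "tau_perkins \<mu> W Z \<omega> < \<top>" and p: "0 < tau_alpha \<mu> W \<omega>"
  have g: "continuous_path \<omega>" using n by (simp add: oscillating_path_def)
  show "(\<forall>s. 0 < s \<longrightarrow> s < h \<longrightarrow>
     (at_time (running_sup W) (tau_perkins \<mu> W Z) \<omega> < s \<longrightarrow> alpha s \<le> at_time W (tau_perkins \<mu> W Z) \<omega>) \<and>
     (s \<le> at_time (running_sup W) (tau_perkins \<mu> W Z) \<omega> \<longrightarrow> at_time W (tau_perkins \<mu> W Z) \<omega> < s
        \<longrightarrow> at_time W (tau_perkins \<mu> W Z) \<omega> \<le> alpha s))
   \<and> (at_time W (tau_perkins \<mu> W Z) \<omega> = 0 \<longleftrightarrow> measure \<mu> {0} \<noteq> 0 \<and> Z \<omega> \<le> measure \<mu> {0})"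
  proof (cases "measure \<mu> {0} \<noteq> 0 \<and> Z \<omega> \<le> measure \<mu> {0}")
    case True
    then have t: "tau_perkins \<mu> W Z \<omega> = 0" by (simp add: tau_perkins_def)
    have "W 0 \<omega> = 0" using g by (simp add: continuous_path_def)
    then show ?thesis using True alpha_arg_max(3) sup_zero[OF g] t by (auto simp: at_time_def less_imp_le)
  next
    case False
    then have t: "tau_perkins \<mu> W Z \<omega> = tau_alpha \<mu> W \<omega>" by (auto simp: tau_perkins_def)
    then obtain T where T: "tau_alpha \<mu> W \<omega> = ennreal T" "0 \<le> T" using f by (cases "tau_alpha \<mu> W \<omega>") auto
    then have T0: "0 < T" using p by simp
    have at: "at_time X (tau_perkins \<mu> W Z) \<omega> = X T \<omega>" for X :: "real \<Rightarrow> 'a \<Rightarrow> real"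
      using t T by (simp add: at_time_def)
    have "W T \<omega> \<noteq> 0" using tau_alpha_threshold(3)[OF n T0 T(1), of "h / 2"] h0 by simp
    then show ?thesis unfolding at using tau_alpha_threshold(1,2)[OF n T0 T(1)] False by blast
  qed
qed

lemma prob_Z: assumes "0 \<le> m" "m \<le> 1" shows "prob {\<omega>\<in>space M. Z \<omega> \<le> m} = m"
proof -
  have Zm[measurable]: "Z \<in> borel_measurable M" and d: "distr M borel Z = uniform_measure lborel {0..1}"
    using Z_unif by (auto simp: uniform_rv_def)
  have "prob {\<omega>\<in>space M. Z \<omega> \<le> m} = measure (distr M borel Z) {..m}"
    by (subst measure_distr) (auto intro!: arg_cong[where f=prob])
  also have "\<dots> = measure lborel ({0..1} \<inter> {..m}) / measure lborel {0..1::real}"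
    unfolding d by (subst measure_uniform_measure) auto
  also have "{0..1} \<inter> {..m} = {0..m}" using assms by auto
  finally show ?thesis using assms by simp
qed

text \<open>
  The reflected problem has the same stopping time, which yields the tangents of the second kind from those
  of the first.
\<close>

theorem tau_perkins_embeds: "tau_perkins \<mu> W Z \<in> ui_embeddings M \<F> W \<mu>"
proof (rule ui_embeddings_I[OF tau_perkins_stopping_time tau_perkins_finite tau_perkins_range])
  let ?\<tau> = "tau_perkins \<mu> W Z"
  let ?\<rho> = "distr M borel (at_time W ?\<tau>)"
  note st = tau_perkins_stopping_time tau_perkins_finite tau_perkins_range
  note B = bounded_until_at_time[OF bounded_until_of_range[OF st]]
  note [measurable] = B(1)
  interpret R: skorokhod_randomised M \<F> "\<lambda>t \<omega>. - W t \<omega>" "distr \<mu> borel uminus" "- h" "- c" Z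
    by (intro skorokhod_randomised.intro reflect_skorokhod skorokhod_randomised_axioms.intro Z_unif Z0)
  interpret L: bounded_law ?\<rho> c h by (rule bounded_until_law(2)[OF st])
  have uu: "distr (distr \<mu> borel uminus) borel uminus = \<mu>" by (rule distr_uminus_uminus) simp
  have m0: "measure (distr \<mu> borel uminus) {0} = measure \<mu> {0}"
    using uminus_measurable by (subst measure_distr) (auto intro!: arg_cong[where f="measure \<mu>"])
  have ta: "tau_alpha (distr \<mu> borel uminus) (\<lambda>t \<omega>. - W t \<omega>) = tau_alpha \<mu> W"
    by (auto simp: fun_eq_iff tau_alpha_eq R.tau_alpha_eq uu min.commute)
  have tp: "tau_perkins (distr \<mu> borel uminus) (\<lambda>t \<omega>. - W t \<omega>) Z = ?\<tau>"
    by (auto simp: fun_eq_iff tau_perkins_def m0 ta)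
  have at: "at_time (\<lambda>t \<omega>. - W t \<omega>) ?\<tau> = (\<lambda>\<omega>. - at_time W ?\<tau> \<omega>)" by (auto simp: at_time_def)
  have dn: "distr M borel (at_time (\<lambda>t \<omega>. - W t \<omega>) ?\<tau>) = distr ?\<rho> borel uminus"
    unfolding at by (subst distr_distr) (auto simp: o_def)
  have t1: "tangency 1 (call ?\<rho>) (\<lambda>y. put ?\<rho> (- y)) h (- c) (\<lambda>s. - alpha s)"
    by (rule perkins_tangency_law[OF st]) (use tau_perkins_position in \<open>eventually_elim, blast\<close>)
  have t2: "tangency 1 (call (distr ?\<rho> borel uminus)) (\<lambda>y. put (distr ?\<rho> borel uminus) (- y)) (- c) (- (- h)) (\<lambda>s. - R.alpha s)"
    unfolding dn[symmetric]
    by (rule R.perkins_tangency_law[OF R.tau_perkins_stopping_time R.tau_perkins_finite R.tau_perkins_range, unfolded tp])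
       (use R.tau_perkins_position[unfolded tp] in \<open>eventually_elim, blast\<close>)
  show "?\<rho> = \<mu>"
  proof (rule perkins_unique[OF L.bounded_law_axioms t1])
    show "tangency 1 (\<lambda>y. put ?\<rho> (- y)) (call ?\<rho>) (- c) h (\<lambda>x. - R.alpha x)"
      using t2 by (simp add: L.call_reflect[abs_def] L.put_reflect[abs_def])
    have m01: "0 \<le> measure \<mu> {0}" "measure \<mu> {0} \<le> 1" by auto
    have "measure ?\<rho> {0} = prob {\<omega>\<in>space M. at_time W ?\<tau> \<omega> = 0}"
      by (subst measure_distr) (auto intro!: arg_cong[where f=prob])
    also have "\<dots> = prob {\<omega>\<in>space M. measure \<mu> {0} \<noteq> 0 \<and> Z \<omega> \<le> measure \<mu> {0}}"
    proof (rule finite_measure_eq_AE)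
      have [measurable]: "Z \<in> borel_measurable M" using Z_unif by (auto simp: uniform_rv_def)
      show "{\<omega>\<in>space M. at_time W ?\<tau> \<omega> = 0} \<in> sets M" "{\<omega>\<in>space M. measure \<mu> {0} \<noteq> 0 \<and> Z \<omega> \<le> measure \<mu> {0}} \<in> sets M"
        by measurable
      show "AE \<omega> in M. (\<omega> \<in> {\<omega>\<in>space M. at_time W ?\<tau> \<omega> = 0}) = (\<omega> \<in> {\<omega>\<in>space M. measure \<mu> {0} \<noteq> 0 \<and> Z \<omega> \<le> measure \<mu> {0}})"
        using tau_perkins_position by eventually_elim blast
    qed
    also have "\<dots> = measure \<mu> {0}" using prob_Z[OF m01] by (cases "measure \<mu> {0} = 0") auto
    finally show "measure ?\<rho> {0} = measure \<mu> {0}" .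
  qed
qed

end

section \<open>Layers of a payoff\<close>

context prob_space begin

text \<open>
  The fundamental theorem of calculus in the second variable and Fubini's theorem.  The kernel \<open>k\<close> is cut off
  outside a compact set so that it is bounded for all paths.
\<close>

lemma payoff_layers:
  fixes F Fs :: "real \<times> real \<Rightarrow> real" and X Y :: "'a \<Rightarrow> real" and c h :: real
  defines "k s x \<equiv> (if c \<le> x \<and> x \<le> s \<and> 0 \<le> s \<and> s \<le> h then Fs (x, s) else 0)"
  assumes F: "continuous_on payoff_domain F" "has_partial_s F Fs" "continuous_on payoff_domain Fs"
    and m[measurable]: "X \<in> borel_measurable M" "Y \<in> borel_measurable M"
    and bd: "AE \<omega> in M. c \<le> X \<omega> \<and> X \<omega> \<le> Y \<omega> \<and> 0 \<le> Y \<omega> \<and> Y \<omega> \<le> h"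
  shows "integrable M (\<lambda>\<omega>. if (X \<omega>, Y \<omega>) \<in> payoff_domain then F (X \<omega>, Y \<omega>) else 0)"
    and "integrable lborel (\<lambda>s. expectation (\<lambda>\<omega>. k s (X \<omega>) * indicator {\<omega>. s \<le> Y \<omega>} \<omega>))"
    and "expectation (\<lambda>\<omega>. if (X \<omega>, Y \<omega>) \<in> payoff_domain then F (X \<omega>, Y \<omega>) else 0)
       = expectation (\<lambda>\<omega>. if (X \<omega>, max (X \<omega>) 0) \<in> payoff_domain then F (X \<omega>, max (X \<omega>) 0) else 0)
         + (\<integral>s. expectation (\<lambda>\<omega>. k s (X \<omega>) * indicator {\<omega>. s \<le> Y \<omega>} \<omega>) \<partial>lborel)"
    and "\<exists>B. \<forall>s x. \<bar>k s x\<bar> \<le> B"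
    and "(\<lambda>p. k (snd p) (fst p)) \<in> borel_measurable borel"
proof -
  have cl: "closed payoff_domain"
  proof -
    have "payoff_domain = {p. 0 \<le> snd p} \<inter> {p. fst p \<le> snd p}" by (auto simp: payoff_domain_def)
    moreover have "closed ({p :: real \<times> real. 0 \<le> snd p} \<inter> {p. fst p \<le> snd p})"
      by (intro closed_Int closed_Collect_le continuous_intros)
    ultimately show ?thesis by simp
  qed
  have pm: "payoff_domain \<in> sets borel" using cl by simp
  define Fd Gd where "Fd = (\<lambda>p. if p \<in> payoff_domain then F p else 0)"
    and "Gd = (\<lambda>p. if p \<in> payoff_domain then Fs p else 0)"
  have Fdm[measurable]: "Fd \<in> borel_measurable borel" and Gdm[measurable]: "Gd \<in> borel_measurable borel"
    unfolding Fd_def Gd_def by (intro borel_measurable_continuous_on_if pm F continuous_on_const)+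
  define K where "K = {p. c \<le> fst p \<and> fst p \<le> snd p \<and> 0 \<le> snd p \<and> snd p \<le> h}"
  have Kd: "K \<subseteq> payoff_domain" by (auto simp: K_def payoff_domain_def)
  have "compact K"
  proof -
    have "K = payoff_domain \<inter> ({c..h} \<times> {0..h})"
      by (auto simp: K_def payoff_domain_def)
    then show ?thesis using closed_Int_compact[OF cl, of "{c..h} \<times> {0..h}"] compact_Times by auto
  qed
  have bdd: "\<exists>B\<ge>0. \<forall>p\<in>K. \<bar>f p\<bar> \<le> B" if "continuous_on payoff_domain f" for f :: "real \<times> real \<Rightarrow> real"
  proof -
    have "compact (f ` K)" using compact_continuous_image[OF continuous_on_subset[OF that Kd] \<open>compact K\<close>] .
    then obtain B where "\<forall>x\<in>f ` K. \<bar>x\<bar> \<le> B" using compact_imp_bounded bounded_iff by (metis real_norm_def)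
    then show ?thesis by (intro exI[of _ "max B 0"]) (auto simp: le_max_iff_disj)
  qed
  obtain B where B: "0 \<le> B" "\<And>p. p \<in> K \<Longrightarrow> \<bar>F p\<bar> \<le> B" using bdd[OF F(1)] by blast
  obtain C where C: "0 \<le> C" "\<And>p. p \<in> K \<Longrightarrow> \<bar>Fs p\<bar> \<le> C" using bdd[OF F(3)] by blast
  have kG: "k s x = (if c \<le> x \<and> x \<le> s \<and> 0 \<le> s \<and> s \<le> h then Gd (x, s) else 0)" for s x
    by (auto simp: k_def Gd_def payoff_domain_def)
  have kb: "\<bar>k s x\<bar> \<le> C" for s x using C by (auto simp: k_def K_def)
  then show "\<exists>B. \<forall>s x. \<bar>k s x\<bar> \<le> B" by blast
  show km: "(\<lambda>p. k (snd p) (fst p)) \<in> borel_measurable borel"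
    unfolding kG borel_prod[symmetric] by measurable
  have inK: "AE \<omega> in M. (X \<omega>, Y \<omega>) \<in> K \<and> (X \<omega>, max (X \<omega>) 0) \<in> K"
    using bd by eventually_elim (auto simp: K_def)
  have i1: "integrable M (\<lambda>\<omega>. Fd (X \<omega>, Y \<omega>))"
  proof (rule integrable_const_bound[of _ B])
    show "AE \<omega> in M. norm (Fd (X \<omega>, Y \<omega>)) \<le> B" using inK by eventually_elim (use B Kd in \<open>auto simp: Fd_def\<close>)
  qed measurable
  have i2: "integrable M (\<lambda>\<omega>. Fd (X \<omega>, max (X \<omega>) 0))"
  proof (rule integrable_const_bound[of _ B])
    show "AE \<omega> in M. norm (Fd (X \<omega>, max (X \<omega>) 0)) \<le> B" using inK by eventually_elim (use B Kd in \<open>auto simp: Fd_def\<close>)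
  qed measurable
  show "integrable M (\<lambda>\<omega>. if (X \<omega>, Y \<omega>) \<in> payoff_domain then F (X \<omega>, Y \<omega>) else 0)"
    using i1 by (simp add: Fd_def)
  define f where "f \<omega> s = k s (X \<omega>) * indicator {\<omega>. s \<le> Y \<omega>} \<omega>" for \<omega> s
  have fm: "case_prod f \<in> borel_measurable (M \<Otimes>\<^sub>M lborel)"
  proof -
    have kp: "(\<lambda>p. k (snd p) (X (fst p))) \<in> borel_measurable (M \<Otimes>\<^sub>M lborel)"
      using measurable_compose[OF _ km, of "\<lambda>p. (X (fst p), snd p)" "M \<Otimes>\<^sub>M lborel"]
      by (simp add: borel_prod[symmetric])
    have "(\<lambda>p. k (snd p) (X (fst p)) * (if snd p \<le> Y (fst p) then 1 else 0)) \<in> borel_measurable (M \<Otimes>\<^sub>M lborel)"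
      using kp by measurable
    moreover have "case_prod f = (\<lambda>p. k (snd p) (X (fst p)) * (if snd p \<le> Y (fst p) then 1 else 0))"
      by (auto simp: f_def fun_eq_iff indicator_def)
    ultimately show ?thesis by (simp only:)
  qed
  interpret P: pair_sigma_finite M lborel ..
  have fi: "integrable (M \<Otimes>\<^sub>M lborel) (case_prod f)"
  proof (rule integrableI_bounded_set[of "space M \<times> {0..h}" _ _ C])
    show "space M \<times> {0..h} \<in> sets (M \<Otimes>\<^sub>M lborel)" by auto
    have "emeasure (M \<Otimes>\<^sub>M lborel) (space M \<times> {0..h}) = emeasure M (space M) * emeasure lborel {0..h}"
      by (rule lborel.emeasure_pair_measure_Times) auto
    also have "\<dots> = emeasure lborel {0..h}" by (simp add: emeasure_space_1)
    also have "\<dots> < \<infinity>" by (cases "0 \<le> h") auto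
    finally show "emeasure (M \<Otimes>\<^sub>M lborel) (space M \<times> {0..h}) < \<infinity>" .
    have "norm (case_prod f p) \<le> C" for p
      using kb[of "snd p" "X (fst p)"] C(1) by (auto simp: f_def case_prod_beta' indicator_def)
    then show "AE p in M \<Otimes>\<^sub>M lborel. p \<in> space M \<times> {0..h} \<longrightarrow> norm (case_prod f p) \<le> C" by simp
    show "AE p in M \<Otimes>\<^sub>M lborel. p \<notin> space M \<times> {0..h} \<longrightarrow> case_prod f p = 0"
    proof (rule AE_I2, rule impI)
      fix p assume p: "p \<in> space (M \<Otimes>\<^sub>M lborel)" "p \<notin> space M \<times> {0..h}"
      have "snd p \<notin> {0..h}" using p by (cases p) (auto simp: space_pair_measure)
      then have "k (snd p) x = 0" for x by (auto simp: k_def)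
      then show "case_prod f p = 0" by (simp add: f_def case_prod_beta)
    qed
  qed (rule fm)
  show "integrable lborel (\<lambda>s. expectation (\<lambda>\<omega>. k s (X \<omega>) * indicator {\<omega>. s \<le> Y \<omega>} \<omega>))"
    using P.integrable_snd[OF fi] by (simp add: f_def)
  have ftc: "AE \<omega> in M. Fd (X \<omega>, Y \<omega>) - Fd (X \<omega>, max (X \<omega>) 0) = (\<integral>s. f \<omega> s \<partial>lborel)"
    using bd
  proof eventually_elim
    fix \<omega> assume b: "c \<le> X \<omega> \<and> X \<omega> \<le> Y \<omega> \<and> 0 \<le> Y \<omega> \<and> Y \<omega> \<le> h"
    let ?x = "X \<omega>" and ?l = "max (X \<omega>) 0" and ?u = "Y \<omega>"
    have sub: "(?x, s) \<in> payoff_domain" if "s \<in> {?l..?u}" for s using that by (auto simp: payoff_domain_def)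
    have "(\<integral>s. indicator {?l..?u} s *\<^sub>R Fs (?x, s) \<partial>lborel) = F (?x, ?u) - F (?x, ?l)"
    proof (rule integral_FTC_Icc)
      show "?l \<le> ?u" using b by simp
      show "((\<lambda>s. F (?x, s)) has_vector_derivative Fs (?x, s)) (at s within {?l..?u})" if "?l \<le> s" "s \<le> ?u" for s
      proof -
        have "((\<lambda>r. F (?x, r)) has_real_derivative Fs (?x, s)) (at s within {r. (?x, r) \<in> payoff_domain})"
          using F(2) sub[of s] that unfolding has_partial_s_def by auto
        then have "((\<lambda>r. F (?x, r)) has_real_derivative Fs (?x, s)) (at s within {?l..?u})"
          by (rule DERIV_subset) (use sub in auto)
        then show ?thesis by (simp add: has_real_derivative_iff_has_vector_derivative)
      qed
      show "continuous_on {?l..?u} (\<lambda>s. Fs (?x, s))"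
        by (rule continuous_on_compose2[OF F(3)]) (use sub in \<open>auto intro!: continuous_intros\<close>)
    qed
    moreover have "indicator {?l..?u} s *\<^sub>R Fs (?x, s) = f \<omega> s" for s
      using b by (auto simp: f_def k_def indicator_def)
    moreover have "(?x, ?l) \<in> payoff_domain" "(?x, ?u) \<in> payoff_domain" using b by (auto simp: payoff_domain_def)
    ultimately show "Fd (?x, ?u) - Fd (?x, ?l) = (\<integral>s. f \<omega> s \<partial>lborel)" by (simp add: Fd_def)
  qed
  have "expectation (\<lambda>\<omega>. Fd (X \<omega>, Y \<omega>)) - expectation (\<lambda>\<omega>. Fd (X \<omega>, max (X \<omega>) 0))
      = expectation (\<lambda>\<omega>. Fd (X \<omega>, Y \<omega>) - Fd (X \<omega>, max (X \<omega>) 0))" using i1 i2 by simp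
  also have "\<dots> = expectation (\<lambda>\<omega>. \<integral>s. f \<omega> s \<partial>lborel)"
  proof (rule integral_cong_AE)
    show "(\<lambda>\<omega>. \<integral>s. f \<omega> s \<partial>lborel) \<in> borel_measurable M"
      using lborel.borel_measurable_lebesgue_integral[OF fm] by simp
  qed (use ftc in auto)
  also have "\<dots> = (\<integral>s. expectation (\<lambda>\<omega>. f \<omega> s) \<partial>lborel)" using P.Fubini_integral[OF fi] by simp
  finally show "expectation (\<lambda>\<omega>. if (X \<omega>, Y \<omega>) \<in> payoff_domain then F (X \<omega>, Y \<omega>) else 0)
       = expectation (\<lambda>\<omega>. if (X \<omega>, max (X \<omega>) 0) \<in> payoff_domain then F (X \<omega>, max (X \<omega>) 0) else 0)
         + (\<integral>s. expectation (\<lambda>\<omega>. k s (X \<omega>) * indicator {\<omega>. s \<le> Y \<omega>} \<omega>) \<partial>lborel)"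
    by (simp add: Fd_def f_def)
qed

text \<open>
  Subtracting \<open>a (s - w)\<close> from \<open>F\<^sub>s (w, s)\<close> changes the layer \<open>s\<close> by an amount that is the same for both pairs, by the
  Doob identity and equality of the laws.  What remains is at least the mean of its negative part
  \<open>min (F\<^sub>s (w, s) - a (s - w)) 0\<close> over all of \<open>w < s\<close>; the hypothesis on the pair \<open>(X', Y')\<close> says that this bound
  is attained.  On \<open>w = s\<close> the event \<open>s \<le> Y\<close> always occurs, so that this part depends on the law only.
\<close>

lemma payoff_comparison:
  fixes F Fs :: "real \<times> real \<Rightarrow> real" and X Y X' Y' :: "'a \<Rightarrow> real" and c h :: real
  assumes F: "continuous_on payoff_domain F" "has_partial_s F Fs" "continuous_on payoff_domain Fs"
    and m[measurable]: "X \<in> borel_measurable M" "Y \<in> borel_measurable M"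
      "X' \<in> borel_measurable M" "Y' \<in> borel_measurable M"
    and bd: "AE \<omega> in M. c \<le> X \<omega> \<and> X \<omega> \<le> Y \<omega> \<and> 0 \<le> Y \<omega> \<and> Y \<omega> \<le> h"
    and bd': "AE \<omega> in M. c \<le> X' \<omega> \<and> X' \<omega> \<le> Y' \<omega> \<and> 0 \<le> Y' \<omega> \<and> Y' \<omega> \<le> h"
    and law: "distr M borel X = distr M borel X'"
    and doob: "\<And>s. 0 < s \<Longrightarrow> s < h \<Longrightarrow> expectation (\<lambda>\<omega>. (X \<omega> - s) * indicator {\<omega>\<in>space M. s \<le> Y \<omega>} \<omega>) = 0"
    and doob': "\<And>s. 0 < s \<Longrightarrow> s < h \<Longrightarrow> expectation (\<lambda>\<omega>. (X' \<omega> - s) * indicator {\<omega>\<in>space M. s \<le> Y' \<omega>} \<omega>) = 0"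
    and opt: "\<And>s. 0 < s \<Longrightarrow> s < h \<Longrightarrow> \<exists>a. AE \<omega> in M. X' \<omega> < s \<longrightarrow>
       (if s \<le> Y' \<omega> then Fs (X' \<omega>, s) - a * (s - X' \<omega>) \<le> 0 else 0 \<le> Fs (X' \<omega>, s) - a * (s - X' \<omega>))"
  shows "expectation (\<lambda>\<omega>. if (X' \<omega>, Y' \<omega>) \<in> payoff_domain then F (X' \<omega>, Y' \<omega>) else 0)
      \<le> expectation (\<lambda>\<omega>. if (X \<omega>, Y \<omega>) \<in> payoff_domain then F (X \<omega>, Y \<omega>) else 0)"
proof -
  define k where "k s x = (if c \<le> x \<and> x \<le> s \<and> 0 \<le> s \<and> s \<le> h then Fs (x, s) else 0)" for s x
  note L = payoff_layers[OF F m(1,2) bd, folded k_def] and L' = payoff_layers[OF F m(3,4) bd', folded k_def]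
  have transfer: "expectation (\<lambda>\<omega>. g (X \<omega>)) = expectation (\<lambda>\<omega>. g (X' \<omega>))" if g: "g \<in> borel_measurable borel" for g :: "real \<Rightarrow> real"
    using integral_distr[OF m(1) g] integral_distr[OF m(3) g] law by simp
  obtain C where C: "\<And>s x. \<bar>k s x\<bar> \<le> C" using L(4) by blast
  have ks: "k s \<in> borel_measurable borel" for s
    using measurable_compose[OF _ L(5), of "\<lambda>x. (x, s)" borel] by (simp add: borel_prod[symmetric])
  have bX: "AE \<omega> in M. \<bar>X \<omega>\<bar> \<le> max (- c) h" using bd by eventually_elim auto
  have bX': "AE \<omega> in M. \<bar>X' \<omega>\<bar> \<le> max (- c) h" using bd' by eventually_elim auto
  have layer: "expectation (\<lambda>\<omega>. k s (X' \<omega>) * indicator {\<omega>. s \<le> Y' \<omega>} \<omega>)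
      \<le> expectation (\<lambda>\<omega>. k s (X \<omega>) * indicator {\<omega>. s \<le> Y \<omega>} \<omega>)" if s: "0 < s" "s < h" for s
  proof -
    obtain a where a: "AE \<omega> in M. X' \<omega> < s \<longrightarrow>
       (if s \<le> Y' \<omega> then Fs (X' \<omega>, s) - a * (s - X' \<omega>) \<le> 0 else 0 \<le> Fs (X' \<omega>, s) - a * (s - X' \<omega>))"
      using opt[OF s] by blast
    \<comment> \<open>the part \<open>p\<close> is what an optimal pair retains of the integrand \<open>q\<close>; at \<open>x = s\<close> nothing can be discarded\<close>
    define q where "q x = k s x - a * max (s - x) 0" for x
    define p where "p x = (if x < s then min (q x) 0 else q x)" for x
    have [measurable]: "k s \<in> borel_measurable borel" by (rule ks)
    have qm[measurable]: "q \<in> borel_measurable borel" unfolding q_def by measurable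
    have pm[measurable]: "p \<in> borel_measurable borel" unfolding p_def by measurable
    have key: "expectation (\<lambda>\<omega>. k s (V \<omega>) * indicator {\<omega>. s \<le> U \<omega>} \<omega>)
        = expectation (\<lambda>\<omega>. q (V \<omega>) * indicator {\<omega>\<in>space M. s \<le> U \<omega>} \<omega>) + a * expectation (\<lambda>\<omega>. max (V \<omega> - s) 0)
       \<and> integrable M (\<lambda>\<omega>. q (V \<omega>) * indicator {\<omega>\<in>space M. s \<le> U \<omega>} \<omega>) \<and> integrable M (\<lambda>\<omega>. p (V \<omega>))"
      if V[measurable]: "V \<in> borel_measurable M" "U \<in> borel_measurable M" and b: "AE \<omega> in M. \<bar>V \<omega>\<bar> \<le> max (- c) h"
        and VU: "AE \<omega> in M. V \<omega> \<le> U \<omega>"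
        and d: "expectation (\<lambda>\<omega>. (V \<omega> - s) * indicator {\<omega>\<in>space M. s \<le> U \<omega>} \<omega>) = 0" for V U :: "'a \<Rightarrow> real"
    proof -
      let ?E = "{\<omega>\<in>space M. s \<le> U \<omega>}"
      have Em[measurable]: "?E \<in> sets M" by measurable
      have Vi: "integrable M V" by (rule integrable_const_bound[of _ "max (- c) h"]) (use b in auto)
      have ki: "integrable M (\<lambda>\<omega>. k s (V \<omega>))" by (rule integrable_const_bound[of _ C]) (use C in auto)
      have mi: "integrable M (\<lambda>\<omega>. max (s - V \<omega>) 0)" "integrable M (\<lambda>\<omega>. max (V \<omega> - s) 0)"
        using Vi by (auto intro!: Bochner_Integration.integrable_max)
      have qi: "integrable M (\<lambda>\<omega>. q (V \<omega>))" unfolding q_def using ki mi by simp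
      note ind = integrable_real_mult_indicator[OF Em]
      have pi: "integrable M (\<lambda>\<omega>. p (V \<omega>))"
        by (rule Bochner_Integration.integrable_bound[OF qi]) (auto simp: p_def)
      have vi: "integrable M (\<lambda>\<omega>. (V \<omega> - s) * indicator ?E \<omega>)" by (rule ind) (use Vi in auto)
      have "expectation (\<lambda>\<omega>. k s (V \<omega>) * indicator {\<omega>. s \<le> U \<omega>} \<omega>)
         = expectation (\<lambda>\<omega>. q (V \<omega>) * indicator ?E \<omega> + a * (max (V \<omega> - s) 0 - (V \<omega> - s) * indicator ?E \<omega>))"
      proof (rule integral_cong_AE)
        show "AE \<omega> in M. k s (V \<omega>) * indicator {\<omega>. s \<le> U \<omega>} \<omega>
           = q (V \<omega>) * indicator ?E \<omega> + a * (max (V \<omega> - s) 0 - (V \<omega> - s) * indicator ?E \<omega>)"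
          using VU AE_space
        proof eventually_elim
          fix \<omega> assume *: "V \<omega> \<le> U \<omega>" "\<omega> \<in> space M"
          show "k s (V \<omega>) * indicator {\<omega>. s \<le> U \<omega>} \<omega>
             = q (V \<omega>) * indicator ?E \<omega> + a * (max (V \<omega> - s) 0 - (V \<omega> - s) * indicator ?E \<omega>)"
          proof (cases "s \<le> U \<omega>")
            case True
            have "max (V \<omega> - s) 0 - (V \<omega> - s) = max (s - V \<omega>) 0" by (simp add: max_def)
            then show ?thesis using True * by (simp add: q_def)
          next
            case False then show ?thesis using * by simp
          qed
        qed
      qed measurable
      also have "\<dots> = expectation (\<lambda>\<omega>. q (V \<omega>) * indicator ?E \<omega>) + a * (expectation (\<lambda>\<omega>. max (V \<omega> - s) 0) - 0)"
        using ind[OF qi] mi vi d by simp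
      finally show ?thesis using ind[OF qi] pi by simp
    qed
    have XY: "AE \<omega> in M. X \<omega> \<le> Y \<omega>" "AE \<omega> in M. X' \<omega> \<le> Y' \<omega>" using bd bd' by (auto elim!: eventually_mono)
    note K = key[OF m(1,2) bX XY(1) doob[OF s]] and K' = key[OF m(3,4) bX' XY(2) doob'[OF s]]
    have tm: "expectation (\<lambda>\<omega>. max (X \<omega> - s) 0) = expectation (\<lambda>\<omega>. max (X' \<omega> - s) 0)" by (rule transfer) measurable
    have tp: "expectation (\<lambda>\<omega>. p (X \<omega>)) = expectation (\<lambda>\<omega>. p (X' \<omega>))" by (rule transfer) measurable
    have above: "q x = 0" if "s < x" for x using that by (simp add: q_def k_def)
    have "expectation (\<lambda>\<omega>. q (X' \<omega>) * indicator {\<omega>\<in>space M. s \<le> Y' \<omega>} \<omega>) = expectation (\<lambda>\<omega>. p (X' \<omega>))"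
    proof (rule integral_cong_AE)
      show "AE \<omega> in M. q (X' \<omega>) * indicator {\<omega>\<in>space M. s \<le> Y' \<omega>} \<omega> = p (X' \<omega>)"
        using a bd' AE_space
      proof eventually_elim
        fix \<omega> assume *: "X' \<omega> < s \<longrightarrow> (if s \<le> Y' \<omega> then Fs (X' \<omega>, s) - a * (s - X' \<omega>) \<le> 0 else 0 \<le> Fs (X' \<omega>, s) - a * (s - X' \<omega>))"
          "c \<le> X' \<omega> \<and> X' \<omega> \<le> Y' \<omega> \<and> 0 \<le> Y' \<omega> \<and> Y' \<omega> \<le> h" "\<omega> \<in> space M"
        show "q (X' \<omega>) * indicator {\<omega>\<in>space M. s \<le> Y' \<omega>} \<omega> = p (X' \<omega>)"
        proof (cases "X' \<omega> < s")
          case True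
          then have "q (X' \<omega>) = Fs (X' \<omega>, s) - a * (s - X' \<omega>)" using *(2) s by (simp add: q_def k_def)
          then show ?thesis using *(1,3) True by (cases "s \<le> Y' \<omega>") (auto simp: p_def min_def)
        next
          case False
          then have "s \<le> Y' \<omega>" using *(2) by simp
          then show ?thesis using False *(3) by (simp add: p_def)
        qed
      qed
    qed measurable
    also have "\<dots> = expectation (\<lambda>\<omega>. p (X \<omega>))" using tp by simp
    also have "\<dots> \<le> expectation (\<lambda>\<omega>. q (X \<omega>) * indicator {\<omega>\<in>space M. s \<le> Y \<omega>} \<omega>)"
    proof (rule integral_mono_AE)
      show "AE \<omega> in M. p (X \<omega>) \<le> q (X \<omega>) * indicator {\<omega>\<in>space M. s \<le> Y \<omega>} \<omega>"
        using XY(1) AE_space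
      proof eventually_elim
        fix \<omega> assume *: "X \<omega> \<le> Y \<omega>" "\<omega> \<in> space M"
        show "p (X \<omega>) \<le> q (X \<omega>) * indicator {\<omega>\<in>space M. s \<le> Y \<omega>} \<omega>"
          using * by (cases "X \<omega> < s"; cases "s \<le> Y \<omega>") (auto simp: p_def)
      qed
    qed (use K in auto)
    finally show ?thesis using K K' tm by simp
  qed
  have "(\<integral>s. expectation (\<lambda>\<omega>. k s (X' \<omega>) * indicator {\<omega>. s \<le> Y' \<omega>} \<omega>) \<partial>lborel)
     \<le> (\<integral>s. expectation (\<lambda>\<omega>. k s (X \<omega>) * indicator {\<omega>. s \<le> Y \<omega>} \<omega>) \<partial>lborel)"
  proof (rule integral_mono_AE[OF L'(2) L(2)])
    show "AE s in lborel. expectation (\<lambda>\<omega>. k s (X' \<omega>) * indicator {\<omega>. s \<le> Y' \<omega>} \<omega>)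
       \<le> expectation (\<lambda>\<omega>. k s (X \<omega>) * indicator {\<omega>. s \<le> Y \<omega>} \<omega>)"
      using AE_lborel_singleton[of 0] AE_lborel_singleton[of h]
    proof eventually_elim
      fix s :: real assume ne: "s \<noteq> 0" "s \<noteq> h"
      show "expectation (\<lambda>\<omega>. k s (X' \<omega>) * indicator {\<omega>. s \<le> Y' \<omega>} \<omega>)
       \<le> expectation (\<lambda>\<omega>. k s (X \<omega>) * indicator {\<omega>. s \<le> Y \<omega>} \<omega>)"
      proof (cases "0 < s \<and> s < h")
        case True then show ?thesis using layer by simp
      next
        case False
        then have "k s x = 0" for x using ne by (auto simp: k_def)
        then show ?thesis by simp
      qed
    qed
  qed
  moreover have "expectation (\<lambda>\<omega>. if (X \<omega>, max (X \<omega>) 0) \<in> payoff_domain then F (X \<omega>, max (X \<omega>) 0) else 0)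
      = expectation (\<lambda>\<omega>. if (X' \<omega>, max (X' \<omega>) 0) \<in> payoff_domain then F (X' \<omega>, max (X' \<omega>) 0) else 0)"
  proof -
    have d: "(x, max x 0) \<in> payoff_domain" for x :: real by (auto simp: payoff_domain_def)
    have "continuous_on UNIV (\<lambda>x. F (x, max x 0))"
      by (rule continuous_on_compose2[OF F(1)]) (use d in \<open>auto intro!: continuous_intros\<close>)
    then have "(\<lambda>x. F (x, max x 0)) \<in> borel_measurable borel" by (rule borel_measurable_continuous_onI)
    from transfer[OF this] show ?thesis using d by simp
  qed
  ultimately show ?thesis using L(3) L'(3) by simp
qed

end

section \<open>Optimality of the two embeddings\<close>

context skorokhod begin

lemma sup_at_time_le:
  assumes f: "AE \<omega> in M. \<tau> \<omega> < \<top>"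
    and rng: "AE \<omega> in M. \<forall>t\<ge>0. c \<le> stopped_process W \<tau> t \<omega> \<and> stopped_process W \<tau> t \<omega> \<le> h"
  shows "AE \<omega> in M. at_time (running_sup W) \<tau> \<omega> \<le> h"
  using AE_continuous_path f rng
proof eventually_elim
  fix \<omega> assume g: "continuous_path \<omega>" and f: "\<tau> \<omega> < \<top>"
    and r: "\<forall>t\<ge>0. c \<le> stopped_process W \<tau> t \<omega> \<and> stopped_process W \<tau> t \<omega> \<le> h"
  obtain T where T: "\<tau> \<omega> = ennreal T" "0 \<le> T" using f by (cases "\<tau> \<omega>") auto
  obtain v where v: "0 \<le> v" "v \<le> T" "W v \<omega> = running_sup W T \<omega>" using sup_attained[OF g T(2)] by metis
  have "stopped_process W \<tau> v \<omega> = W v \<omega>"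
    using v T by (simp add: stopped_process_def at_time_def min_def ennreal_leI)
  then have "W v \<omega> \<le> h" using r v(1) by metis
  then show "at_time (running_sup W) \<tau> \<omega> \<le> h" using v T by (simp add: at_time_def)
qed

lemma ui_embedding_range:
  assumes "\<tau> \<in> ui_embeddings M \<F> W \<mu>"
  shows "stopping_time \<F> \<tau>" "AE \<omega> in M. \<tau> \<omega> < \<top>"
    "AE \<omega> in M. \<forall>t\<ge>0. c \<le> stopped_process W \<tau> t \<omega> \<and> stopped_process W \<tau> t \<omega> \<le> h"
    "distr M borel (at_time W \<tau>) = \<mu>"
proof -
  have \<tau>: "stopping_time \<F> \<tau>" "AE \<omega> in M. \<tau> \<omega> < \<top>" "at_time W \<tau> \<in> borel_measurable M"
    "distr M borel (at_time W \<tau>) = \<mu>" "uniformly_integrable M {0..} (stopped_process W \<tau>)"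
    using assms by (auto simp: ui_embeddings_def embeddings_def)
  then show "stopping_time \<F> \<tau>" "AE \<omega> in M. \<tau> \<omega> < \<top>" "distr M borel (at_time W \<tau>) = \<mu>" by auto
  have "AE y in distr M borel (at_time W \<tau>). c \<le> y \<and> y \<le> h" unfolding \<tau>(4) by (rule conc)
  then have "AE \<omega> in M. c \<le> at_time W \<tau> \<omega> \<and> at_time W \<tau> \<omega> \<le> h"
    by (subst (asm) AE_distr_iff[OF \<tau>(3)]) auto
  then show "AE \<omega> in M. \<forall>t\<ge>0. c \<le> stopped_process W \<tau> t \<omega> \<and> stopped_process W \<tau> t \<omega> \<le> h"
    using c0 h0 by (intro ui_range[OF \<tau>(1,2,5)]) auto
qed

lemma ui_embedding_pair:
  assumes e: "\<tau> \<in> ui_embeddings M \<F> W \<mu>"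
  shows "at_time W \<tau> \<in> borel_measurable M" "at_time (running_sup W) \<tau> \<in> borel_measurable M"
    "AE \<omega> in M. c \<le> at_time W \<tau> \<omega> \<and> at_time W \<tau> \<omega> \<le> at_time (running_sup W) \<tau> \<omega>
       \<and> 0 \<le> at_time (running_sup W) \<tau> \<omega> \<and> at_time (running_sup W) \<tau> \<omega> \<le> h"
proof -
  note E = ui_embedding_range[OF e]
  show "at_time W \<tau> \<in> borel_measurable M" "at_time (running_sup W) \<tau> \<in> borel_measurable M"
    using at_time_measurable[OF E(1,2)] sup_at_time_measurable[OF E(1,2)] by auto
  show "AE \<omega> in M. c \<le> at_time W \<tau> \<omega> \<and> at_time W \<tau> \<omega> \<le> at_time (running_sup W) \<tau> \<omega>
       \<and> 0 \<le> at_time (running_sup W) \<tau> \<omega> \<and> at_time (running_sup W) \<tau> \<omega> \<le> h"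
    using bounded_until_law(1)[OF E(1-3)] sup_at_time_zero[OF E(2)] sup_at_time_le[OF E(2,3)]
    by eventually_elim auto
qed

lemma ui_embedding_comparison:
  assumes F: "continuous_on payoff_domain F" "has_partial_s F Fs" "continuous_on payoff_domain Fs"
    and e: "\<tau> \<in> ui_embeddings M \<F> W \<mu>" "\<sigma> \<in> ui_embeddings M \<F> W \<mu>"
    and opt: "\<And>s. 0 < s \<Longrightarrow> s < h \<Longrightarrow> \<exists>a. AE \<omega> in M. at_time W \<sigma> \<omega> < s \<longrightarrow>
       (if s \<le> at_time (running_sup W) \<sigma> \<omega> then Fs (at_time W \<sigma> \<omega>, s) - a * (s - at_time W \<sigma> \<omega>) \<le> 0
        else 0 \<le> Fs (at_time W \<sigma> \<omega>, s) - a * (s - at_time W \<sigma> \<omega>))"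
  defines "E \<equiv> \<lambda>\<tau>. expectation (\<lambda>\<omega>. if (at_time W \<tau> \<omega>, at_time (running_sup W) \<tau> \<omega>) \<in> payoff_domain
      then F (at_time W \<tau> \<omega>, at_time (running_sup W) \<tau> \<omega>) else 0)"
  shows "E \<sigma> \<le> E \<tau>"
proof -
  note R = ui_embedding_range[OF e(1)] and R' = ui_embedding_range[OF e(2)]
  note P = ui_embedding_pair[OF e(1)] and P' = ui_embedding_pair[OF e(2)]
  show ?thesis unfolding E_def
  proof (rule payoff_comparison[OF F P(1,2) P'(1,2) P(3) P'(3) _ _ _ opt])
    show "distr M borel (at_time W \<tau>) = distr M borel (at_time W \<sigma>)" using R(4) R'(4) by simp
  qed (use doob_law[OF R(1-3)] doob_law[OF R'(1-3)] in auto)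
qed

lemma expected_payoff_eq:
  assumes F: "continuous_on payoff_domain F" "has_partial_s F Fs" "continuous_on payoff_domain Fs"
    and nn: "\<And>w s. (w, s) \<in> payoff_domain \<Longrightarrow> 0 \<le> F (w, s)"
    and e: "\<tau> \<in> ui_embeddings M \<F> W \<mu>"
  shows "expected_payoff M W F \<tau> = ennreal (expectation (\<lambda>\<omega>. if (at_time W \<tau> \<omega>, at_time (running_sup W) \<tau> \<omega>) \<in> payoff_domain
      then F (at_time W \<tau> \<omega>, at_time (running_sup W) \<tau> \<omega>) else 0))"
proof -
  note P = ui_embedding_pair[OF e]
  let ?F = "\<lambda>\<omega>. if (at_time W \<tau> \<omega>, at_time (running_sup W) \<tau> \<omega>) \<in> payoff_domain
      then F (at_time W \<tau> \<omega>, at_time (running_sup W) \<tau> \<omega>) else 0"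
  have i: "integrable M ?F" by (rule payoff_layers(1)[OF F P])
  have "expected_payoff M W F \<tau> = (\<integral>\<^sup>+\<omega>. ennreal (?F \<omega>) \<partial>M)"
    unfolding expected_payoff_def
  proof (rule nn_integral_cong_AE)
    show "AE \<omega> in M. ennreal (F (at_time W \<tau> \<omega>, at_time (running_sup W) \<tau> \<omega>)) = ennreal (?F \<omega>)"
      using P(3) by eventually_elim (auto simp: payoff_domain_def)
  qed
  also have "\<dots> = ennreal (expectation ?F)" by (rule nn_integral_eq_integral[OF i]) (auto simp: nn)
  finally show ?thesis .
qed

end

text \<open>
  The function \<open>F\<^sub>s (x, s) / (s - x) - F\<^sub>s (b, s) / (s - b)\<close> changes sign at \<open>b\<close>.
\<close>

lemma F_MON_sign:
  assumes mon: "F_MON_down Fs" and s: "0 < s" and b: "b < s" "x < s"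
  shows "b \<le> x \<Longrightarrow> Fs (x, s) - Fs (b, s) / (s - b) * (s - x) \<le> 0"
    "x \<le> b \<Longrightarrow> 0 \<le> Fs (x, s) - Fs (b, s) / (s - b) * (s - x)"
proof -
  have m: "Fs (v, s) / (s - v) \<le> Fs (u, s) / (s - u)" if "u \<le> v" "v < s" for u v
    using mon s that unfolding F_MON_down_def monotone_on_def by auto
  have e: "Fs (x, s) = Fs (x, s) / (s - x) * (s - x)" using b by simp
  show "Fs (x, s) - Fs (b, s) / (s - b) * (s - x) \<le> 0" if "b \<le> x"
    using mult_right_mono[OF m[OF that b(2)], of "s - x"] b e by simp
  show "0 \<le> Fs (x, s) - Fs (b, s) / (s - b) * (s - x)" if "x \<le> b"
    using mult_right_mono[OF m[OF that b(1)], of "s - x"] b e by simp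
qed

theorem theorem5p11:
  fixes M :: "'a measure" and \<F> :: "ennreal \<Rightarrow> 'a measure"
    and W :: "real \<Rightarrow> 'a \<Rightarrow> real" and Z :: "'a \<Rightarrow> real"
    and \<mu> :: "real measure" and F Fs :: "real \<times> real \<Rightarrow> real"
  assumes "usual_filtered_prob_space M \<F>"
    and "brownian_motion M \<F> W"
    and "uniform_rv M Z" and "Z \<in> borel_measurable (\<F> 0)" and "indep_of_process M Z W"
    and "real_distribution \<mu>" and "centered \<mu>" and "\<mu> \<noteq> return borel 0"
    and "bounded (measure_support \<mu>)"
    and "\<And>w s. (w, s) \<in> payoff_domain \<Longrightarrow> 0 \<le> F (w, s)"
    and "continuous_on payoff_domain F"
    and "has_partial_s F Fs" and "continuous_on payoff_domain Fs"
    and "F_MON_down Fs"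
  shows "(INF \<tau>\<in>ui_embeddings M \<F> W \<mu>. expected_payoff M W F \<tau>) = expected_payoff M W F (tau_AY \<mu> W)
       \<and> (SUP \<tau>\<in>ui_embeddings M \<F> W \<mu>. expected_payoff M W F \<tau>) = expected_payoff M W F (tau_perkins \<mu> W Z)"
proof -
  obtain c h where t: "target \<mu> c h" using target_exists assms(6-9) by blast
  interpret skorokhod_randomised M \<F> W \<mu> c h Z
    by (intro skorokhod_randomised.intro skorokhod.intro brownian.intro brownian_axioms.intro
        skorokhod_randomised_axioms.intro assms t)
  note F = assms(11-13) and mon = assms(14)
  note Fn = continuous_on_minus[OF F(1)] continuous_on_minus[OF F(3)]
  have part: "has_partial_s (\<lambda>p. - F p) (\<lambda>p. - Fs p)"
    using F(2) unfolding has_partial_s_def by (auto intro!: DERIV_minus)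
  define E where "E \<tau> = expectation (\<lambda>\<omega>. if (at_time W \<tau> \<omega>, at_time (running_sup W) \<tau> \<omega>) \<in> payoff_domain
      then F (at_time W \<tau> \<omega>, at_time (running_sup W) \<tau> \<omega>) else 0)" for \<tau>
  have pay: "expected_payoff M W F \<tau> = ennreal (E \<tau>)" if "\<tau> \<in> ui_embeddings M \<F> W \<mu>" for \<tau>
    unfolding E_def by (rule expected_payoff_eq[OF F assms(10) that])
  have AY: "E (tau_AY \<mu> W) \<le> E \<tau>" if e: "\<tau> \<in> ui_embeddings M \<F> W \<mu>" for \<tau>
    unfolding E_def
  proof (rule ui_embedding_comparison[OF F e tau_AY_embeds])
    fix s assume s: "0 < s" "s < h"
    let ?X = "at_time W (tau_AY \<mu> W)" and ?Y = "at_time (running_sup W) (tau_AY \<mu> W)"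
    have b: "beta s < s" using beta_arg_min(3)[OF s] .
    have "AE \<omega> in M. ?X \<omega> < s \<longrightarrow> (if s \<le> ?Y \<omega> then Fs (?X \<omega>, s) - Fs (beta s, s) / (s - beta s) * (s - ?X \<omega>) \<le> 0
        else 0 \<le> Fs (?X \<omega>, s) - Fs (beta s, s) / (s - beta s) * (s - ?X \<omega>))"
      using tau_AY_threshold
    proof eventually_elim
      case (elim \<omega>)
      show ?case using elim[rule_format, OF s] F_MON_sign[OF mon s(1) b, of "?X \<omega>"] by auto
    qed
    then show "\<exists>a. AE \<omega> in M. ?X \<omega> < s \<longrightarrow> (if s \<le> ?Y \<omega> then Fs (?X \<omega>, s) - a * (s - ?X \<omega>) \<le> 0
        else 0 \<le> Fs (?X \<omega>, s) - a * (s - ?X \<omega>))" by blast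
  qed
  have neg: "(if P then - x else 0) = - (if P then x else (0::real))" for P x by simp
  have Pk: "E \<tau> \<le> E (tau_perkins \<mu> W Z)" if e: "\<tau> \<in> ui_embeddings M \<F> W \<mu>" for \<tau>
  proof -
    have "- E (tau_perkins \<mu> W Z) \<le> - E \<tau>"
      unfolding E_def integral_minus[symmetric] neg[symmetric]
    proof (rule ui_embedding_comparison[OF Fn(1) part Fn(2) e tau_perkins_embeds])
      fix s assume s: "0 < s" "s < h"
      let ?X = "at_time W (tau_perkins \<mu> W Z)" and ?Y = "at_time (running_sup W) (tau_perkins \<mu> W Z)"
      let ?a = "Fs (alpha s, s) / (s - alpha s)"
      have b: "alpha s < s" using alpha_arg_max(3)[OF s] s by simp
      have "AE \<omega> in M. ?X \<omega> < s \<longrightarrow> (if s \<le> ?Y \<omega> then - Fs (?X \<omega>, s) - (- ?a) * (s - ?X \<omega>) \<le> 0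
          else 0 \<le> - Fs (?X \<omega>, s) - (- ?a) * (s - ?X \<omega>))"
        using tau_perkins_position
      proof eventually_elim
        case (elim \<omega>)
        then have "(?Y \<omega> < s \<longrightarrow> alpha s \<le> ?X \<omega>) \<and> (s \<le> ?Y \<omega> \<longrightarrow> ?X \<omega> < s \<longrightarrow> ?X \<omega> \<le> alpha s)"
          using s by blast
        then show ?case using F_MON_sign[OF mon s(1) b, of "?X \<omega>"] by auto
      qed
      then show "\<exists>a. AE \<omega> in M. ?X \<omega> < s \<longrightarrow> (if s \<le> ?Y \<omega> then - Fs (?X \<omega>, s) - a * (s - ?X \<omega>) \<le> 0
          else 0 \<le> - Fs (?X \<omega>, s) - a * (s - ?X \<omega>))" by blast
    qed
    then show ?thesis by simp
  qed
  have "(INF \<tau>\<in>ui_embeddings M \<F> W \<mu>. expected_payoff M W F \<tau>) = expected_payoff M W F (tau_AY \<mu> W)"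
    by (rule antisym[OF INF_lower[OF tau_AY_embeds] INF_greatest])
       (use AY pay tau_AY_embeds in \<open>auto intro: ennreal_leI\<close>)
  moreover have "(SUP \<tau>\<in>ui_embeddings M \<F> W \<mu>. expected_payoff M W F \<tau>) = expected_payoff M W F (tau_perkins \<mu> W Z)"
    by (rule antisym[OF SUP_least SUP_upper[OF tau_perkins_embeds]])
       (use Pk pay tau_perkins_embeds in \<open>auto intro: ennreal_leI\<close>)
  ultimately show ?thesis by simp
qed

end
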